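(* Let $V$ be the generalized Vilenkin group associated with a dilation matrix $M$ and a set of digits $D(M)$, and let $m=|\det M|$. Let $\varphi\in L_2(V)$ be an orthogonal compactly supported refinable function with $\widehat\varphi(\theta)=1$. Then a wavelet system $\{\psi^{(\nu)}_{jk}\mid j\in\mathbb Z,\ k\in\mathbb Z_+,\ \nu=1,\dots,m-1\}$ generated by $\varphi$ is an orthonormal basis in $L_2(V)$.
   Context: A dilation matrix is an integer $d\times d$ matrix $M$ all of whose eigenvalues are greater than $1$ in absolute value; $m:=|\det M|$ and $M^*$ is the transpose of $M$. Vectors $l,k\in\mathbb Z^d$ are congruent modulo $M$ if $l-k=Ms$ for some $s\in\mathbb Z^d$. A set of digits for $M$ is a set $D(M)=\{s_0,\dots,s_{m-1}\}\subset\mathbb Z^d$ with $s_0=\mathbf 0$ and $s_i\not\equiv s_j \pmod M$ for $i\ne j$. The generalized Vilenkin group $V$ associated with $M$ and $D(M)$ consists of all sequences $x=\{x_j\}_{j\in\mathbb Z}$ with $x_j\in D(M)$ and $x_j\neq\mathbf 0$ for only finitely many negative $j$, with coordinate-wise addition modulo $M$, denoted $\oplus$ (i.e. $(x\oplus y)_j$ is the element of $D(M)$ congruent to $x_j+y_j$ modulo $M$). A base of neighbourhoods of the neutral element $\theta$ is given by $U_l:=\{x\in V: x_j=\mathbf 0\text{ for all }j\le l\}$, $l\in\mathbb Z$; $U:=U_0$. $V$ is a locally compact abelian group with Haar measure $\mu$ normalized by $\mu(U)=1$. $H:=\{x\in V: x_j=\mathbf 0\text{ for all }j>0\}$. The map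 $\mathcal M:V\to V$ is the shift $(\mathcal M x)_j=x_{j+1}$. For $k\in\mathbb Z_+=\{0,1,2,\dots\}$ with $m$-ary expansion $k=\sum_{j\ge0}k_jm^j$, $k_j\in\{0,\dots,m-1\}$, $\gamma_{[k]}$ is the element of $H$ with $(\gamma_{[k]})_{-j}=s_{k_j}$, $j\ge 0$. $V^*$ is the generalized Vilenkin group associated with the matrix $M^*$ and a set of digits $D^*=D(M^* )=\{s_0^*,\dots,s_{m-1}^*\}$, $s_0^*=\mathbf 0$; $U_l^*,U^*,H^*,\mu^*,\mathcal M^*$ are defined for $V^*$ in the same way, and $\theta$ also denotes the neutral element of $V^*$. A digit $q\in D^*$ is identified with the element of $H^*$ whose coordinate with index $0$ is $q$ and whose other coordinates are $\mathbf 0$. For $x\in V$, $\omega\in V^*$ put $\chi(x,\omega)=\exp\big(2\pi i\sum_{j\in\mathbb Z}\langle M^{-1}x_j,\omega_{1-j}\rangle\big)$. The Fourier transform of $f\in L_1(V)$ is $\widehat f(\omega)=\int_V f(x)\overline{\chi(x,\omega)}\,d\mu(x)$, $\omega\in V^*$, extended to $L_2(V)$ in the standard way. The Walsh functions on $V^*$ are $W_k:=\chi(\gamma_{[k]},\cdot)$, $k\in\mathbb Z_+$; a Walsh polynomial is a finite linear combination of Walsh functions. A function $\varphi\in L_2(V)$ is refinable if there are numbers $\alpha_k$, $k\in\mathbb Z_+$, such that $\varphi(x)=\sum_{k=0}^\infty\alpha_k\varphi(\mathcal M x\oplus\gamma_{[k]})$ for all $x\in V$. For a compactly supported refinable $\varphi$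 it is known that $\widehat\varphi=m_0({\mathcal M^*}^{-1}\cdot)\,\widehat\varphi({\mathcal M^*}^{-1}\cdot)$ for a Walsh polynomial $m_0$ on $V^*$, called the mask of $\varphi$. A refinable function $\varphi$ is orthogonal if the system $\{\varphi(\cdot\oplus h)\mid h\in H\}$ is orthonormal in $L_2(V)$. Wavelet system generated by $\varphi$ (with $m-1$ wavelet functions): let $m_0$ be the mask of $\varphi$ and let $m_1,\dots,m_{m-1}$ be Walsh polynomials on $V^*$ such that for all $k,l\in\{0,\dots,m-1\}$ $$\sum_{\nu=0}^{m-1}m_\nu\big({\mathcal M^*}^{-1}(\omega\oplus s_k^* )\big)\overline{m_\nu\big({\mathcal M^*}^{-1}(\omega\oplus s_l^* )\big)}=\delta_{kl}\quad\text{for all }\omega\in V^*.$$ The wavelet functions $\psi^{(\nu)}$ are defined by $\widehat{\psi^{(\nu)}}=m_\nu({\mathcal M^*}^{-1}\cdot)\,\widehat\varphi({\mathcal M^*}^{-1}\cdot)$, $\nu=1,\dots,m-1$, and the corresponding wavelet system generated by $\varphi$ is $\psi^{(\nu)}_{jk}(x):=m^{j/2}\psi^{(\nu)}(\mathcal M^jx\oplus\gamma_{[k]})$, $\nu=1,\dots,m-1$, $j\in\mathbb Z$, $k\in\mathbb Z_+$. *)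

theory Defs
  imports "HOL-Analysis.Analysis"
begin

section \<open>Dilation matrices and digits\<close>

definition vec_of_int :: "int ^ 'd \<Rightarrow> ('a::ring_1) ^ 'd" where
  "vec_of_int v = (\<chi> i. of_int (v $ i))"

definition mat_of_int :: "int ^ 'd ^ 'd \<Rightarrow> ('a::ring_1) ^ 'd ^ 'd" where
  "mat_of_int M = (\<chi> i j. of_int (M $ i $ j))"

text \<open>All complex eigenvalues of an integer matrix are taken into account.\<close>

definition dilation_matrix :: "int ^ 'd ^ 'd \<Rightarrow> bool" where
  "dilation_matrix M \<longleftrightarrow>
    (\<forall>(c::complex) (v::complex ^ 'd).
       v \<noteq> 0 \<longrightarrow> mat_of_int M *v v = c *s v \<longrightarrow> 1 < cmod c)"

definition abs_det :: "int ^ 'd ^ 'd \<Rightarrow> nat" where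
  "abs_det M = nat \<bar>det M\<bar>"

definition congruent_mod :: "int ^ 'd ^ 'd \<Rightarrow> int ^ 'd \<Rightarrow> int ^ 'd \<Rightarrow> bool" where
  "congruent_mod M l k \<longleftrightarrow> (\<exists>u. l - k = M *v u)"

text \<open>A set of digits is given together with its enumeration \<open>s 0, \<dots>, s (abs_det M - 1)\<close>;
  the values of \<open>s\<close> at larger arguments are irrelevant.\<close>

definition digit_set :: "int ^ 'd ^ 'd \<Rightarrow> (nat \<Rightarrow> int ^ 'd) \<Rightarrow> bool" where
  "digit_set M s \<longleftrightarrow>
    s 0 = 0 \<and>
    (\<forall>i < abs_det M. \<forall>j < abs_det M. i \<noteq> j \<longrightarrow> \<not> congruent_mod M (s i) (s j))"

definition digits :: "int ^ 'd ^ 'd \<Rightarrow> (nat \<Rightarrow> int ^ 'd) \<Rightarrow> (int ^ 'd) set" where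
  "digits M s = s ` {..<abs_det M}"

definition digit_of :: "int ^ 'd ^ 'd \<Rightarrow> (nat \<Rightarrow> int ^ 'd) \<Rightarrow> int ^ 'd \<Rightarrow> int ^ 'd" where
  "digit_of M s v = (THE q. q \<in> digits M s \<and> congruent_mod M q v)"


section \<open>The generalized Vilenkin group\<close>

type_synonym 'd vseq = "int \<Rightarrow> int ^ 'd"

definition vilenkin :: "int ^ 'd ^ 'd \<Rightarrow> (nat \<Rightarrow> int ^ 'd) \<Rightarrow> 'd vseq set" where
  "vilenkin M s = {x. (\<forall>j. x j \<in> digits M s) \<and> finite {j. j < 0 \<and> x j \<noteq> 0}}"

definition vadd :: "int ^ 'd ^ 'd \<Rightarrow> (nat \<Rightarrow> int ^ 'd) \<Rightarrow> 'd vseq \<Rightarrow> 'd vseq \<Rightarrow> 'd vseq" where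
  "vadd M s x y = (\<lambda>j. digit_of M s (x j + y j))"

definition vzero :: "('d::finite) vseq" where
  "vzero = (\<lambda>_. 0)"

definition vnbhd :: "int ^ 'd ^ 'd \<Rightarrow> (nat \<Rightarrow> int ^ 'd) \<Rightarrow> int \<Rightarrow> 'd vseq set" where
  "vnbhd M s l = {x \<in> vilenkin M s. \<forall>j \<le> l. x j = 0}"

definition vlattice :: "int ^ 'd ^ 'd \<Rightarrow> (nat \<Rightarrow> int ^ 'd) \<Rightarrow> 'd vseq set" where
  "vlattice M s = {x \<in> vilenkin M s. \<forall>j > 0. x j = 0}"

text \<open>\<open>vshift n\<close> is the \<open>n\<close>-th power of the shift \<open>(vshift 1 x) j = x (j + 1)\<close>;
  in particular \<open>vshift (- 1)\<close> is its inverse.\<close>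

definition vshift :: "int \<Rightarrow> 'd vseq \<Rightarrow> 'd vseq" where
  "vshift n x = (\<lambda>j. x (j + n))"

text \<open>\<open>k div m ^ j mod m\<close> is the \<open>j\<close>-th digit of the \<open>m\<close>-ary expansion of \<open>k\<close>.\<close>

definition vgamma :: "int ^ 'd ^ 'd \<Rightarrow> (nat \<Rightarrow> int ^ 'd) \<Rightarrow> nat \<Rightarrow> 'd vseq" where
  "vgamma M s k =
    (\<lambda>i. if i \<le> 0 then s ((k div abs_det M ^ nat (- i)) mod abs_det M) else 0)"

definition digit_embed :: "int ^ ('d::finite) \<Rightarrow> 'd vseq" where
  "digit_embed q = (\<lambda>j. if j = 0 then q else 0)"

definition vtopology :: "int ^ 'd ^ 'd \<Rightarrow> (nat \<Rightarrow> int ^ 'd) \<Rightarrow> 'd vseq topology" where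
  "vtopology M s = topology (\<lambda>S. S \<subseteq> vilenkin M s \<and>
     (\<forall>x \<in> S. \<exists>l. \<forall>u \<in> vnbhd M s l. vadd M s x u \<in> S))"

lemma vnbhd_antimono: "l \<le> l' \<Longrightarrow> vnbhd M s l' \<subseteq> vnbhd M s l"
  by (auto simp: vnbhd_def)

lemma openin_vtopology:
  "openin (vtopology M s) S \<longleftrightarrow>
     S \<subseteq> vilenkin M s \<and> (\<forall>x \<in> S. \<exists>l. \<forall>u \<in> vnbhd M s l. vadd M s x u \<in> S)"
proof -
  let ?P = "\<lambda>S. S \<subseteq> vilenkin M s \<and> (\<forall>x \<in> S. \<exists>l. \<forall>u \<in> vnbhd M s l. vadd M s x u \<in> S)"
  have "?P (S \<inter> T)" if ST: "?P S" "?P T" for S T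
  proof (intro conjI ballI)
    show "S \<inter> T \<subseteq> vilenkin M s" using that by auto
    fix x assume "x \<in> S \<inter> T"
    then obtain l l' where l: "\<forall>u \<in> vnbhd M s l. vadd M s x u \<in> S"
      and l': "\<forall>u \<in> vnbhd M s l'. vadd M s x u \<in> T"
      using ST by blast
    have "\<forall>u \<in> vnbhd M s (max l l'). vadd M s x u \<in> S \<inter> T"
      using l l' vnbhd_antimono[of l "max l l'" M s] vnbhd_antimono[of l' "max l l'" M s] by auto
    then show "\<exists>l. \<forall>u \<in> vnbhd M s l. vadd M s x u \<in> S \<inter> T" by blast
  qed
  moreover have "?P (\<Union> K)" if "\<forall>S \<in> K. ?P S" for K
    using that by (meson Sup_le_iff UnionE UnionI)
  ultimately have "istopology ?P"
    unfolding istopology_def by blast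
  then show ?thesis
    by (simp add: vtopology_def topology_inverse')
qed

text \<open>The topology is second countable, so that regularity of the Borel measure is
  automatic and need not be demanded separately.\<close>

definition haar_measure ::
  "int ^ 'd ^ 'd \<Rightarrow> (nat \<Rightarrow> int ^ 'd) \<Rightarrow> 'd vseq measure \<Rightarrow> bool" where
  "haar_measure M s \<mu> \<longleftrightarrow>
    sets \<mu> = sets (sigma (vilenkin M s) {S. openin (vtopology M s) S}) \<and>
    (\<forall>K. compactin (vtopology M s) K \<longrightarrow> emeasure \<mu> K < \<infinity>) \<and>
    (\<forall>x \<in> vilenkin M s. \<forall>A \<in> sets \<mu>. emeasure \<mu> (vadd M s x ` A) = emeasure \<mu> A) \<and>
    emeasure \<mu> (vnbhd M s 0) = 1"


section \<open>Square-integrable functions\<close>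

definition L2_fun :: "'a measure \<Rightarrow> ('a \<Rightarrow> complex) \<Rightarrow> bool" where
  "L2_fun \<mu> f \<longleftrightarrow> f \<in> borel_measurable \<mu> \<and> integrable \<mu> (\<lambda>x. (cmod (f x))\<^sup>2)"

definition L2_inner :: "'a measure \<Rightarrow> ('a \<Rightarrow> complex) \<Rightarrow> ('a \<Rightarrow> complex) \<Rightarrow> complex" where
  "L2_inner \<mu> f g = (LINT x|\<mu>. f x * cnj (g x))"

definition L2_nrm :: "'a measure \<Rightarrow> ('a \<Rightarrow> complex) \<Rightarrow> real" where
  "L2_nrm \<mu> f = sqrt (LINT x|\<mu>. (cmod (f x))\<^sup>2)"

definition orthonormal_system :: "'a measure \<Rightarrow> 'i set \<Rightarrow> ('i \<Rightarrow> 'a \<Rightarrow> complex) \<Rightarrow> bool" where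
  "orthonormal_system \<mu> I e \<longleftrightarrow>
    (\<forall>i \<in> I. L2_fun \<mu> (e i)) \<and>
    (\<forall>i \<in> I. \<forall>j \<in> I. L2_inner \<mu> (e i) (e j) = (if i = j then 1 else 0))"

definition orthonormal_basis :: "'a measure \<Rightarrow> 'i set \<Rightarrow> ('i \<Rightarrow> 'a \<Rightarrow> complex) \<Rightarrow> bool" where
  "orthonormal_basis \<mu> I e \<longleftrightarrow>
    orthonormal_system \<mu> I e \<and>
    (\<forall>f. L2_fun \<mu> f \<longrightarrow> (\<forall>\<epsilon> > 0. \<exists>F c. finite F \<and> F \<subseteq> I \<and>
       L2_nrm \<mu> (\<lambda>x. f x - (\<Sum>i\<in>F. c i * e i x)) < \<epsilon>))"


section \<open>Fourier transform and Walsh functions\<close>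

text \<open>For \<open>x\<close> in the group of \<open>M\<close> and \<open>\<omega>\<close> in the group of \<open>transpose M\<close> only finitely
  many summands are nonzero.\<close>

definition vchar :: "int ^ 'd ^ 'd \<Rightarrow> 'd vseq \<Rightarrow> 'd vseq \<Rightarrow> complex" where
  "vchar M x \<omega> = exp (2 * of_real pi * \<i> * of_real
     (\<Sum>\<^sub>\<infinity>j\<in>UNIV. (matrix_inv (mat_of_int M) *v vec_of_int (x j)) \<bullet>
        (vec_of_int (\<omega> (1 - j)) :: real ^ 'd)))"

definition fourier ::
  "int ^ 'd ^ 'd \<Rightarrow> 'd vseq measure \<Rightarrow> ('d vseq \<Rightarrow> complex) \<Rightarrow> 'd vseq \<Rightarrow> complex" where
  "fourier M \<mu> f \<omega> = (LINT x|\<mu>. f x * cnj (vchar M x \<omega>))"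

text \<open>\<open>g\<close> is (a representative of) the Fourier transform of \<open>f\<close> in the sense of the
  continuous extension from \<open>L\<^sub>1 \<inter> L\<^sub>2\<close> to \<open>L\<^sub>2\<close>.\<close>

definition has_fourier_L2 ::
  "int ^ 'd ^ 'd \<Rightarrow> 'd vseq measure \<Rightarrow> 'd vseq measure \<Rightarrow>
    ('d vseq \<Rightarrow> complex) \<Rightarrow> ('d vseq \<Rightarrow> complex) \<Rightarrow> bool" where
  "has_fourier_L2 M \<mu> \<mu>' f g \<longleftrightarrow>
    L2_fun \<mu> f \<and> L2_fun \<mu>' g \<and>
    (\<exists>F :: nat \<Rightarrow> 'd vseq \<Rightarrow> complex.
       (\<forall>n. integrable \<mu> (F n) \<and> L2_fun \<mu> (F n) \<and> L2_fun \<mu>' (fourier M \<mu> (F n))) \<and>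
       (\<lambda>n. L2_nrm \<mu> (\<lambda>x. F n x - f x)) \<longlonglongrightarrow> 0 \<and>
       (\<lambda>n. L2_nrm \<mu>' (\<lambda>\<omega>. fourier M \<mu> (F n) \<omega> - g \<omega>)) \<longlonglongrightarrow> 0)"

definition walsh :: "int ^ 'd ^ 'd \<Rightarrow> (nat \<Rightarrow> int ^ 'd) \<Rightarrow> nat \<Rightarrow> 'd vseq \<Rightarrow> complex" where
  "walsh M s k = vchar M (vgamma M s k)"

text \<open>Here \<open>t\<close> enumerates the digits of \<open>transpose M\<close>. Functions on the dual group are
  only compared on its carrier.\<close>

definition walsh_polynomial ::
  "int ^ 'd ^ 'd \<Rightarrow> (nat \<Rightarrow> int ^ 'd) \<Rightarrow> (nat \<Rightarrow> int ^ 'd) \<Rightarrow> ('d vseq \<Rightarrow> complex) \<Rightarrow> bool" where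
  "walsh_polynomial M s t p \<longleftrightarrow>
    (\<exists>K c. finite K \<and> (\<forall>\<omega> \<in> vilenkin (transpose M) t. p \<omega> = (\<Sum>k\<in>K. c k * walsh M s k \<omega>)))"


section \<open>Refinable functions and wavelet systems\<close>

definition compactly_supported ::
  "int ^ 'd ^ 'd \<Rightarrow> (nat \<Rightarrow> int ^ 'd) \<Rightarrow> ('d vseq \<Rightarrow> complex) \<Rightarrow> bool" where
  "compactly_supported M s f \<longleftrightarrow>
    compactin (vtopology M s) (vtopology M s closure_of {x \<in> vilenkin M s. f x \<noteq> 0})"

definition refinable ::
  "int ^ 'd ^ 'd \<Rightarrow> (nat \<Rightarrow> int ^ 'd) \<Rightarrow> 'd vseq measure \<Rightarrow> ('d vseq \<Rightarrow> complex) \<Rightarrow> bool" where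
  "refinable M s \<mu> f \<longleftrightarrow>
    L2_fun \<mu> f \<and>
    (\<exists>\<alpha> :: nat \<Rightarrow> complex. \<forall>x \<in> vilenkin M s.
       (\<lambda>k. \<alpha> k * f (vadd M s (vshift 1 x) (vgamma M s k))) sums f x)"

definition orthogonal_refinable ::
  "int ^ 'd ^ 'd \<Rightarrow> (nat \<Rightarrow> int ^ 'd) \<Rightarrow> 'd vseq measure \<Rightarrow> ('d vseq \<Rightarrow> complex) \<Rightarrow> bool" where
  "orthogonal_refinable M s \<mu> f \<longleftrightarrow>
    refinable M s \<mu> f \<and>
    orthonormal_system \<mu> (vlattice M s) (\<lambda>h x. f (vadd M s x h))"

text \<open>A compactly supported function in \<open>L\<^sub>2\<close> is integrable, hence \<open>fourier\<close> is
  applicable to it and the identity below is one of continuous functions.\<close>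

definition is_mask ::
  "int ^ 'd ^ 'd \<Rightarrow> (nat \<Rightarrow> int ^ 'd) \<Rightarrow> (nat \<Rightarrow> int ^ 'd) \<Rightarrow> 'd vseq measure \<Rightarrow>
    ('d vseq \<Rightarrow> complex) \<Rightarrow> ('d vseq \<Rightarrow> complex) \<Rightarrow> bool" where
  "is_mask M s t \<mu> f p \<longleftrightarrow>
    walsh_polynomial M s t p \<and>
    (\<forall>\<omega> \<in> vilenkin (transpose M) t.
       fourier M \<mu> f \<omega> = p (vshift (- 1) \<omega>) * fourier M \<mu> f (vshift (- 1) \<omega>))"

definition wavelet_functions ::
  "int ^ 'd ^ 'd \<Rightarrow> (nat \<Rightarrow> int ^ 'd) \<Rightarrow> (nat \<Rightarrow> int ^ 'd) \<Rightarrow>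
    'd vseq measure \<Rightarrow> 'd vseq measure \<Rightarrow>
    ('d vseq \<Rightarrow> complex) \<Rightarrow> (nat \<Rightarrow> 'd vseq \<Rightarrow> complex) \<Rightarrow> bool" where
  "wavelet_functions M s t \<mu> \<mu>' f \<psi> \<longleftrightarrow>
    (\<exists>p :: nat \<Rightarrow> 'd vseq \<Rightarrow> complex.
       is_mask M s t \<mu> f (p 0) \<and>
       (\<forall>\<nu> \<in> {1..<abs_det M}. walsh_polynomial M s t (p \<nu>)) \<and>
       (\<forall>k < abs_det M. \<forall>l < abs_det M. \<forall>\<omega> \<in> vilenkin (transpose M) t.
          (\<Sum>\<nu><abs_det M.
             p \<nu> (vshift (- 1) (vadd (transpose M) t \<omega> (digit_embed (t k)))) *
             cnj (p \<nu> (vshift (- 1) (vadd (transpose M) t \<omega> (digit_embed (t l)))))) =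
          (if k = l then 1 else 0)) \<and>
       (\<forall>\<nu> \<in> {1..<abs_det M}.
          has_fourier_L2 M \<mu> \<mu>' (\<psi> \<nu>)
            (\<lambda>\<omega>. p \<nu> (vshift (- 1) \<omega>) * fourier M \<mu> f (vshift (- 1) \<omega>))))"

definition wavelet ::
  "int ^ 'd ^ 'd \<Rightarrow> (nat \<Rightarrow> int ^ 'd) \<Rightarrow> ('d vseq \<Rightarrow> complex) \<Rightarrow>
    int \<Rightarrow> nat \<Rightarrow> 'd vseq \<Rightarrow> complex" where
  "wavelet M s \<psi> j k x =
    of_real (real (abs_det M) powr (of_int j / 2)) * \<psi> (vadd M s (vshift j x) (vgamma M s k))"

end

theory Submission
  imports Defs "HOL-Computational_Algebra.Fundamental_Theorem_Algebra" "HOL-Number_Theory.Cong"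
begin

text \<open>
  Write \<open>\<phi>\<^sub>j\<^sub>h = m\<^bsup>j/2\<^esup> \<phi>(\<M>\<^sup>j x \<oplus> h)\<close> for \<open>h \<in> H\<close>, let \<open>\<psi>\<^bsup>(0)\<^esup> = \<phi>\<close>, and let \<open>V\<^sub>j\<close> be the span of the
  \<open>\<phi>\<^sub>j\<^sub>h\<close>. Since Fourier transforms determine integrals over balls, the mask equations become
  finite identities \<open>\<psi>\<^bsup>(\<nu>)\<^esup> = \<Sum>\<^sub>g b\<^sub>\<nu>\<^sub>,\<^sub>g \<phi>\<^sub>1\<^sub>g\<close>. The unitarity of the masks, averaged over a finite
  subgroup of the dual group, says that the rows \<open>(b\<^sub>\<nu>\<^sub>,\<^sub>g\<^sub>-\<^sub>M\<^sub>h)\<^sub>g\<close> are orthonormal; cut down to finite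
  subgroups of \<open>H\<close> this matrix is square, so its columns are orthonormal as well, which
  expresses \<open>\<phi>\<^sub>1\<^sub>g\<close> through the \<open>\<psi>\<^bsup>(\<nu>)\<^esup>(\<cdot> \<oplus> h)\<close>. Hence \<open>V\<^sub>j\<^sub>+\<^sub>1 = V\<^sub>j \<oplus> W\<^sub>j\<close>, and the wavelets are
  orthonormal.

  The indicator \<open>f\<close> of a ball lies in some \<open>V\<^sub>J\<close>: for large \<open>J\<close> the \<open>\<phi>\<^sub>J\<^sub>h\<close> supported in the ball satisfy
  Bessel's inequality with equality, because \<open>\<phi>\<close> has integral \<open>1\<close>. The component of \<open>f\<close> in \<open>V\<^sub>-\<^sub>K\<close>
  tends to \<open>0\<close>, because only boundedly many \<open>\<phi>\<^sub>-\<^sub>K\<^sub>h\<close> meet the ball and there they carry the integral of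
  \<open>\<bar>\<phi>\<bar>\<^sup>2\<close> over a ball shrinking to a point. Indicators of balls span a dense subspace of \<open>L\<^sub>2\<close>.

  The group structure requires that \<open>\<bar>det M\<bar>\<close> incongruent vectors exhaust all residue classes, i.e.
  \<open>[\<int>\<^sup>d : M\<int>\<^sup>d] \<le> \<bar>det M\<bar>\<close>. This follows by enlarging \<open>M\<int>\<^sup>d\<close> one prime index at a time.
\<close>

section \<open>Integer matrices\<close>

text \<open>The wavelet functions are given only through L2 Fourier transforms, defined by
  approximating sequences, while orthonormality of the translates of \<phi> is known on the group
  itself. No inversion or full Plancherel theorem is developed to bridge this: the transform of a
  ball indicator is a character cut off to a dual ball, and Fubini against these test functions
  identifies a function almost everywhere. Afterwards only the finite coefficient families of the
  masks remain.

  From there everything is kept finite. \<open>H\<close> is an increasing union of finite subgroups,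
  and one more digit multiplies the order by \<open>m\<close>, which is also the number of
  generating functions with \<nu> = 0 included; hence the coefficient matrix is square. The spaces
  V_j can be algebraic spans up to null sets, without closed subspaces or projections: Bessel's
  inequality is used with its exact defect.

  Addition acts on each coordinate without carry. This makes preimages of balls under shifts and
  translations balls again, so that measure theory and supports reduce to bookkeeping of
  levels.\<close>

lemma det_mat_of_int:
  fixes A :: "int ^ 'd ^ 'd"
  shows "det (mat_of_int A :: 'a::comm_ring_1 ^ 'd ^ 'd) = of_int (det A)"
  by (simp add: det_def mat_of_int_def)

lemma mat_of_int_mult_vec:
  "mat_of_int A *v vec_of_int v = (vec_of_int (A *v v) :: ('a::comm_ring_1) ^ 'd)"
  by (simp add: matrix_vector_mult_def mat_of_int_def vec_of_int_def vec_eq_iff)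

lemma vec_of_int_eq_iff [simp]:
  "(vec_of_int v :: 'a::ring_char_0 ^ 'd) = vec_of_int w \<longleftrightarrow> v = w"
  by (simp add: vec_of_int_def vec_eq_iff)

text \<open>A determinant of polynomials serves as characteristic polynomial. In the Leibniz
  expansion a permutation that moves an index picks a constant entry there, so its product has
  degree below \<open>CARD('d)\<close>; only the identity reaches the top degree.\<close>

lemma det_linear_pencil_poly:
  fixes A :: "complex ^ 'd ^ 'd"
  defines "P \<equiv> det (\<chi> i j. if i = j then [:- A $ i $ j, 1:] else [:- A $ i $ j:])"
  shows "lead_coeff P = 1" "degree P = CARD('d)" "poly P z = det (mat z - A)"
proof -
  define C :: "complex poly ^ 'd ^ 'd"
    where "C = (\<chi> i j. if i = j then [:- A $ i $ j, 1:] else [:- A $ i $ j:])"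
  have P: "P = (\<Sum>p | p permutes UNIV. of_int (sign p) * (\<Prod>i\<in>UNIV. C $ i $ p i))"
    by (simp add: P_def det_def C_def)
  define D where "D = (\<Prod>i\<in>UNIV. C $ i $ i)"
  define R where "R = (\<Sum>p \<in> {p. p permutes (UNIV::'d set)} - {id}. of_int (sign p) * (\<Prod>i\<in>UNIV. C $ i $ p i))"
  have PDR: "P = D + R"
    unfolding P D_def R_def
    by (subst sum.remove[of _ id]) (auto simp: permutes_id finite_permutations)
  have lead_D: "lead_coeff D = 1"
    by (simp add: D_def lead_coeff_prod C_def)
  have deg_D: "degree D = CARD('d)"
    unfolding D_def by (subst degree_prod_eq_sum_degree) (auto simp: C_def)
  have deg_R: "degree R < CARD('d)"
    unfolding R_def
  proof (rule degree_sum_less)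
    fix p assume p: "p \<in> {p. p permutes (UNIV::'d set)} - {id}"
    then obtain i where i: "p i \<noteq> i" by fastforce
    have "degree (of_int (sign p) * (\<Prod>i\<in>UNIV. C $ i $ p i)) \<le> degree (\<Prod>i\<in>UNIV. C $ i $ p i)"
      using degree_mult_le[of "of_int (sign p)" "\<Prod>i\<in>UNIV. C $ i $ p i"] by simp
    also have "\<dots> \<le> (\<Sum>i\<in>UNIV. degree (C $ i $ p i))"
      using degree_prod_sum_le[of UNIV "\<lambda>i. C $ i $ p i"] by (simp add: o_def)
    also have "\<dots> < (\<Sum>i\<in>(UNIV::'d set). 1)"
      by (rule sum_strict_mono_ex1) (use i[symmetric] in \<open>auto simp: C_def intro!: bexI[of _ i]\<close>)
    finally show "degree (of_int (sign p) * (\<Prod>i\<in>UNIV. C $ i $ p i)) < CARD('d)" by simp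
  qed simp
  show deg: "degree P = CARD('d)"
    unfolding PDR using deg_R deg_D by (simp add: degree_add_eq_left)
  show "lead_coeff P = 1"
    unfolding deg unfolding PDR coeff_add using lead_D deg_D deg_R by (simp add: coeff_eq_0)
  have eq: "poly (C $ i $ j) z = (mat z - A) $ i $ j" for i j
    by (simp add: C_def mat_def)
  show "poly P z = det (mat z - A)"
    unfolding P by (simp add: poly_sum poly_prod det_def eq)
qed

text \<open>Up to sign the determinant is the characteristic polynomial at 0, so its modulus is the
  product of the moduli of the complex roots, all greater than 1. An integer of modulus above 1 has
  modulus at least 2.\<close>

lemma dilation_matrix_abs_det_ge_2:
  fixes M :: "int ^ 'd ^ 'd"
  assumes "dilation_matrix M"
  shows "2 \<le> abs_det M"
proof -
  define A :: "complex ^ 'd ^ 'd" where "A = mat_of_int M"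
  define P where "P = det (\<chi> i j. if i = j then [:- A $ i $ j, 1:] else [:- A $ i $ j:])"
  note P = det_linear_pencil_poly[of A, folded P_def]
  obtain r where r: "smult (lead_coeff P) (\<Prod>i<degree P. [:-r i, 1:]) = P"
    using complex_poly_decompose' by blast
  then have r': "P = (\<Prod>i<CARD('d). [:-r i, 1:])"
    using P(1,2) by simp
  have big: "1 < cmod (r i)" if "i < CARD('d)" for i
  proof -
    have "poly P (r i) = 0" using that by (auto simp: r' poly_prod)
    then have "\<not> invertible (mat (r i) - A)"
      by (simp add: P(3) invertible_det_nz)
    then have "\<nexists>B. B ** (mat (r i) - A) = mat 1"
      by (simp add: invertible_left_inverse)
    then obtain v where v: "(mat (r i) - A) *v v = 0" "v \<noteq> 0"
      by (auto simp: matrix_left_invertible_ker)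
    have m: "mat (r i) *v v = r i *s v"
      by (simp add: vec_eq_iff matrix_vector_mult_def mat_def if_distrib[of "\<lambda>x. x * _"] cong: if_cong)
    have "A *v v = r i *s v"
      using v(1) by (simp add: matrix_vector_mult_diff_rdistrib m)
    then show ?thesis using assms v(2) unfolding dilation_matrix_def A_def by blast
  qed
  have "cmod (poly P 0) = (\<Prod>i<CARD('d). cmod (r i))"
    
  proof -
    have "poly P 0 = (\<Prod>i<CARD('d). - r i)" by (simp add: r' poly_prod)
    then show ?thesis by (simp only: prod_norm[symmetric] norm_minus_cancel)
  qed
  also have "\<dots> > 1" using big by (intro less_1_prod) (auto simp: lessThan_empty_iff)
  finally have "1 < cmod (poly P 0)" .
  moreover have "poly P 0 = det (\<chi> i. (-1) *s (A $ i))"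
    unfolding P(3) by (rule arg_cong[of _ _ det]) (simp add: vec_eq_iff mat_def)
  moreover have "\<dots> = (-1) ^ CARD('d) * of_int (det M)"
    using det_rows_mul[of "\<lambda>_. -1" "\<lambda>i. A $ i"] by (simp add: A_def det_mat_of_int)
  ultimately have "1 < cmod (of_int (det M))" by (simp add: norm_mult norm_power)
  then show ?thesis by (simp add: abs_det_def)
qed

text \<open>Cramer's rule without division. It will tell by which factor the determinant drops when
  a column is exchanged for a vector of finite order modulo \<open>A\<close>.\<close>

lemma det_replace_column:
  fixes A :: "int ^ 'd ^ 'd"
  assumes "k *s v = A *v u"
  shows "k * det (\<chi> r j. if j = i then v $ r else A $ r $ j) = u $ i * det A"
proof -
  have "k * det (\<chi> r j. if j = i then v $ r else A $ r $ j)
      = det (\<chi> j. if j = i then k *s v else column j A)"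
    by (subst det_row_mul, subst (1) det_transpose[symmetric],
        rule arg_cong[of _ _ "\<lambda>x. k * det x"]) (simp add: vec_eq_iff transpose_def column_def)
  also have "\<dots> = det (\<chi> r j. if j = i then (A *v u) $ r else A $ r $ j)"
    by (subst det_transpose[symmetric], rule arg_cong[of _ _ det])
       (simp add: vec_eq_iff transpose_def column_def assms)
  finally have 1: "k * det (\<chi> r j. if j = i then v $ r else A $ r $ j)
      = det (\<chi> r j. if j = i then (A *v u) $ r else A $ r $ j)" .
  \<comment> \<open>Cramer's lemma is applied over the reals; the identity returns to the integers
    by injectivity of \<open>real_of_int\<close>.\<close>
  have "real_of_int (det (\<chi> r j. if j = i then (A *v u) $ r else A $ r $ j))
      = det (\<chi> r j. if j = i then (mat_of_int A *v vec_of_int u) $ r else mat_of_int A $ r $ j)"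
    unfolding det_mat_of_int[symmetric] mat_of_int_mult_vec
    by (rule arg_cong[of _ _ det]) (simp add: vec_eq_iff mat_of_int_def vec_of_int_def)
  also have "\<dots> = real_of_int (u $ i * det A)"
    unfolding cramer_lemma by (simp add: det_mat_of_int vec_of_int_def)
  finally show ?thesis unfolding 1 by (simp only: of_int_eq_iff)
qed

text \<open>Cramer's solution becomes integral after multiplication by \<open>det A\<close>. For
  \<open>det A\<close> nonzero, every vector thus has finite order modulo the range of
  \<open>A\<close>.\<close>

lemma det_smult_in_range:
  fixes A :: "int ^ 'd ^ 'd"
  shows "\<exists>u. det A *s v = A *v u"
proof (cases "det A = 0")
  case True
  then show ?thesis by (intro exI[of _ 0]) (simp add: vec_eq_iff)
next
  case False
  define B :: "real ^ 'd ^ 'd" where "B = mat_of_int A"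
  define u where "u = (\<chi> k. det (\<chi> i j. if j = k then v $ i else A $ i $ j))"
  have dB: "det B = of_int (det A)" by (simp add: B_def det_mat_of_int)
  have "B *v (\<chi> k. det (\<chi> i j. if j = k then vec_of_int v $ i else B $ i $ j) / det B) = vec_of_int v"
    using False by (subst cramer) (auto simp: dB)
  moreover have "det (\<chi> i j. if j = k then vec_of_int v $ i else B $ i $ j) = of_int (u $ k)" for k
    unfolding u_def vec_lambda_beta det_mat_of_int[symmetric]
    by (rule arg_cong[of _ _ det]) (simp add: vec_eq_iff mat_of_int_def vec_of_int_def B_def)
  ultimately have v: "B *v (inverse (det B) *s vec_of_int u) = vec_of_int v"
    by (simp add: divide_inverse mult.commute vector_scalar_mult_def vec_of_int_def)
  then have "B *v vec_of_int u = det B *s vec_of_int v"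
  proof -
    have "B *v (inverse (det B) *s vec_of_int u) = inverse (det B) *s (B *v vec_of_int u)"
      by (rule vector_scalar_commute)
    then have "det B *s vec_of_int v = det B *s (inverse (det B) *s (B *v vec_of_int u))"
      using v by simp
    also have "\<dots> = B *v vec_of_int u"
      using False dB unfolding vector_smult_assoc by simp
    finally show ?thesis by simp
  qed
  then have "vec_of_int (A *v u) = (vec_of_int (det A *s v) :: real ^ 'd)"
    unfolding B_def mat_of_int_mult_vec
    by (simp add: dB[unfolded B_def] vec_eq_iff vec_of_int_def)
  then show ?thesis by (metis vec_of_int_eq_iff)
qed

section \<open>Congruence modulo a matrix and the index of its range\<close>

lemma matrix_vector_mult_minus_distrib_int:
  "A *v (- x) = - (A *v x)" for A :: "int ^ 'n ^ 'm"
  by (simp add: matrix_vector_mult_def vec_eq_iff sum_negf)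

lemma matrix_vector_mult_diff_distrib_int:
  "A *v (x - y) = A *v x - A *v y" for A :: "int ^ 'n ^ 'm"
  by (simp add: matrix_vector_mult_def vec_eq_iff sum_subtractf right_diff_distrib)

lemma vector_scalar_commute_int:
  "A *v (c *s x) = c *s (A *v x)" for A :: "int ^ 'n ^ 'm"
  by (simp add: matrix_vector_mult_def vec_eq_iff sum_distrib_left mult_ac)

lemma matrix_vector_mult_basis_int:
  "A *v axis i 1 = column i A" for A :: "int ^ 'n ^ 'm"
  by (simp add: matrix_vector_mult_def vec_eq_iff column_def axis_def if_distrib[of "(*) _"] cong: if_cong)

lemma congruent_mod_refl [simp]: "congruent_mod M x x"
  unfolding congruent_mod_def by (intro exI[of _ 0]) simp

lemma congruent_mod_sym: "congruent_mod M x y \<Longrightarrow> congruent_mod M y x"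
proof -
  assume "congruent_mod M x y"
  then obtain u where "x - y = M *v u" by (auto simp: congruent_mod_def)
  then have "y - x = M *v (- u)"
    by (simp add: matrix_vector_mult_minus_distrib_int flip: \<open>x - y = M *v u\<close>)
  then show ?thesis by (auto simp: congruent_mod_def)
qed

lemma congruent_mod_trans: "congruent_mod M x y \<Longrightarrow> congruent_mod M y z \<Longrightarrow> congruent_mod M x z"
proof -
  assume "congruent_mod M x y" "congruent_mod M y z"
  then obtain u w where "x - y = M *v u" "y - z = M *v w" by (auto simp: congruent_mod_def)
  then have "x - z = M *v (u + w)"
    by (simp add: matrix_vector_right_distrib flip: \<open>x - y = M *v u\<close> \<open>y - z = M *v w\<close>)
  then show ?thesis by (auto simp: congruent_mod_def)
qed

text \<open>Induction on the determinant. If the range of \<open>A\<close> is not everything, the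
  quotient has a class of prime order \<open>p\<close>; adjoining it gives the range of a matrix
  \<open>A'\<close> with \<open>abs_det A = p * abs_det A'\<close>. Each class modulo
  \<open>A'\<close> splits into at most \<open>p\<close> classes modulo \<open>A\<close>.\<close>

lemma card_incongruent_le_abs_det:
  fixes A :: "int ^ 'd ^ 'd"
  assumes "det A \<noteq> 0" "finite S" "pairwise (\<lambda>x y. \<not> congruent_mod A x y) S"
  shows "card S \<le> abs_det A"
  using assms
proof (induction "abs_det A" arbitrary: A S rule: less_induct)
  case less
  show ?case
  proof (cases "\<forall>v. \<exists>u. v = A *v u")
    case True
    then have "x = y" if "x \<in> S" "y \<in> S" for x y
      using less.prems(3) that unfolding pairwise_def congruent_mod_def by blast
    then have "card S \<le> 1" by (auto simp: card_le_Suc0_iff_eq less.prems(2))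
    moreover have "1 \<le> abs_det A" using less.prems(1) by (simp add: abs_det_def)
    ultimately show ?thesis by simp
  next
    case False
    then obtain v0 where v0: "\<nexists>u. v0 = A *v u" by blast
    \<comment> \<open>The least \<open>k\<close> with \<open>K k\<close> is the order of
      \<open>v0\<close> in the quotient; it exists because \<open>det A\<close> annihilates the
      quotient.\<close>
    define K where "K = (\<lambda>k::nat. 0 < k \<and> (\<exists>u. int k *s v0 = A *v u))"
    have "\<exists>k. K k"
    proof -
      obtain u where u: "det A *s v0 = A *v u" using det_smult_in_range by blast
      then have "(- det A) *s v0 = A *v (- u)"
        by (metis matrix_vector_mult_minus_distrib_int vector_sneg_minus1 vector_smult_assoc mult_minus1)
      then show ?thesis unfolding K_def using u less.prems(1)
        by (intro exI[of _ "nat \<bar>det A\<bar>"]) (cases "0 < det A"; auto)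
    qed
    define k where "k = (LEAST k. K k)"
    have k: "K k" unfolding k_def using \<open>\<exists>k. K k\<close> by (rule LeastI_ex)
    have k_min: "k \<le> k'" if "K k'" for k' unfolding k_def using that by (rule Least_le)
    have "k \<noteq> 1" using k v0 by (auto simp: K_def)
    then obtain p where p: "prime p" "p dvd k" using prime_factor_nat by blast
    then obtain q where q: "k = p * q" by auto
    \<comment> \<open>The multiple by the cofactor of a prime divisor of the order has order exactly
      \<open>p\<close>.\<close>
    define v where "v = int q *s v0"
    have q_less: "0 < q" "q < k" using k p(1) q by (auto simp: K_def prime_gt_1_nat prime_gt_Suc_0_nat)
    then have v: "\<nexists>u. v = A *v u" using k_min[of q] by (auto simp: K_def v_def)
    obtain u where u: "int p *s v = A *v u"
    proof -
      have "int p *s v = int k *s v0" by (simp add: v_def q vec_eq_iff)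
      then show thesis using k that by (auto simp: K_def)
    qed
    \<comment> \<open>If \<open>p\<close> divided all coordinates of \<open>u\<close>, cancelling it
      would put \<open>v\<close> into the range of \<open>A\<close>.\<close>
    have "\<exists>i. \<not> int p dvd u $ i"
    proof (rule ccontr)
      assume "\<not> ?thesis"
      then have "u = int p *s (\<chi> i. u $ i div int p)"
        by (simp add: vec_eq_iff)
      then have "int p *s v = int p *s (A *v (\<chi> i. u $ i div int p))"
        using u by (metis vector_scalar_commute_int)
      then have "v = A *v (\<chi> i. u $ i div int p)"
        using p(1) by (auto simp: vec_eq_iff prime_gt_0_nat)
      then show False using v by blast
    qed
    then obtain i where i: "\<not> int p dvd u $ i" by blast
    then have "coprime (u $ i) (int p)"
      using p(1) by (metis coprime_commute prime_imp_coprime prime_nat_int_transfer)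
    then obtain c where "[u $ i * c = 1] (mod int p)"
      by (metis cong_solve_coprime_int)
    then obtain b where b: "c * u $ i = 1 + int p * b"
      by (metis add.commute cong_iff_lin mult.commute cong_sym)
    \<comment> \<open>\<open>c\<close> inverts \<open>u $ i\<close> modulo \<open>p\<close> and
      \<open>b\<close> removes the rest, so that \<open>p\<close> times \<open>v'\<close> involves
      column \<open>i\<close> with coefficient exactly 1. Exchanging that column for
      \<open>v'\<close> therefore divides the determinant by exactly \<open>p\<close>.\<close>
    define v' where "v' = c *s v - b *s column i A"
    define u' where "u' = c *s u - (int p * b) *s axis i 1"
    have u'_i: "u' $ i = 1" by (simp add: u'_def b)
    have pv': "int p *s v' = A *v u'"
    proof -
      have "A *v u' = c *s (A *v u) - (int p * b) *s (A *v axis i 1)"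
        by (simp add: u'_def matrix_vector_mult_diff_distrib_int vector_scalar_commute_int)
      then show ?thesis
        unfolding v'_def by (simp add: vec_eq_iff column_def matrix_vector_mult_basis_int algebra_simps
            flip: u)
    qed
    define A' where "A' = (\<chi> r j. if j = i then v' $ r else A $ r $ j)"
    have det: "int p * det A' = det A"
      using det_replace_column[OF pv', of i] by (simp add: A'_def u'_i)
    then have det0: "det A' \<noteq> 0" using less.prems(1) by auto
    have abs: "abs_det A = p * abs_det A'"
      by (simp add: abs_det_def abs_mult nat_mult_distrib flip: det)
    have smaller: "abs_det A' < abs_det A"
    proof -
      have "0 < abs_det A'" using det0 by (simp add: abs_det_def)
      then show ?thesis using prime_gt_1_nat[OF p(1)] by (simp add: abs)
    qed
    \<comment> \<open>Divide the \<open>i\<close>-th coefficient by \<open>p\<close>: the quotient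
      part is absorbed by the range of \<open>A\<close>, since \<open>p\<close> times
      \<open>v'\<close> lies there.\<close>
    have split: "\<exists>r<p. \<exists>w. A' *v x = int r *s v' + A *v w" for x
    proof -
      define w where "w = (\<chi> j. (if j = i then 0 else x $ j) + (x $ i div int p) * u' $ j)"
      have "A' *v x = x $ i *s v' + A *v (\<chi> j. if j = i then 0 else x $ j)"
        by (simp add: vec_eq_iff matrix_vector_mult_def A'_def sum.remove[of UNIV i] algebra_simps)
      also have "x $ i *s v' = (x $ i mod int p) *s v' + (x $ i div int p) *s (int p *s v')"
        by (simp add: vec_eq_iff flip: distrib_right mult.assoc)
      also have "(x $ i div int p) *s (int p *s v') = A *v ((x $ i div int p) *s u')"
        by (simp add: pv' vector_scalar_commute_int)
      also have "(x $ i mod int p) *s v' + A *v ((x $ i div int p) *s u') + A *v (\<chi> j. if j = i then 0 else x $ j)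
          = (x $ i mod int p) *s v' + A *v (((x $ i div int p) *s u') + (\<chi> j. if j = i then 0 else x $ j))"
        by (simp add: matrix_vector_right_distrib)
      finally show ?thesis using p(1)
        by (intro exI[of _ "nat (x $ i mod int p)"]) (auto simp: prime_gt_0_nat nat_less_iff)
    qed
    \<comment> \<open>One representative in \<open>S\<close> for each class modulo
      \<open>A'\<close>; together with the remainder from \<open>split\<close> it determines the
      element of \<open>S\<close>.\<close>
    define f where "f x = (SOME y. y \<in> S \<and> congruent_mod A' x y)" for x
    have f: "f x \<in> S \<and> congruent_mod A' x (f x)" if "x \<in> S" for x
      unfolding f_def by (rule someI[of _ x]) (simp add: that)
    have f_eq: "f x = f y" if "congruent_mod A' x y" for x y
    proof -
      have "congruent_mod A' x z \<longleftrightarrow> congruent_mod A' y z" for z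
        using that by (meson congruent_mod_trans congruent_mod_sym)
      then show ?thesis by (simp add: f_def)
    qed
    have "card (f ` S) \<le> abs_det A'"
    proof (rule less.hyps[OF smaller det0])
      show "pairwise (\<lambda>x y. \<not> congruent_mod A' x y) (f ` S)"
      proof (rule pairwiseI, clarify)
        fix x y assume "x \<in> S" "y \<in> S" "f x \<noteq> f y" "congruent_mod A' (f x) (f y)"
        then have "congruent_mod A' x y"
          using f by (meson congruent_mod_trans congruent_mod_sym)
        then show False using f_eq \<open>f x \<noteq> f y\<close> by blast
      qed
    qed (simp add: less.prems(2))
    have "\<exists>r. \<forall>x\<in>S. r x < p \<and> (\<exists>w. x - f x = int (r x) *s v' + A *v w)"
    proof (rule bchoice, rule ballI)
      fix x assume "x \<in> S"
      then obtain y where "x - f x = A' *v y" using f congruent_mod_def by metis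
      with split[of y] show "\<exists>r. r < p \<and> (\<exists>w. x - f x = int r *s v' + A *v w)" by simp
    qed
    then obtain r where r: "\<And>x. x \<in> S \<Longrightarrow> r x < p"
        "\<And>x. x \<in> S \<Longrightarrow> \<exists>w. x - f x = int (r x) *s v' + A *v w" by blast
    have "card S \<le> card (f ` S \<times> {..<p})"
    proof (rule card_inj_on_le[where f = "\<lambda>x. (f x, r x)"])
      show "inj_on (\<lambda>x. (f x, r x)) S"
      proof (rule inj_onI)
        fix x y assume xy: "x \<in> S" "y \<in> S" "(f x, r x) = (f y, r y)"
        obtain w w' where "x - f x = int (r x) *s v' + A *v w" "y - f y = int (r y) *s v' + A *v w'"
          using r xy by metis
        then have "(x - f x) - (y - f y) = (int (r x) *s v' + A *v w) - (int (r y) *s v' + A *v w')"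
          by simp
        then have "x - y = A *v (w - w')"
          using xy(3) by (simp add: matrix_vector_mult_diff_distrib_int)
        then have "congruent_mod A x y" unfolding congruent_mod_def by blast
        then show "x = y"
          using pairwiseD[OF less.prems(3) xy(1,2)] by blast
      qed
      show "(\<lambda>x. (f x, r x)) ` S \<subseteq> f ` S \<times> {..<p}"
        using r(1) by blast
    qed (simp add: less.prems(2))
    also have "\<dots> \<le> abs_det A"
      using \<open>card (f ` S) \<le> abs_det A'\<close> by (simp add: abs card_cartesian_product mult.commute)
    finally show ?thesis .
  qed
qed

text \<open>A vector missed by all digits would form with them \<open>abs_det M + 1\<close>
  incongruent vectors.\<close>

lemma digit_set_complete:
  fixes M :: "int ^ 'd ^ 'd"
  assumes "det M \<noteq> 0" "digit_set M s"
  shows "\<exists>i<abs_det M. congruent_mod M (s i) v"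
proof (rule ccontr)
  assume no: "\<not> ?thesis"
  have incong: "\<not> congruent_mod M (s i) (s j)" if "i < abs_det M" "j < abs_det M" "i \<noteq> j" for i j
    using assms(2) that unfolding digit_set_def by blast
  have "s i \<noteq> s j" if "i < abs_det M" "j < abs_det M" "i \<noteq> j" for i j
    using incong[OF that] by (metis congruent_mod_refl)
  then have inj: "inj_on s {..<abs_det M}"
    by (meson inj_onI lessThan_iff)
  have "\<not> congruent_mod M (s i) v \<and> \<not> congruent_mod M v (s i)" if "i < abs_det M" for i
    using no that by (meson congruent_mod_sym)
  moreover have "pairwise (\<lambda>x y. \<not> congruent_mod M x y) (s ` {..<abs_det M})"
    using incong unfolding pairwise_image by (auto simp: pairwise_def)
  ultimately have "pairwise (\<lambda>x y. \<not> congruent_mod M x y) (insert v (s ` {..<abs_det M}))"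
    unfolding pairwise_insert by blast
  then have "card (insert v (s ` {..<abs_det M})) \<le> abs_det M"
    using assms(1) by (intro card_incongruent_le_abs_det) auto
  moreover have "v \<notin> s ` {..<abs_det M}" using no by auto
  ultimately show False using inj by (simp add: card_image)
qed

section \<open>The group\<close>

lemma congruent_mod_add:
  "congruent_mod M x x' \<Longrightarrow> congruent_mod M y y' \<Longrightarrow> congruent_mod M (x + y) (x' + y')"
proof -
  assume "congruent_mod M x x'" "congruent_mod M y y'"
  then obtain u w where "x - x' = M *v u" "y - y' = M *v w" by (auto simp: congruent_mod_def)
  then have "(x + y) - (x' + y') = M *v (u + w)"
    by (simp add: matrix_vector_right_distrib flip: \<open>x - x' = M *v u\<close> \<open>y - y' = M *v w\<close>)
  then show ?thesis by (auto simp: congruent_mod_def)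
qed

lemma congruent_mod_minus:
  "congruent_mod M x x' \<Longrightarrow> congruent_mod M (- x) (- x')"
proof -
  assume "congruent_mod M x x'"
  then obtain u where "x - x' = M *v u" by (auto simp: congruent_mod_def)
  then have "(- x) - (- x') = M *v (- u)"
    by (simp add: matrix_vector_mult_minus_distrib_int flip: \<open>x - x' = M *v u\<close>)
  then show ?thesis by (auto simp: congruent_mod_def)
qed

text \<open>The bound on the determinant passes at once to the transpose, so
  \<open>transpose M\<close> can be a second instance.\<close>

locale vilenkin_group =
  fixes M :: "int ^ 'd ^ 'd" and s :: "nat \<Rightarrow> int ^ 'd"
  assumes abs_det_ge_2: "2 \<le> abs_det M" and digit_set: "digit_set M s"
begin

abbreviation "V \<equiv> vilenkin M s"
abbreviation "D \<equiv> digit_of M s"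
abbreviation add (infixl "\<oplus>" 65) where "x \<oplus> y \<equiv> vadd M s x y"

definition vneg :: "'d vseq \<Rightarrow> 'd vseq" where
  "vneg x = (\<lambda>j. D (- x j))"

text \<open>For \<open>x\<close> in the group, its coset modulo \<open>vnbhd M s l\<close>. The
  description by coordinates allows single digits of the centre to be overwritten freely.\<close>

definition cyl :: "'d vseq \<Rightarrow> int \<Rightarrow> 'd vseq set" where
  "cyl x l = {y \<in> V. \<forall>j\<le>l. y j = x j}"

text \<open>A finite subgroup. The half-open index range makes \<open>b - a\<close> the number of
  free digits.\<close>

definition vfin :: "int \<Rightarrow> int \<Rightarrow> 'd vseq set" where
  "vfin a b = {x \<in> V. \<forall>j. j \<le> a \<or> b < j \<longrightarrow> x j = 0}"

section \<open>Reduction to digits and the group laws\<close>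

lemma det_nz: "det M \<noteq> 0"
  using abs_det_ge_2 by (auto simp: abs_det_def)

lemma incongruent: "i < abs_det M \<Longrightarrow> j < abs_det M \<Longrightarrow> congruent_mod M (s i) (s j) \<Longrightarrow> i = j"
  using digit_set unfolding digit_set_def by blast

lemma inj_s: "inj_on s {..<abs_det M}"
  by (rule inj_onI) (metis incongruent congruent_mod_refl lessThan_iff)

lemma s_0: "s 0 = 0"
  using digit_set by (simp add: digit_set_def)

lemma card_digits: "card (digits M s) = abs_det M"
  by (simp add: digits_def card_image inj_s)

lemma finite_digits: "finite (digits M s)"
  by (simp add: digits_def)

lemma zero_digit [simp]: "0 \<in> digits M s"
  unfolding digits_def using abs_det_ge_2 s_0 by (metis image_eqI lessThan_iff less_le_trans zero_less_numeral)

lemma digits_unique: "p \<in> digits M s \<Longrightarrow> q \<in> digits M s \<Longrightarrow> congruent_mod M p q \<Longrightarrow> p = q"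
  using incongruent by (auto simp: digits_def)

text \<open>Completeness of the digits gives existence and incongruence gives uniqueness, so the
  description in \<open>digit_of\<close> is meaningful. The group laws rest on this.\<close>

lemma D_props: "D v \<in> digits M s" "congruent_mod M (D v) v"
proof -
  obtain i where i: "i < abs_det M" "congruent_mod M (s i) v"
    using digit_set_complete[OF det_nz digit_set] by blast
  have "\<exists>!q. q \<in> digits M s \<and> congruent_mod M q v"
  proof (rule ex1I[of _ "s i"])
    show "s i \<in> digits M s \<and> congruent_mod M (s i) v" using i by (auto simp: digits_def)
    show "q = s i" if "q \<in> digits M s \<and> congruent_mod M q v" for q
      using that i digits_unique[of q "s i"] congruent_mod_trans congruent_mod_sym
      by (metis digits_def imageI lessThan_iff)
  qed
  from theI'[OF this] show "D v \<in> digits M s" "congruent_mod M (D v) v"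
    by (auto simp: digit_of_def)
qed

lemma D_eqI: "q \<in> digits M s \<Longrightarrow> congruent_mod M q v \<Longrightarrow> D v = q"
  by (metis D_props digits_unique congruent_mod_trans congruent_mod_sym)

lemma D_cong: "congruent_mod M v w \<Longrightarrow> D v = D w"
  by (metis D_eqI D_props congruent_mod_trans)

lemma D_digit [simp]: "q \<in> digits M s \<Longrightarrow> D q = q"
  by (rule D_eqI) auto

lemma D_add_left [simp]: "D (D a + b) = D (a + b)"
  by (intro D_cong congruent_mod_add D_props) simp

lemma D_add_right [simp]: "D (a + D b) = D (a + b)"
  by (intro D_cong congruent_mod_add D_props) simp

lemma D_minus [simp]: "D (- D a) = D (- a)"
  by (intro D_cong congruent_mod_minus D_props)

lemma D_diff [simp]: "D (D a - b) = D (a - b)" "D (a - D b) = D (a - b)"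
  unfolding diff_conv_add_uminus
  by (intro D_cong congruent_mod_add congruent_mod_minus D_props congruent_mod_refl)+

lemma V_iff: "x \<in> V \<longleftrightarrow> (\<forall>j. x j \<in> digits M s) \<and> (\<exists>N. \<forall>j\<le>N. x j = 0)"
proof -
  have "(\<exists>N. \<forall>j\<le>N. x j = 0)" if "finite {j. j < 0 \<and> x j \<noteq> 0}"
  proof (intro exI allI impI)
    fix j assume j: "j \<le> Min (insert 0 {j. j < 0 \<and> x j \<noteq> 0}) - 1"
    show "x j = 0"
    proof (rule ccontr)
      assume "x j \<noteq> 0"
      moreover have "j < 0" using j Min_le[of "insert 0 {j. j < 0 \<and> x j \<noteq> 0}" 0] that by simp
      ultimately have "Min (insert 0 {j. j < 0 \<and> x j \<noteq> 0}) \<le> j" using that by (intro Min_le) auto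
      then show False using j by simp
    qed
  qed
  moreover have "finite {j. j < 0 \<and> x j \<noteq> 0}" if "\<forall>j\<le>N. x j = 0" for N
  proof (rule finite_subset)
    show "{j. j < 0 \<and> x j \<noteq> 0} \<subseteq> {N..0}"
    proof
      fix j assume "j \<in> {j. j < 0 \<and> x j \<noteq> 0}"
      then show "j \<in> {N..0}" using that by (cases "j \<le> N") auto
    qed
  qed simp
  ultimately show ?thesis by (auto simp: vilenkin_def)
qed

lemma V_digit: "x \<in> V \<Longrightarrow> x j \<in> digits M s"
  by (simp add: V_iff)

lemma V_lower: "x \<in> V \<Longrightarrow> \<exists>N\<ge>n. \<forall>j\<le>-N. x j = 0"
proof -
  assume "x \<in> V"
  then obtain N where "\<forall>j\<le>N. x j = 0" by (auto simp: V_iff)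
  then show ?thesis by (intro exI[of _ "max n (- N)"]) auto
qed

lemma vzero_V [simp]: "vzero \<in> V"
  by (auto simp: V_iff vzero_def)

lemma add_V [simp]: "x \<in> V \<Longrightarrow> y \<in> V \<Longrightarrow> x \<oplus> y \<in> V"
proof -
  assume "x \<in> V" "y \<in> V"
  then obtain N N' where "\<forall>j\<le>N. x j = 0" "\<forall>j\<le>N'. y j = 0" by (auto simp: V_iff)
  then have "\<forall>j\<le>min N N'. (x \<oplus> y) j = 0" by (simp add: vadd_def)
  then have "\<exists>N. \<forall>j\<le>N. (x \<oplus> y) j = 0" by blast
  then show ?thesis unfolding V_iff using D_props(1) by (simp add: vadd_def)
qed

lemma vneg_V [simp]: "x \<in> V \<Longrightarrow> vneg x \<in> V"
  using D_props(1) by (fastforce simp: V_iff vneg_def)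

lemma vshift_V [simp]: "x \<in> V \<Longrightarrow> vshift n x \<in> V"
proof -
  assume "x \<in> V"
  then obtain N where "\<forall>j\<le>N. x j = 0" "\<forall>j. x j \<in> digits M s" by (auto simp: V_iff)
  then show ?thesis by (auto simp: V_iff vshift_def intro!: exI[of _ "N - n"])
qed

lemma add_commute: "x \<oplus> y = y \<oplus> x"
  by (simp add: vadd_def add.commute)

lemma add_assoc: "x \<oplus> y \<oplus> z = x \<oplus> (y \<oplus> z)"
  by (simp add: vadd_def add.assoc)

lemma add_vzero [simp]: "x \<in> V \<Longrightarrow> x \<oplus> vzero = x" "x \<in> V \<Longrightarrow> vzero \<oplus> x = x"
  by (simp_all add: vadd_def vzero_def V_digit)

lemma add_vneg [simp]: "x \<oplus> vneg x = vzero" "vneg x \<oplus> x = vzero"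
  by (simp_all add: vadd_def vneg_def vzero_def)

lemma add_vneg_cancel [simp]:
  "x \<in> V \<Longrightarrow> x \<oplus> (vneg h \<oplus> h) = x" "x \<in> V \<Longrightarrow> x \<oplus> (h \<oplus> vneg h) = x"
  "x \<in> V \<Longrightarrow> h \<oplus> (vneg h \<oplus> x) = x" "x \<in> V \<Longrightarrow> vneg h \<oplus> (h \<oplus> x) = x"
  by simp_all (simp_all add: add_assoc[symmetric])

lemma vneg_vneg [simp]: "x \<in> V \<Longrightarrow> vneg (vneg x) = x"
  by (simp add: vneg_def V_digit)

lemma vshift_add: "vshift n (x \<oplus> y) = vshift n x \<oplus> vshift n y"
  by (simp add: vshift_def vadd_def)

lemma vshift_vneg: "vshift n (vneg x) = vneg (vshift n x)"
  by (simp add: vshift_def vneg_def)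

lemma vshift_vshift [simp]: "vshift a (vshift b x) = vshift (a + b) x"
  by (simp add: vshift_def add.assoc)

lemma vshift_0 [simp]: "vshift 0 x = x"
  by (simp add: vshift_def)

lemma vshift_vzero [simp]: "vshift n vzero = vzero"
  by (simp add: vshift_def vzero_def)

lemma add_eq_iff:
  assumes "x \<in> V" "y \<in> V" "h \<in> V" shows "x \<oplus> h = y \<longleftrightarrow> x = y \<oplus> vneg h"
  using assms by (metis add_assoc add_vneg add_vzero(1))

lemma add_right_cancel:
  assumes "x \<in> V" "y \<in> V" "h \<in> V" shows "x \<oplus> h = y \<oplus> h \<longleftrightarrow> x = y"
  using assms by (metis add_assoc add_vneg(1) add_vzero(1))

lemma D_add_eq_iff:
  assumes "p \<in> digits M s" "q \<in> digits M s"
  shows "D (p + v) = q \<longleftrightarrow> p = D (q - v)"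
proof -
  have "D (D (p + v) + (- v)) = p" "D (D (q - v) + v) = q"
    using assms by simp_all
  then show ?thesis by (metis (no_types) D_add_left diff_conv_add_uminus)
qed

section \<open>Balls, that is, cosets of the basic neighbourhoods\<close>

lemma cyl_V: "cyl x l \<subseteq> V"
  by (auto simp: cyl_def)

lemma cyl_self [simp]: "x \<in> V \<Longrightarrow> x \<in> cyl x l"
  by (simp add: cyl_def)

lemma cyl_eq: "y \<in> cyl x l \<Longrightarrow> cyl y l = cyl x l"
  by (auto simp: cyl_def)

lemma vnbhd_eq_cyl: "vnbhd M s l = cyl vzero l"
  by (auto simp: vnbhd_def cyl_def vzero_def)

lemma cyl_antimono: "l \<le> l' \<Longrightarrow> cyl x l' \<subseteq> cyl x l"
  by (auto simp: cyl_def)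

text \<open>Since there is no carry, the condition on coordinate \<open>j\<close> of the image
  concerns coordinate \<open>j + n\<close> of \<open>x\<close> alone. Shifts and translations thus
  pull balls back to balls.\<close>

lemma affine_cyl_iff:
  assumes "x \<in> V" "y \<in> V" "h \<in> V"
  shows "vshift n x \<oplus> h \<in> cyl y l \<longleftrightarrow> x \<in> cyl (vshift (- n) (y \<oplus> vneg h)) (l + n)"
proof -
  have eq: "(vshift n x \<oplus> h) j = y j \<longleftrightarrow> x (j + n) = (y \<oplus> vneg h) j" for j
    using assms by (simp add: vshift_def vadd_def vneg_def D_add_eq_iff V_digit)
  have "vshift n x \<oplus> h \<in> cyl y l \<longleftrightarrow> (\<forall>j\<le>l. x (j + n) = (y \<oplus> vneg h) j)"
    using assms by (simp add: cyl_def eq)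
  also have "\<dots> \<longleftrightarrow> (\<forall>j\<le>l+n. x j = (y \<oplus> vneg h) (j - n))"
    by (metis add_diff_cancel_right' diff_add_cancel diff_le_eq)
  finally show ?thesis using assms by (simp add: cyl_def vshift_def)
qed

lemma add_cyl_iff:
  assumes "x \<in> V" "y \<in> V" "h \<in> V"
  shows "x \<oplus> h \<in> cyl y l \<longleftrightarrow> x \<in> cyl (y \<oplus> vneg h) l"
  using affine_cyl_iff[OF assms, of 0] by simp

lemma image_add_cyl:
  assumes "x \<in> V" "y \<in> V"
  shows "vadd M s x ` cyl y l = cyl (x \<oplus> y) l"
proof (intro set_eqI iffI)
  fix z assume "z \<in> vadd M s x ` cyl y l"
  then obtain w where w: "w \<in> cyl y l" "z = x \<oplus> w" by auto
  then have "w \<in> V" using cyl_V by blast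
  then have "w \<oplus> x \<in> cyl (x \<oplus> y) l \<longleftrightarrow> w \<in> cyl (x \<oplus> y \<oplus> vneg x) l"
    using assms by (intro add_cyl_iff) auto
  moreover have "x \<oplus> y \<oplus> vneg x = y" using assms by (metis add_assoc add_commute add_vneg_cancel(2))
  ultimately show "z \<in> cyl (x \<oplus> y) l" using w by (simp add: add_commute)
next
  fix z assume z: "z \<in> cyl (x \<oplus> y) l"
  then have "z \<in> V" using cyl_V by blast
  then have "z \<oplus> vneg x \<in> cyl y l \<longleftrightarrow> z \<in> cyl (y \<oplus> vneg (vneg x)) l"
    using assms by (intro add_cyl_iff) auto
  then have "z \<oplus> vneg x \<in> cyl y l" using z assms by (simp add: add_commute)
  moreover have "z = x \<oplus> (z \<oplus> vneg x)" using \<open>z \<in> V\<close> by (metis add_commute add_vneg_cancel(3))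
  ultimately show "z \<in> vadd M s x ` cyl y l" by blast
qed

text \<open>Fixing one more digit; this partition fixes how Haar measure scales from level to
  level.\<close>

lemma cyl_split: "cyl x l = (\<Union>q\<in>digits M s. cyl (x(l + 1 := q)) (l + 1))"
proof (intro set_eqI iffI)
  fix y assume y: "y \<in> cyl x l"
  then have "y \<in> cyl (x(l + 1 := y (l + 1))) (l + 1)" by (auto simp: cyl_def)
  moreover have "y (l + 1) \<in> digits M s" using y by (auto simp: cyl_def V_digit)
  ultimately show "y \<in> (\<Union>q\<in>digits M s. cyl (x(l + 1 := q)) (l + 1))" by blast
next
  fix y assume "y \<in> (\<Union>q\<in>digits M s. cyl (x(l + 1 := q)) (l + 1))"
  then obtain q where "y \<in> cyl (x(l + 1 := q)) (l + 1)" by blast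
  then show "y \<in> cyl x l" by (auto simp: cyl_def)
qed

lemma disjoint_cyl_split: "disjoint_family_on (\<lambda>q. cyl (x(l + 1 := q)) (l + 1)) A"
proof (unfold disjoint_family_on_def, intro ballI impI, rule equals0I)
  fix p q y assume "p \<noteq> q" "y \<in> cyl (x(l + 1 := p)) (l + 1) \<inter> cyl (x(l + 1 := q)) (l + 1)"
  then have "y (l + 1) = p" "y (l + 1) = q" by (auto simp: cyl_def)
  then show False using \<open>p \<noteq> q\<close> by simp
qed

section \<open>Finite subgroups and the lattice \<open>H\<close>\<close>

lemma vfin_V: "x \<in> vfin a b \<Longrightarrow> x \<in> V"
  by (simp add: vfin_def)

lemma vzero_vfin [simp]: "vzero \<in> vfin a b"
  by (simp add: vfin_def) (simp add: vzero_def)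

lemma add_vfin [simp]: "x \<in> vfin a b \<Longrightarrow> y \<in> vfin a b \<Longrightarrow> x \<oplus> y \<in> vfin a b"
  by (simp add: vfin_def) (simp add: vadd_def)

lemma vneg_vfin [simp]: "x \<in> vfin a b \<Longrightarrow> vneg x \<in> vfin a b"
  by (simp add: vfin_def) (simp add: vneg_def)

lemma vshift_vfin: "x \<in> vfin a b \<Longrightarrow> vshift n x \<in> vfin (a - n) (b - n)"
  by (simp add: vfin_def) (simp add: vshift_def)

lemma vfin_mono: "a' \<le> a \<Longrightarrow> b \<le> b' \<Longrightarrow> vfin a b \<subseteq> vfin a' b'"
  by (auto simp: vfin_def)

lemma vfin_bij: "bij_betw (\<lambda>x. restrict x {a<..b}) (vfin a b) ({a<..b} \<rightarrow>\<^sub>E digits M s)"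
proof (rule bij_betw_byWitness[where f' = "\<lambda>f j. if j \<in> {a<..b} then f j else 0"])
  show "(\<lambda>f j. if j \<in> {a<..b} then f j else 0) ` ({a<..b} \<rightarrow>\<^sub>E digits M s) \<subseteq> vfin a b"
    by (auto simp: vfin_def V_iff PiE_mem intro!: exI[of _ a])
qed (auto simp: vfin_def V_digit restrict_def PiE_def extensional_def fun_eq_iff)

lemma finite_vfin [simp]: "finite (vfin a b)"
  using bij_betw_finite[OF vfin_bij, of a b] by (simp add: finite_PiE finite_digits)

lemma card_vfin: "card (vfin a b) = abs_det M ^ nat (b - a)"
  using bij_betw_same_card[OF vfin_bij, of a b] by (simp add: card_PiE card_digits)

text \<open>Group elements vanish far to the left, so each point of \<open>H\<close> has finitely
  many nonzero digits. This is what reduces later sums over \<open>H\<close> to finite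
  groups.\<close>

lemma vlattice_eq_Union_vfin: "vlattice M s = (\<Union>n. vfin (- int n) 0)"
proof (intro set_eqI iffI)
  fix x assume x: "x \<in> vlattice M s"
  then obtain N where "N \<ge> 0" "\<forall>j\<le>-N. x j = 0" using V_lower[of x 0] by (auto simp: vlattice_def)
  then have "x \<in> vfin (- int (nat N)) 0" using x by (auto simp: vfin_def vlattice_def)
  then show "x \<in> (\<Union>n. vfin (- int n) 0)" by blast
qed (auto simp: vlattice_def vfin_def)

lemma vlattice_V: "h \<in> vlattice M s \<Longrightarrow> h \<in> V"
  by (simp add: vlattice_def)

lemma add_vlattice [simp]: "x \<in> vlattice M s \<Longrightarrow> y \<in> vlattice M s \<Longrightarrow> x \<oplus> y \<in> vlattice M s"
  by (simp add: vlattice_def) (simp add: vadd_def)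

lemma vneg_vlattice [simp]: "x \<in> vlattice M s \<Longrightarrow> vneg x \<in> vlattice M s"
  by (simp add: vlattice_def) (simp add: vneg_def)

lemma finite_subset_vlattice:
  assumes "finite G" "G \<subseteq> vlattice M s"
  obtains n where "G \<subseteq> vfin (- int n) 0"
proof -
  have "\<exists>n. G \<subseteq> vfin (- int n) 0"
    using assms
  proof (induction G)
    case (insert g G)
    then obtain n n' where "G \<subseteq> vfin (- int n) 0" "g \<in> vfin (- int n') 0"
      by (auto simp: vlattice_eq_Union_vfin)
    then have "insert g G \<subseteq> vfin (- int (max n n')) 0"
      using vfin_mono[of "- int (max n n')" "- int n" 0 0] vfin_mono[of "- int (max n n')" "- int n'" 0 0]
      by auto
    then show ?case by blast
  qed simp
  then show ?thesis using that by blast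
qed

text \<open>Uniqueness and existence of expansions in base \<open>abs_det M\<close>. Injectivity
  strips the last digit by strong induction; surjectivity rebuilds the number as in Horner's
  rule.\<close>

lemma bij_vgamma: "bij_betw (vgamma M s) UNIV (vlattice M s)"
proof -
  let ?m = "abs_det M"
  have m: "0 < ?m" "Suc 0 < ?m" using abs_det_ge_2 by auto
  \<comment> \<open>Division by the base discards the digit at index 0 and moves the others one
    place.\<close>
  have shift: "vgamma M s k (- int (Suc j)) = vgamma M s (k div ?m) (- int j)" for k j
    by (simp add: vgamma_def div_mult2_eq nat_minus_as_int Suc_nat_eq_nat_zadd1 algebra_simps
        flip: of_nat_Suc)
  have gam0: "vgamma M s k 0 = s (k mod ?m)" for k
    by (simp add: vgamma_def)
  have "j = k" if "vgamma M s j = vgamma M s k" for j k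
    using that
  proof (induction j arbitrary: k rule: less_induct)
    case (less j)
    have "s (j mod ?m) = s (k mod ?m)" using less.prems gam0 by metis
    then have mod: "j mod ?m = k mod ?m"
      using inj_s m by (auto dest: inj_onD)
    have "vgamma M s (j div ?m) i = vgamma M s (k div ?m) i" for i
    proof (cases "i \<le> 0")
      case True
      then obtain n where "i = - int n" by (metis nonpos_int_cases)
      then show ?thesis using shift[of j n] shift[of k n] less.prems by simp
    qed (simp add: vgamma_def)
    then have eq: "vgamma M s (j div ?m) = vgamma M s (k div ?m)" by blast
    show ?case
    proof (cases "j = 0")
      case False
      then have "j div ?m < j" using m by simp
      then have "j div ?m = k div ?m" using less.IH eq by blast
      then show ?thesis using mod by (metis div_mod_decomp)
    next
      case True
      \<comment> \<open>For \<open>j = 0\<close> division does not decrease \<open>j\<close>, so the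
        induction hypothesis gives nothing. Instead all digits of \<open>k\<close> vanish, and
        \<open>k < ?m ^ k\<close> forces \<open>k = 0\<close>.\<close>
      have zero: "s (k div ?m ^ n mod ?m) = 0" for n
        using fun_cong[OF less.prems, of "- int n"] True m by (simp add: vgamma_def s_0)
      then have z: "k div ?m ^ n mod ?m = 0" for n
        using inj_s m inj_onD[OF inj_s, of "k div ?m ^ n mod ?m" 0] s_0 by simp
      have "k div ?m ^ n = 0 \<Longrightarrow> k = 0" for n
      proof (induction n)
        case (Suc n)
        then have "k div ?m ^ n div ?m = 0" by (metis div_mult2_eq power_Suc2)
        then have "k div ?m ^ n = 0" using z[of n] by (metis add_0 mult_0 div_mod_decomp)
        then show ?case using Suc.IH by blast
      qed simp
      moreover have "k div ?m ^ k = 0"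
        using m(2) by (simp add: power_gt_expt)
      ultimately show ?thesis using True by blast
    qed
  qed
  then have "inj (vgamma M s)" by (rule injI)
  moreover have "vgamma M s k \<in> vlattice M s" for k
  proof -
    have "k div ?m ^ nat (- j) = 0" if "j \<le> - int k" for j
    proof -
      have "k \<le> nat (- j)" using that by simp
      then have "k < ?m ^ nat (- j)" using power_gt_expt[OF m(2), of "nat (- j)"] by linarith
      then show ?thesis by simp
    qed
    then have "\<forall>j\<le>- int k. vgamma M s k j = 0" using s_0 by (simp add: vgamma_def)
    moreover have "vgamma M s k j \<in> digits M s" for j
    proof (cases "j \<le> 0")
      case True
      then show ?thesis using m by (auto simp: vgamma_def digits_def)
    qed (simp add: vgamma_def)
    ultimately show ?thesis by (auto simp: vlattice_def V_iff vgamma_def)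
  qed
  moreover have "\<exists>k. x = vgamma M s k" if "x \<in> vfin (- int n) 0" for x n
    using that
  proof (induction n arbitrary: x)
    case 0
    then have "x = vgamma M s 0" using m s_0 by (auto simp: vfin_def vgamma_def fun_eq_iff)
    then show ?case by blast
  next
    case (Suc n)
    define y where "y = (\<lambda>j. if j \<le> 0 then x (j - 1) else 0)"
    have xV: "x \<in> V" and x0: "j \<le> - int (Suc n) \<or> 0 < j \<Longrightarrow> x j = 0" for j
      using Suc.prems by (auto simp: vfin_def)
    have "y \<in> vfin (- int n) 0"
      using xV x0 by (auto simp: vfin_def y_def V_iff intro!: exI[of _ "- int n"])
    then obtain k where k: "y = vgamma M s k" using Suc.IH by blast
    have "x 0 \<in> digits M s" using xV by (rule V_digit)
    then obtain i where i: "i < ?m" "x 0 = s i" by (auto simp: digits_def)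
    have "x j = vgamma M s (k * ?m + i) j" for j
    proof (cases "j < 0")
      case True
      then have "x j = y (j + 1)" by (simp add: y_def)
      moreover obtain n' where n': "j = - int (Suc n')" using True by (metis negative_eq_positive of_nat_Suc int_cases less_irrefl not_less_iff_gr_or_eq of_nat_less_0_iff)
      ultimately show ?thesis unfolding k n' shift using i m by (simp add: algebra_simps)
    next
      case False
      then show ?thesis using i m x0 by (cases "j = 0") (auto simp: gam0 vgamma_def)
    qed
    then show ?case by blast
  qed
  ultimately have "inj (vgamma M s)" "range (vgamma M s) \<subseteq> vlattice M s" "vlattice M s \<subseteq> range (vgamma M s)"
    unfolding vlattice_eq_Union_vfin by blast+
  then show ?thesis unfolding bij_betw_def by blast
qed

lemma countable_vlattice: "countable (vlattice M s)"
  using bij_vgamma by (metis bij_betw_imp_surj_on countable_image countableI_type)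

end

section \<open>Haar measure\<close>

locale vilenkin_measure = vilenkin_group M s for M :: "int ^ 'd ^ 'd" and s :: "nat \<Rightarrow> int ^ 'd" +
  fixes \<mu> :: "'d vseq measure"
  assumes haar: "haar_measure M s \<mu>"
begin

abbreviation "m \<equiv> real (abs_det M)"

lemma m_gt_1: "1 < m"
  using abs_det_ge_2 by linarith

lemma m_pos: "0 < m"
  using abs_det_ge_2 by linarith

section \<open>Borel sets generated by balls, and the measure of a ball\<close>

lemma open_subset_V: "{S. openin (vtopology M s) S} \<subseteq> Pow V"
  by (auto simp: openin_vtopology)

lemma sets_open: "sets \<mu> = sigma_sets V {S. openin (vtopology M s) S}"
  using haar open_subset_V by (simp add: haar_measure_def)

lemma space_eq [simp]: "space \<mu> = V"
proof -
  have "sets \<mu> = sets (sigma V {S. openin (vtopology M s) S})"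
    using haar by (simp add: haar_measure_def)
  from sets_eq_imp_space_eq[OF this] show ?thesis
    using open_subset_V by (simp add: space_measure_of_conv)
qed

lemma open_sets: "openin (vtopology M s) S \<Longrightarrow> S \<in> sets \<mu>"
  unfolding sets_open by (rule sigma_sets.Basic) simp

lemma open_cyl: "openin (vtopology M s) (cyl x l)"
  unfolding openin_vtopology
proof (intro conjI ballI exI)
  fix y u assume yu: "y \<in> cyl x l" "u \<in> vnbhd M s l"
  then have "(y \<oplus> u) j = y j" if "j \<le> l" for j
  proof -
    have "y \<in> V" "u j = 0" using yu that by (simp_all add: cyl_def vnbhd_def)
    then have "y j \<in> digits M s" by (simp add: V_digit)
    then show ?thesis using \<open>u j = 0\<close> by (simp add: vadd_def)
  qed
  then show "y \<oplus> u \<in> cyl x l"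
    using yu by (auto simp: cyl_def vnbhd_def)
qed (rule cyl_V)

lemma cyl_sets [measurable]: "cyl x l \<in> sets \<mu>"
  by (rule open_sets[OF open_cyl])

text \<open>Two balls are nested or disjoint; the empty set is adjoined to make the family stable
  under intersection.\<close>

definition cyls :: "'d vseq set set" where
  "cyls = insert {} {cyl x l | x l. x \<in> V}"

lemma cyls_V: "cyls \<subseteq> Pow V"
  using cyl_V by (auto simp: cyls_def)

text \<open>Only coordinates up to \<open>l\<close> of the centre matter; shifted by
  \<open>l\<close> they form an element of the countable set \<open>H\<close>.\<close>

lemma countable_cyls: "countable cyls"
proof -
  have "cyl x l \<in> (\<lambda>(h, l). cyl (vshift (- l) h) l) ` (vlattice M s \<times> UNIV)" if "x \<in> V" for x l
  proof -
    define h where "h = (\<lambda>j. if j \<le> 0 then vshift l x j else 0)"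
    have x: "vshift l x \<in> V" using that by simp
    have "h \<in> V" using x unfolding V_iff h_def by auto
    then have "h \<in> vlattice M s" by (auto simp: vlattice_def h_def)
    moreover have "cyl (vshift (- l) h) l = cyl x l"
      by (auto simp: cyl_def vshift_def h_def)
    ultimately show ?thesis by force
  qed
  then have "cyls \<subseteq> insert {} ((\<lambda>(h, l). cyl (vshift (- l) h) l) ` (vlattice M s \<times> UNIV))"
    by (auto simp: cyls_def)
  then show ?thesis
    by (rule countable_subset) (intro countable_insert countable_image countable_SIGMA countable_vlattice countableI_type)
qed

text \<open>Every open set is the union of the balls inside it, and there are only countably many
  balls.\<close>

lemma sets_cyls: "sets \<mu> = sigma_sets V cyls"
  unfolding sets_open
proof (rule sigma_sets_eqI)
  fix S assume "S \<in> {S. openin (vtopology M s) S}"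
  then have S: "openin (vtopology M s) S" by simp
  have "S = \<Union>{C \<in> cyls. C \<subseteq> S}"
  proof (intro set_eqI iffI)
    fix x assume x: "x \<in> S"
    then have xV: "x \<in> V" using S by (auto simp: openin_vtopology)
    obtain l where l: "\<forall>u \<in> vnbhd M s l. x \<oplus> u \<in> S"
      using S x unfolding openin_vtopology by meson
    have "cyl x l \<subseteq> S"
    proof -
      have "cyl x l = vadd M s x ` cyl vzero l" using image_add_cyl[OF xV vzero_V, of l] xV by simp
      then show ?thesis using l unfolding vnbhd_eq_cyl by (simp only: image_subset_iff)
    qed
    moreover have "cyl x l \<in> cyls" "x \<in> cyl x l" using xV by (auto simp: cyls_def)
    ultimately show "x \<in> \<Union>{C \<in> cyls. C \<subseteq> S}" by (intro UnionI[of "cyl x l"] CollectI conjI)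
  qed auto
  moreover have "countable {C \<in> cyls. C \<subseteq> S}"
    by (rule countable_subset[OF _ countable_cyls]) auto
  then have "\<Union>{C \<in> cyls. C \<subseteq> S} \<in> sigma_sets V cyls"
    by (rule sigma_sets_UNION) (simp add: sigma_sets.Basic)
  ultimately show "S \<in> sigma_sets V cyls" by (rule ssubst)
next
  fix C assume "C \<in> cyls"
  then have "openin (vtopology M s) C" using open_cyl by (auto simp: cyls_def)
  then show "C \<in> sigma_sets V {S. openin (vtopology M s) S}" by (intro sigma_sets.Basic) simp
qed

lemma Int_stable_cyls: "Int_stable cyls"
proof (rule Int_stableI)
  fix A B assume AB: "A \<in> cyls" "B \<in> cyls"
  show "A \<inter> B \<in> cyls"
  proof (cases "A \<inter> B = {}")
    case False
    then obtain z where z: "z \<in> A" "z \<in> B" by blast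
    have "\<exists>l. C = cyl z l" if C: "C \<in> cyls" "z \<in> C" for C
    proof -
      obtain x l where "C = cyl x l" using C by (auto simp: cyls_def)
      then show ?thesis using cyl_eq C(2) by blast
    qed
    then obtain l l' where "A = cyl z l" "B = cyl z l'" using AB z by meson
    moreover have "z \<in> V" using AB z cyls_V by blast
    ultimately show ?thesis
      using cyl_antimono[of l l' z] cyl_antimono[of l' l z]
      by (cases "l \<le> l'") (auto simp: cyls_def Int_absorb1 Int_absorb2)
  qed (simp add: cyls_def)
qed

lemma emeasure_cyl_translate:
  assumes "x \<in> V" shows "emeasure \<mu> (cyl x l) = emeasure \<mu> (cyl vzero l)"
proof -
  have "\<forall>x\<in>V. \<forall>A\<in>sets \<mu>. emeasure \<mu> (vadd M s x ` A) = emeasure \<mu> A"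
    using haar unfolding haar_measure_def by blast
  from bspec[OF bspec[OF this assms] cyl_sets]
  have "emeasure \<mu> (vadd M s x ` cyl vzero l) = emeasure \<mu> (cyl vzero l)" .
  then show ?thesis using assms by (simp add: image_add_cyl)
qed

lemma emeasure_cyl_Suc: "emeasure \<mu> (cyl vzero l) = abs_det M * emeasure \<mu> (cyl vzero (l + 1))"
proof -
  have "emeasure \<mu> (cyl vzero l) = (\<Sum>q\<in>digits M s. emeasure \<mu> (cyl (vzero(l + 1 := q)) (l + 1)))"
    unfolding cyl_split[of vzero l]
    by (rule sum_emeasure[symmetric]) (auto simp: finite_digits disjoint_cyl_split)
  also have "\<dots> = (\<Sum>q\<in>digits M s. emeasure \<mu> (cyl vzero (l + 1)))"
  proof (rule sum.cong[OF refl], rule emeasure_cyl_translate)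
    fix q assume "q \<in> digits M s"
    then show "vzero(l + 1 := q) \<in> V"
      unfolding V_iff by (intro conjI exI[of _ l]) (auto simp: vzero_def)
  qed
  also have "\<dots> = abs_det M * emeasure \<mu> (cyl vzero (l + 1))"
    by (simp add: card_digits)
  finally show ?thesis .
qed

text \<open>The recursion between levels starts from the value 1 at level 0 and is needed in both
  directions; hence \<open>step\<close> is an equivalence.\<close>

lemma emeasure_cyl:
  assumes "x \<in> V" shows "emeasure \<mu> (cyl x l) = ennreal (m powi (- l))"
proof -
  have one: "emeasure \<mu> (cyl vzero 0) = 1"
    using haar by (simp add: haar_measure_def vnbhd_eq_cyl)
  have step: "emeasure \<mu> (cyl vzero (l + 1)) = ennreal (m powi (- (l + 1))) \<longleftrightarrow>
      emeasure \<mu> (cyl vzero l) = ennreal (m powi (- l))" for l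
  proof -
    have m: "ennreal (m powi (- l)) = abs_det M * ennreal (m powi (- (l + 1)))"
    proof -
      have "m powi (- l) = m * m powi (- (l + 1))"
        using m_pos by (simp add: power_int_diff power_int_minus field_simps)
      then show ?thesis by (simp add: ennreal_mult' ennreal_of_nat_eq_real_of_nat)
    qed
    show ?thesis
      unfolding m emeasure_cyl_Suc[of l]
      using abs_det_ge_2 by (auto simp: ennreal_mult_cancel_left ennreal_of_nat_eq_real_of_nat)
  qed
  have "emeasure \<mu> (cyl vzero l) = ennreal (m powi (- l))"
  proof (induction l rule: int_induct[where k = 0])
    case (step1 i)
    then show ?case using step[of i] by simp
  next
    case (step2 i)
    then show ?case using step[of "i - 1"] by simp
  qed (simp add: one)
  then show ?thesis using emeasure_cyl_translate[OF assms] by simp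
qed

lemma measure_cyl: "x \<in> V \<Longrightarrow> measure \<mu> (cyl x l) = m powi (- l)"
  by (simp add: measure_def emeasure_cyl)

lemma V_Union_cyl: "V = (\<Union>n. cyl vzero (- int n))"
proof (intro set_eqI iffI)
  fix x assume x: "x \<in> V"
  then obtain N where "0 \<le> N" "\<forall>j\<le>-N. x j = 0" using V_lower[of x 0] by blast
  then have "x \<in> cyl vzero (- int (nat N))" using x by (auto simp: cyl_def vzero_def)
  then show "x \<in> (\<Union>n. cyl vzero (- int n))" by blast
qed (use cyl_V in auto)

text \<open>Balls are an intersection-stable generator, and those around the neutral element exhaust
  the group with finite measure.\<close>

lemma measure_eqI_cyl:
  assumes "sets N = sets \<mu>" "\<And>x l. x \<in> V \<Longrightarrow> emeasure N (cyl x l) = ennreal (m powi (- l))"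
  shows "\<mu> = N"
proof (rule measure_eqI_generator_eq[OF Int_stable_cyls cyls_V, where A = "\<lambda>n. cyl vzero (- int n)"])
  show "emeasure \<mu> X = emeasure N X" if "X \<in> cyls" for X
    using that assms(2) by (auto simp: cyls_def emeasure_cyl)
qed (use assms(1) in \<open>auto simp: sets_cyls emeasure_cyl V_Union_cyl[symmetric] cyls_def intro!: exI[of _ vzero]\<close>)

sublocale sigma_finite_measure \<mu>
proof
  show "\<exists>A. countable A \<and> A \<subseteq> sets \<mu> \<and> \<Union> A = space \<mu> \<and> (\<forall>a\<in>A. emeasure \<mu> a \<noteq> \<infinity>)"
    by (rule exI[of _ "range (\<lambda>n. cyl vzero (- int n))"])
       (auto simp: emeasure_cyl V_Union_cyl[symmetric])
qed

lemma emeasure_point: "x \<in> V \<Longrightarrow> emeasure \<mu> {x} = 0"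
proof -
  assume x: "x \<in> V"
  have "emeasure \<mu> {x} \<le> ennreal (inverse m ^ n)" for n
  proof -
    have "emeasure \<mu> {x} \<le> emeasure \<mu> (cyl x (int n))"
      by (rule emeasure_mono) (use x in auto)
    also have "\<dots> = ennreal (inverse m ^ n)"
      using x by (simp add: emeasure_cyl power_int_minus power_inverse)
    finally show ?thesis .
  qed
  moreover have "(\<lambda>n. ennreal (inverse m ^ n)) \<longlonglongrightarrow> ennreal 0"
    using m_gt_1 by (intro tendsto_ennrealI LIMSEQ_realpow_zero) (simp_all add: inverse_less_1_iff)
  ultimately have "emeasure \<mu> {x} \<le> ennreal 0" by (intro LIMSEQ_le_const[of _ "ennreal 0"]) auto
  then show ?thesis by simp
qed

section \<open>Measurability and change of variables under shifts and translations\<close>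

lemma measurable_coordinate [measurable]: "(\<lambda>x. x j) \<in> measurable \<mu> (count_space UNIV)"
proof (subst measurable_count_space_eq_countable, safe)
  show "(\<lambda>x. x j) -` {v} \<inter> space \<mu> \<in> sets \<mu>" for v
  proof (rule open_sets, unfold openin_vtopology, intro conjI ballI exI)
    fix x u assume "x \<in> (\<lambda>x. x j) -` {v} \<inter> space \<mu>" "u \<in> vnbhd M s j"
    then show "x \<oplus> u \<in> (\<lambda>x. x j) -` {v} \<inter> space \<mu>"
      by (auto simp: vnbhd_def) (simp add: vadd_def V_digit)
  qed auto
qed auto

lemma affine_vimage_cyl:
  assumes "y \<in> V" "h \<in> V"
  shows "(\<lambda>x. vshift n x \<oplus> h) -` cyl y l \<inter> V = cyl (vshift (- n) (y \<oplus> vneg h)) (l + n)"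
proof (rule set_eqI)
  fix x
  show "x \<in> (\<lambda>x. vshift n x \<oplus> h) -` cyl y l \<inter> V \<longleftrightarrow> x \<in> cyl (vshift (- n) (y \<oplus> vneg h)) (l + n)"
    using affine_cyl_iff[of x y h n l] assms cyl_V by (cases "x \<in> V") auto
qed

lemma measurable_affine:
  assumes "h \<in> V" shows "(\<lambda>x. vshift n x \<oplus> h) \<in> measurable \<mu> \<mu>"
proof (rule measurable_sigma_sets[OF sets_cyls cyls_V])
  fix C assume "C \<in> cyls"
  then consider "C = {}" | y l where "y \<in> V" "C = cyl y l" by (auto simp: cyls_def)
  then show "(\<lambda>x. vshift n x \<oplus> h) -` C \<inter> space \<mu> \<in> sets \<mu>"
  proof cases
    case 2
    then show ?thesis using assms by (simp add: affine_vimage_cyl)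
  qed simp
qed (use assms in auto)

text \<open>Both measures are compared on balls, whose preimages are balls \<open>n\<close> levels
  deeper. Written as a density, the scaling of Haar measure becomes the substitution rule for
  integrals.\<close>

lemma density_affine:
  assumes "h \<in> V"
  shows "\<mu> = density (distr \<mu> \<mu> (\<lambda>x. vshift n x \<oplus> h)) (\<lambda>_. ennreal (m powi n))"
proof (rule measure_eqI_cyl)
  fix y l assume y: "y \<in> V"
  have "emeasure (distr \<mu> \<mu> (\<lambda>x. vshift n x \<oplus> h)) (cyl y l) = ennreal (m powi (- (l + n)))"
    using measurable_affine[OF assms] y assms by (simp add: emeasure_distr emeasure_cyl affine_vimage_cyl)
  moreover have "m powi n * m powi (- (l + n)) = m powi (- l)"
    using m_pos by (subst power_int_add[symmetric]) auto
  ultimately show "emeasure (density (distr \<mu> \<mu> (\<lambda>x. vshift n x \<oplus> h)) (\<lambda>_. ennreal (m powi n))) (cyl y l)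
      = ennreal (m powi (- l))"
    using m_pos by (simp add: emeasure_density nn_integral_cmult_indicator flip: ennreal_mult')
qed simp

lemma
  fixes f :: "'d vseq \<Rightarrow> 'b::{banach, second_countable_topology}"
  assumes h: "h \<in> V" and f: "f \<in> borel_measurable \<mu>"
  shows integrable_affine_iff: "integrable \<mu> (\<lambda>x. f (vshift n x \<oplus> h)) \<longleftrightarrow> integrable \<mu> f"
    and integral_affine: "(LINT x|\<mu>. f (vshift n x \<oplus> h)) = m powi (- n) *\<^sub>R (LINT x|\<mu>. f x)"
    and borel_measurable_affine: "(\<lambda>x. f (vshift n x \<oplus> h)) \<in> borel_measurable \<mu>"
proof -
  note T = measurable_affine[OF h, of n]
  have c: "0 < m powi n" using m_pos by simp
  show "(\<lambda>x. f (vshift n x \<oplus> h)) \<in> borel_measurable \<mu>"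
    using measurable_compose[OF T f] .
  have "integrable \<mu> f \<longleftrightarrow> integrable (density (distr \<mu> \<mu> (\<lambda>x. vshift n x \<oplus> h)) (\<lambda>_. ennreal (m powi n))) f"
    using density_affine[OF h, of n] by simp
  also have "\<dots> \<longleftrightarrow> integrable (distr \<mu> \<mu> (\<lambda>x. vshift n x \<oplus> h)) (\<lambda>x. m powi n *\<^sub>R f x)"
    using c f by (subst integrable_density) auto
  also have "\<dots> \<longleftrightarrow> integrable \<mu> (\<lambda>x. m powi n *\<^sub>R f (vshift n x \<oplus> h))"
    using f by (subst integrable_distr_eq[OF T]) auto
  finally have "integrable \<mu> f \<longleftrightarrow> integrable \<mu> (\<lambda>x. m powi n *\<^sub>R f (vshift n x \<oplus> h))" .
  moreover have "integrable \<mu> (\<lambda>x. f (vshift n x \<oplus> h))"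
    if "integrable \<mu> (\<lambda>x. m powi n *\<^sub>R f (vshift n x \<oplus> h))"
  proof -
    have ne: "m powi n \<noteq> 0" using c by linarith
    show ?thesis
      using integrable_scaleR_right[of "inverse (m powi n)", OF that]
      by (simp only: scaleR_scaleR left_inverse[OF ne] scaleR_one)
  qed
  ultimately show "integrable \<mu> (\<lambda>x. f (vshift n x \<oplus> h)) \<longleftrightarrow> integrable \<mu> f"
    by auto
  have "(LINT x|\<mu>. f x) = integral\<^sup>L (density (distr \<mu> \<mu> (\<lambda>x. vshift n x \<oplus> h)) (\<lambda>_. ennreal (m powi n))) f"
    using density_affine[OF h, of n] by simp
  also have "\<dots> = integral\<^sup>L (distr \<mu> \<mu> (\<lambda>x. vshift n x \<oplus> h)) (\<lambda>x. m powi n *\<^sub>R f x)"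
    using c f by (subst integral_density) auto
  also have "\<dots> = (LINT x|\<mu>. m powi n *\<^sub>R f (vshift n x \<oplus> h))"
    using f by (subst integral_distr[OF T]) auto
  finally show "(LINT x|\<mu>. f (vshift n x \<oplus> h)) = m powi (- n) *\<^sub>R (LINT x|\<mu>. f x)"
    using left_inverse[of "m powi n"] less_imp_neq[OF c, symmetric] by (simp add: power_int_minus del: power_int_eq_0_iff)
qed

end

section \<open>Square-integrable functions\<close>

lemma borel_measurable_cnj: "f \<in> borel_measurable M \<Longrightarrow> (\<lambda>x. cnj (f x)) \<in> borel_measurable M"
proof -
  assume f: "f \<in> borel_measurable M"
  have "cnj \<in> borel_measurable borel"
    by (rule borel_measurable_continuous_onI) (rule bounded_linear.continuous_on[OF bounded_linear_cnj continuous_on_id])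
  from measurable_compose[OF f this] show ?thesis .
qed

lemma L2_fun_borel: "L2_fun \<mu> f \<Longrightarrow> f \<in> borel_measurable \<mu>"
  by (simp add: L2_fun_def)

lemma L2_fun_integrable: "L2_fun \<mu> f \<Longrightarrow> integrable \<mu> (\<lambda>x. (cmod (f x))\<^sup>2)"
  by (simp add: L2_fun_def)

lemma L2_funI_bounded:
  assumes "f \<in> borel_measurable \<mu>" "integrable \<mu> w" "\<And>x. x \<in> space \<mu> \<Longrightarrow> (cmod (f x))\<^sup>2 \<le> w x"
  shows "L2_fun \<mu> f"
  unfolding L2_fun_def
proof (intro conjI assms)
  show "integrable \<mu> (\<lambda>x. (cmod (f x))\<^sup>2)"
  proof (rule Bochner_Integration.integrable_bound[OF assms(2)])
    show "(\<lambda>x. (cmod (f x))\<^sup>2) \<in> borel_measurable \<mu>" using assms(1) by simp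
    have "norm ((cmod (f x))\<^sup>2) \<le> norm (w x)" if "x \<in> space \<mu>" for x
      using assms(3)[OF that] zero_le_power2[of "cmod (f x)"] by simp
    then show "AE x in \<mu>. norm ((cmod (f x))\<^sup>2) \<le> norm (w x)" by (rule AE_I2)
  qed
qed

lemma norm_add_squared_le: "(norm (a + b))\<^sup>2 \<le> 2 * (norm a)\<^sup>2 + 2 * (norm (b::'a::real_normed_vector))\<^sup>2"
proof -
  have "(norm (a + b))\<^sup>2 \<le> (norm a + norm b)\<^sup>2"
    by (intro power_mono norm_triangle_ineq) simp
  also have "\<dots> \<le> 2 * (norm a)\<^sup>2 + 2 * (norm b)\<^sup>2"
    using sum_squares_bound[of "norm a" "norm b"] by (simp add: power2_sum)
  finally show ?thesis .
qed

lemma L2_fun_add: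
  assumes "L2_fun \<mu> f" "L2_fun \<mu> g" shows "L2_fun \<mu> (\<lambda>x. f x + g x)"
proof (rule L2_funI_bounded)
  show "integrable \<mu> (\<lambda>x. 2 * (cmod (f x))\<^sup>2 + 2 * (cmod (g x))\<^sup>2)"
    using assms by (simp add: L2_fun_def)
qed (use assms in \<open>auto simp: L2_fun_def intro: norm_add_squared_le\<close>)

lemma L2_fun_cmult: "L2_fun \<mu> f \<Longrightarrow> L2_fun \<mu> (\<lambda>x. c * f x)"
  by (auto simp: L2_fun_def norm_mult power_mult_distrib)

lemma L2_fun_zero: "L2_fun \<mu> (\<lambda>x. 0)"
  by (simp add: L2_fun_def)

lemma L2_fun_diff: "L2_fun \<mu> f \<Longrightarrow> L2_fun \<mu> g \<Longrightarrow> L2_fun \<mu> (\<lambda>x. f x - g x)"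
  using L2_fun_add[of \<mu> f "\<lambda>x. -1 * g x"] L2_fun_cmult[of \<mu> g "-1"] by simp

lemma L2_fun_sum: "(\<And>i. i \<in> F \<Longrightarrow> L2_fun \<mu> (f i)) \<Longrightarrow> L2_fun \<mu> (\<lambda>x. \<Sum>i\<in>F. f i x)"
  by (induction F rule: infinite_finite_induct) (auto intro: L2_fun_zero L2_fun_add)

lemma L2_fun_lin: "(\<And>i. i \<in> F \<Longrightarrow> L2_fun \<mu> (f i)) \<Longrightarrow> L2_fun \<mu> (\<lambda>x. \<Sum>i\<in>F. c i * f i x)"
  by (intro L2_fun_sum L2_fun_cmult)

lemma L2_fun_indicator:
  "A \<in> sets \<mu> \<Longrightarrow> emeasure \<mu> A < \<infinity> \<Longrightarrow> L2_fun \<mu> (indicator A)"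
proof -
  assume A: "A \<in> sets \<mu>" "emeasure \<mu> A < \<infinity>"
  have "(\<lambda>x. (cmod (indicator A x))\<^sup>2) = indicat_real A"
    by (auto simp: indicator_def fun_eq_iff)
  then show ?thesis using A by (simp add: L2_fun_def)
qed

lemma L2_inner_integrable:
  assumes "L2_fun \<mu> f" "L2_fun \<mu> g" shows "integrable \<mu> (\<lambda>x. f x * cnj (g x))"
proof (rule Bochner_Integration.integrable_bound)
  show "integrable \<mu> (\<lambda>x. (cmod (f x))\<^sup>2 + (cmod (g x))\<^sup>2)"
    using assms by (simp add: L2_fun_def)
  show "(\<lambda>x. f x * cnj (g x)) \<in> borel_measurable \<mu>"
    using assms by (intro borel_measurable_times borel_measurable_cnj) (simp_all add: L2_fun_def)
  have "cmod a * cmod b \<le> (cmod a)\<^sup>2 + (cmod b)\<^sup>2" for a b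
  proof -
    have "0 \<le> cmod a * cmod b" by simp
    then show ?thesis using sum_squares_bound[of "cmod a" "cmod b"] by linarith
  qed
  then show "AE x in \<mu>. norm (f x * cnj (g x)) \<le> norm ((cmod (f x))\<^sup>2 + (cmod (g x))\<^sup>2)"
    by (auto simp: norm_mult)
qed

lemma L2_inner_add_left:
  "L2_fun \<mu> f \<Longrightarrow> L2_fun \<mu> g \<Longrightarrow> L2_fun \<mu> h \<Longrightarrow>
    L2_inner \<mu> (\<lambda>x. f x + g x) h = L2_inner \<mu> f h + L2_inner \<mu> g h"
  by (simp add: L2_inner_def distrib_right L2_inner_integrable)

lemma L2_inner_diff_left:
  "L2_fun \<mu> f \<Longrightarrow> L2_fun \<mu> g \<Longrightarrow> L2_fun \<mu> h \<Longrightarrow>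
    L2_inner \<mu> (\<lambda>x. f x - g x) h = L2_inner \<mu> f h - L2_inner \<mu> g h"
  by (simp add: L2_inner_def left_diff_distrib L2_inner_integrable)

lemma L2_inner_cmult_left: "L2_inner \<mu> (\<lambda>x. c * f x) h = c * L2_inner \<mu> f h"
  by (simp add: L2_inner_def mult.assoc)

lemma L2_inner_zero_left: "L2_inner \<mu> (\<lambda>x. 0) h = 0"
  by (simp add: L2_inner_def)

lemma L2_inner_commute: "L2_inner \<mu> f g = cnj (L2_inner \<mu> g f)"
  unfolding L2_inner_def by (subst Bochner_Integration.integral_cnj[symmetric]) (simp add: mult.commute)

lemma L2_inner_lin_left:
  assumes "\<And>i. i \<in> F \<Longrightarrow> L2_fun \<mu> (f i)" "L2_fun \<mu> h"
  shows "L2_inner \<mu> (\<lambda>x. \<Sum>i\<in>F. c i * f i x) h = (\<Sum>i\<in>F. c i * L2_inner \<mu> (f i) h)"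
  using assms(1)
  by (induction F rule: infinite_finite_induct)
     (simp_all add: L2_inner_zero_left L2_inner_add_left L2_inner_cmult_left L2_fun_cmult L2_fun_lin assms(2))

lemma L2_inner_lin_right:
  assumes "\<And>i. i \<in> F \<Longrightarrow> L2_fun \<mu> (f i)" "L2_fun \<mu> h"
  shows "L2_inner \<mu> h (\<lambda>x. \<Sum>i\<in>F. c i * f i x) = (\<Sum>i\<in>F. cnj (c i) * L2_inner \<mu> h (f i))"
  using L2_inner_lin_left[where c = c, OF assms] L2_inner_commute[of \<mu> h] by (simp add: cnj_sum)

lemma L2_inner_diff_right:
  "L2_fun \<mu> f \<Longrightarrow> L2_fun \<mu> g \<Longrightarrow> L2_fun \<mu> h \<Longrightarrow>
    L2_inner \<mu> h (\<lambda>x. f x - g x) = L2_inner \<mu> h f - L2_inner \<mu> h g"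
  using L2_inner_diff_left[of \<mu> f g h] L2_inner_commute[of \<mu> h] by simp

lemma L2_inner_add_right:
  "L2_fun \<mu> f \<Longrightarrow> L2_fun \<mu> g \<Longrightarrow> L2_fun \<mu> h \<Longrightarrow>
    L2_inner \<mu> h (\<lambda>x. f x + g x) = L2_inner \<mu> h f + L2_inner \<mu> h g"
  using L2_inner_add_left[of \<mu> f g h] L2_inner_commute[of \<mu> h] by simp

lemma L2_inner_cmult_right: "L2_inner \<mu> h (\<lambda>x. c * f x) = cnj c * L2_inner \<mu> h f"
  using L2_inner_cmult_left[of \<mu> c f h] L2_inner_commute[of \<mu> h] by simp

lemma L2_inner_cong_AE:
  assumes "AE x in \<mu>. f x = f' x" "AE x in \<mu>. g x = g' x" "L2_fun \<mu> f" "L2_fun \<mu> f'" "L2_fun \<mu> g" "L2_fun \<mu> g'"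
  shows "L2_inner \<mu> f g = L2_inner \<mu> f' g'"
  unfolding L2_inner_def
proof (rule integral_cong_AE)
  show "AE x in \<mu>. f x * cnj (g x) = f' x * cnj (g' x)" using assms(1,2) by eventually_elim simp
qed (use assms in \<open>auto intro!: borel_measurable_integrable L2_inner_integrable\<close>)

lemma L2_nrm_nonneg [simp]: "0 \<le> L2_nrm \<mu> f"
  by (simp add: L2_nrm_def)

lemma L2_nrm_squared: "(L2_nrm \<mu> f)\<^sup>2 = (LINT x|\<mu>. (cmod (f x))\<^sup>2)"
  by (simp add: L2_nrm_def)

lemma L2_inner_self: "L2_inner \<mu> f f = of_real ((L2_nrm \<mu> f)\<^sup>2)"
  by (simp add: L2_inner_def L2_nrm_squared complex_norm_square[symmetric] flip: integral_complex_of_real)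

lemma L2_nrm_cong_AE:
  assumes "AE x in \<mu>. f x = g x" "f \<in> borel_measurable \<mu>" "g \<in> borel_measurable \<mu>"
  shows "L2_nrm \<mu> f = L2_nrm \<mu> g"
  unfolding L2_nrm_def using assms by (intro arg_cong[of _ _ sqrt] integral_cong_AE) auto

lemma L2_nrm_eq_0_iff:
  assumes "L2_fun \<mu> f" shows "L2_nrm \<mu> f = 0 \<longleftrightarrow> (AE x in \<mu>. f x = 0)"
  unfolding L2_nrm_def using assms
  by (simp add: L2_fun_def integral_nonneg_eq_0_iff_AE)

lemma L2_nrm_cmult: "L2_nrm \<mu> (\<lambda>x. c * f x) = cmod c * L2_nrm \<mu> f"
  by (simp add: L2_nrm_def norm_mult power_mult_distrib real_sqrt_mult)

text \<open>Integrating the square of \<open>?b * cmod (f x) - ?a * cmod (g x)\<close> gives the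
  inequality multiplied by both norms, so a vanishing norm is treated separately.\<close>

lemma L2_Cauchy_Schwarz_norm:
  assumes f: "L2_fun \<mu> f" and g: "L2_fun \<mu> g"
  shows "(LINT x|\<mu>. cmod (f x) * cmod (g x)) \<le> L2_nrm \<mu> f * L2_nrm \<mu> g"
proof -
  let ?a = "L2_nrm \<mu> f" and ?b = "L2_nrm \<mu> g"
  have int: "integrable \<mu> (\<lambda>x. cmod (f x) * cmod (g x))"
    using integrable_norm[OF L2_inner_integrable[OF f g]] by (simp add: norm_mult)
  show ?thesis
  proof (cases "?a = 0 \<or> ?b = 0")
    case True
    then have "AE x in \<mu>. cmod (f x) * cmod (g x) = 0"
      using L2_nrm_eq_0_iff[OF f] L2_nrm_eq_0_iff[OF g] by auto
    then have "(LINT x|\<mu>. cmod (f x) * cmod (g x)) = 0"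
      by (subst integral_cong_AE[of _ _ "\<lambda>_. 0"]) (use int in auto)
    then show ?thesis by simp
  next
    case False
    then have pos: "0 < ?a * ?b" by (simp add: less_le)
    have "0 \<le> (LINT x|\<mu>. (?b * cmod (f x) - ?a * cmod (g x))\<^sup>2)"
      by (intro integral_nonneg_AE) auto
    also have "\<dots> = (LINT x|\<mu>. ?b\<^sup>2 * (cmod (f x))\<^sup>2 + ?a\<^sup>2 * (cmod (g x))\<^sup>2 - 2 * ?a * ?b * (cmod (f x) * cmod (g x)))"
      by (intro Bochner_Integration.integral_cong) (auto simp: power2_diff power_mult_distrib)
    also have "\<dots> = ?b\<^sup>2 * ?a\<^sup>2 + ?a\<^sup>2 * ?b\<^sup>2 - 2 * ?a * ?b * (LINT x|\<mu>. cmod (f x) * cmod (g x))"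
      using f g int by (simp add: L2_fun_def L2_nrm_squared)
    finally have "(?a * ?b) * (LINT x|\<mu>. cmod (f x) * cmod (g x)) \<le> (?a * ?b) * (?a * ?b)"
      by (simp add: power2_eq_square algebra_simps)
    then show ?thesis using pos by (simp only: mult_le_cancel_left_pos)
  qed
qed

lemma L2_Cauchy_Schwarz:
  assumes "L2_fun \<mu> f" "L2_fun \<mu> g"
  shows "cmod (L2_inner \<mu> f g) \<le> L2_nrm \<mu> f * L2_nrm \<mu> g"
proof -
  have "cmod (L2_inner \<mu> f g) \<le> (LINT x|\<mu>. cmod (f x * cnj (g x)))"
    unfolding L2_inner_def by (rule integral_norm_bound)
  then show ?thesis using L2_Cauchy_Schwarz_norm[OF assms] by (simp add: norm_mult)
qed

lemma L2_nrm_triangle: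
  assumes f: "L2_fun \<mu> f" and g: "L2_fun \<mu> g"
  shows "L2_nrm \<mu> (\<lambda>x. f x + g x) \<le> L2_nrm \<mu> f + L2_nrm \<mu> g"
proof (rule power2_le_imp_le)
  have "complex_of_real ((L2_nrm \<mu> (\<lambda>x. f x + g x))\<^sup>2)
      = L2_inner \<mu> f f + L2_inner \<mu> g g + (L2_inner \<mu> f g + cnj (L2_inner \<mu> f g))"
    unfolding L2_inner_self[symmetric] using f g
    by (simp add: L2_inner_add_left L2_inner_add_right L2_fun_add L2_inner_commute[of \<mu> g f])
  also have "\<dots> = of_real ((L2_nrm \<mu> f)\<^sup>2 + (L2_nrm \<mu> g)\<^sup>2 + 2 * Re (L2_inner \<mu> f g))"
    by (simp add: L2_inner_self complex_add_cnj)
  finally have "(L2_nrm \<mu> (\<lambda>x. f x + g x))\<^sup>2 = (L2_nrm \<mu> f)\<^sup>2 + (L2_nrm \<mu> g)\<^sup>2 + 2 * Re (L2_inner \<mu> f g)"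
    by (simp only: of_real_eq_iff)
  moreover have "Re (L2_inner \<mu> f g) \<le> L2_nrm \<mu> f * L2_nrm \<mu> g"
    using L2_Cauchy_Schwarz[OF f g] complex_Re_le_cmod order_trans by blast
  ultimately show "(L2_nrm \<mu> (\<lambda>x. f x + g x))\<^sup>2 \<le> (L2_nrm \<mu> f + L2_nrm \<mu> g)\<^sup>2"
    by (simp add: power2_sum)
qed simp

lemma L2_nrm_triangle_diff:
  assumes "L2_fun \<mu> f" "L2_fun \<mu> g" "L2_fun \<mu> h"
  shows "L2_nrm \<mu> (\<lambda>x. f x - h x) \<le> L2_nrm \<mu> (\<lambda>x. f x - g x) + L2_nrm \<mu> (\<lambda>x. g x - h x)"
  using L2_nrm_triangle[of \<mu> "\<lambda>x. f x - g x" "\<lambda>x. g x - h x"] assms by (simp add: L2_fun_diff)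

lemma L2_dominated_convergence:
  assumes F: "\<And>n. F n \<in> borel_measurable \<mu>" and f: "f \<in> borel_measurable \<mu>"
    and w: "integrable \<mu> (\<lambda>x. (w x)\<^sup>2)" "\<And>n x. x \<in> space \<mu> \<Longrightarrow> cmod (F n x) \<le> w x"
    and lim: "\<And>x. x \<in> space \<mu> \<Longrightarrow> (\<lambda>n. F n x) \<longlonglongrightarrow> f x"
  shows "(\<lambda>n. L2_nrm \<mu> (\<lambda>x. f x - F n x)) \<longlonglongrightarrow> 0"
proof -
  have fw: "cmod (f x) \<le> w x" if "x \<in> space \<mu>" for x
    by (rule LIMSEQ_le_const2[OF tendsto_norm[OF lim[OF that]]]) (use w(2) that in auto)
  have "(\<lambda>n. LINT x|\<mu>. (cmod (f x - F n x))\<^sup>2) \<longlonglongrightarrow> (LINT x|\<mu>. 0)"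
  proof (rule integral_dominated_convergence[where w = "\<lambda>x. 4 * (w x)\<^sup>2"])
    show "AE x in \<mu>. (\<lambda>n. (cmod (f x - F n x))\<^sup>2) \<longlonglongrightarrow> 0"
    proof (rule AE_I2)
      fix x assume "x \<in> space \<mu>"
      then have "(\<lambda>n. (cmod (f x - F n x))\<^sup>2) \<longlonglongrightarrow> (cmod (f x - f x))\<^sup>2"
        by (intro tendsto_intros lim)
      then show "(\<lambda>n. (cmod (f x - F n x))\<^sup>2) \<longlonglongrightarrow> 0" by simp
    qed
    show "AE x in \<mu>. norm ((cmod (f x - F n x))\<^sup>2) \<le> 4 * (w x)\<^sup>2" for n
    proof (rule AE_I2)
      fix x assume "x \<in> space \<mu>"
      then have "cmod (f x - F n x) \<le> 2 * w x"
        using norm_triangle_ineq4[of "f x" "F n x"] fw[of x] w(2)[of x n] by linarith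
      then have "(cmod (f x - F n x))\<^sup>2 \<le> (2 * w x)\<^sup>2" by (intro power_mono) auto
      then show "norm ((cmod (f x - F n x))\<^sup>2) \<le> 4 * (w x)\<^sup>2" by (simp add: power_mult_distrib)
    qed
  qed (use F f w in auto)
  then have "(\<lambda>n. sqrt (LINT x|\<mu>. (cmod (f x - F n x))\<^sup>2)) \<longlonglongrightarrow> sqrt 0"
    by (intro tendsto_real_sqrt) simp
  then show ?thesis by (simp add: L2_nrm_def)
qed

text \<open>Bessel's inequality with its exact defect, so that equality of norms can be read as
  expansion error 0.\<close>

lemma L2_nrm_orthonormal_expansion:
  assumes f: "L2_fun \<mu> f" and F: "finite F" and on: "orthonormal_system \<mu> F e"
  shows "(L2_nrm \<mu> (\<lambda>x. f x - (\<Sum>i\<in>F. L2_inner \<mu> f (e i) * e i x)))\<^sup>2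
    = (L2_nrm \<mu> f)\<^sup>2 - (\<Sum>i\<in>F. (cmod (L2_inner \<mu> f (e i)))\<^sup>2)"
proof -
  have e: "L2_fun \<mu> (e i)" if "i \<in> F" for i using on that by (simp add: orthonormal_system_def)
  have ee: "L2_inner \<mu> (e i) (e j) = (if i = j then 1 else 0)" if "i \<in> F" "j \<in> F" for i j
    using on that by (simp add: orthonormal_system_def)
  let ?c = "\<lambda>i. L2_inner \<mu> f (e i)"
  let ?S = "\<lambda>x. \<Sum>i\<in>F. ?c i * e i x"
  have S: "L2_fun \<mu> ?S" using e by (rule L2_fun_lin)
  have 1: "L2_inner \<mu> f ?S = (\<Sum>i\<in>F. of_real ((cmod (?c i))\<^sup>2))"
  proof -
    have "L2_inner \<mu> f ?S = (\<Sum>i\<in>F. cnj (?c i) * ?c i)"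
      by (rule L2_inner_lin_right) (use e f in auto)
    also have "\<dots> = (\<Sum>i\<in>F. of_real ((cmod (?c i))\<^sup>2))"
      by (rule sum.cong[OF refl]) (simp only: complex_norm_square mult.commute)
    finally show ?thesis .
  qed
  have 2: "L2_inner \<mu> ?S f = (\<Sum>i\<in>F. of_real ((cmod (?c i))\<^sup>2))"
    using L2_inner_commute[of \<mu> ?S f] 1 by simp
  have "L2_inner \<mu> ?S ?S = (\<Sum>i\<in>F. ?c i * (\<Sum>j\<in>F. cnj (?c j) * L2_inner \<mu> (e i) (e j)))"
    using e S by (simp add: L2_inner_lin_left L2_inner_lin_right)
  also have "\<dots> = (\<Sum>i\<in>F. ?c i * cnj (?c i))"
    using F by (intro sum.cong refl) (simp add: ee if_distrib[of "(*) _"] cong: if_cong)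
  finally have 3: "L2_inner \<mu> ?S ?S = (\<Sum>i\<in>F. of_real ((cmod (?c i))\<^sup>2))"
    by (simp only: complex_norm_square)
  have "complex_of_real ((L2_nrm \<mu> (\<lambda>x. f x - ?S x))\<^sup>2) =
      of_real ((L2_nrm \<mu> f)\<^sup>2) - (\<Sum>i\<in>F. of_real ((cmod (?c i))\<^sup>2))"
    unfolding L2_inner_self[symmetric] using f S
    by (simp add: L2_inner_diff_left L2_inner_diff_right L2_fun_diff 1 2 3)
  also have "\<dots> = of_real ((L2_nrm \<mu> f)\<^sup>2 - (\<Sum>i\<in>F. (cmod (?c i))\<^sup>2))" by simp
  finally show ?thesis by (simp only: of_real_eq_iff)
qed

text \<open>No closure is taken, because all relations between levels are finite. Equality is almost
  everywhere, because Fourier transforms determine functions only up to null sets.\<close>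

definition L2_span :: "'a measure \<Rightarrow> 'i set \<Rightarrow> ('i \<Rightarrow> 'a \<Rightarrow> complex) \<Rightarrow> ('a \<Rightarrow> complex) \<Rightarrow> bool" where
  "L2_span \<mu> I e f \<longleftrightarrow> (\<exists>F c. finite F \<and> F \<subseteq> I \<and> (AE x in \<mu>. f x = (\<Sum>i\<in>F. c i * e i x)))"

lemma L2_span_base: "i \<in> I \<Longrightarrow> L2_span \<mu> I e (e i)"
  unfolding L2_span_def by (intro exI[of _ "{i}"] exI[of _ "\<lambda>_. 1"]) auto

lemma L2_span_zero: "L2_span \<mu> I e (\<lambda>x. 0)"
  unfolding L2_span_def by (intro exI[of _ "{}"]) auto

lemma L2_span_cong: "L2_span \<mu> I e f \<Longrightarrow> AE x in \<mu>. g x = f x \<Longrightarrow> L2_span \<mu> I e g"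
  unfolding L2_span_def
proof (elim exE conjE)
  fix F c assume "finite F" "F \<subseteq> I" "AE x in \<mu>. f x = (\<Sum>i\<in>F. c i * e i x)" "AE x in \<mu>. g x = f x"
  moreover from this(3,4) have "AE x in \<mu>. g x = (\<Sum>i\<in>F. c i * e i x)" by eventually_elim simp
  ultimately show "\<exists>F c. finite F \<and> F \<subseteq> I \<and> (AE x in \<mu>. g x = (\<Sum>i\<in>F. c i * e i x))"
    by (intro exI[of _ F] exI[of _ c] conjI)
qed

lemma L2_span_cmult: "L2_span \<mu> I e f \<Longrightarrow> L2_span \<mu> I e (\<lambda>x. a * f x)"
  unfolding L2_span_def
proof (elim exE conjE)
  fix F c assume "finite F" "F \<subseteq> I" "AE x in \<mu>. f x = (\<Sum>i\<in>F. c i * e i x)"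
  moreover from this(3) have "AE x in \<mu>. a * f x = (\<Sum>i\<in>F. (a * c i) * e i x)"
    by eventually_elim (simp add: sum_distrib_left mult.assoc)
  ultimately show "\<exists>F c. finite F \<and> F \<subseteq> I \<and> (AE x in \<mu>. a * f x = (\<Sum>i\<in>F. c i * e i x))"
    by (intro exI[of _ F] exI[of _ "\<lambda>i. a * c i"] conjI)
qed

lemma L2_span_add: "L2_span \<mu> I e f \<Longrightarrow> L2_span \<mu> I e g \<Longrightarrow> L2_span \<mu> I e (\<lambda>x. f x + g x)"
  unfolding L2_span_def
proof (elim exE conjE)
  fix F G c d
  assume *: "finite F" "F \<subseteq> I" "AE x in \<mu>. f x = (\<Sum>i\<in>F. c i * e i x)"
    "finite G" "G \<subseteq> I" "AE x in \<mu>. g x = (\<Sum>i\<in>G. d i * e i x)"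
  define a where "a i = (if i \<in> F then c i else 0) + (if i \<in> G then d i else 0)" for i
  have eq: "(\<Sum>i\<in>F \<union> G. a i * e i x) = (\<Sum>i\<in>F. c i * e i x) + (\<Sum>i\<in>G. d i * e i x)" for x
  proof -
    have "(\<Sum>i\<in>F. c i * e i x) = (\<Sum>i\<in>F \<union> G. (if i \<in> F then c i else 0) * e i x)"
      using *(1,4) by (intro sum.mono_neutral_cong_left) auto
    moreover have "(\<Sum>i\<in>G. d i * e i x) = (\<Sum>i\<in>F \<union> G. (if i \<in> G then d i else 0) * e i x)"
      using *(1,4) by (intro sum.mono_neutral_cong_left) auto
    ultimately show ?thesis by (simp add: a_def distrib_right sum.distrib)
  qed
  have "AE x in \<mu>. f x + g x = (\<Sum>i\<in>F \<union> G. a i * e i x)"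
    using *(3,6) by eventually_elim (simp add: eq)
  then show "\<exists>F c. finite F \<and> F \<subseteq> I \<and> (AE x in \<mu>. f x + g x = (\<Sum>i\<in>F. c i * e i x))"
    using * by (intro exI[of _ "F \<union> G"] exI[of _ a] conjI) auto
qed

lemma L2_span_sum:
  "(\<And>i. i \<in> F \<Longrightarrow> L2_span \<mu> I e (f i)) \<Longrightarrow> L2_span \<mu> I e (\<lambda>x. \<Sum>i\<in>F. c i * f i x)"
proof (induction F rule: infinite_finite_induct)
  case (insert j F)
  then have "L2_span \<mu> I e (\<lambda>x. c j * f j x + (\<Sum>i\<in>F. c i * f i x))"
    by (intro L2_span_add L2_span_cmult) auto
  then show ?case using insert by simp
qed (simp_all add: L2_span_zero)

lemma L2_span_trans:
  assumes "L2_span \<mu> I e f" "\<And>i. i \<in> I \<Longrightarrow> L2_span \<mu> J d (e i)"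
  shows "L2_span \<mu> J d f"
proof -
  obtain F c where F: "finite F" "F \<subseteq> I" "AE x in \<mu>. f x = (\<Sum>i\<in>F. c i * e i x)"
    using assms(1) unfolding L2_span_def by blast
  show ?thesis
    by (rule L2_span_cong[OF L2_span_sum F(3)]) (use F(2) assms(2) in blast)
qed

lemma L2_span_orthogonal:
  assumes "L2_span \<mu> I e f" "L2_fun \<mu> f" "L2_fun \<mu> g"
    and "\<And>i. i \<in> I \<Longrightarrow> L2_fun \<mu> (e i)" "\<And>i. i \<in> I \<Longrightarrow> L2_inner \<mu> (e i) g = 0"
  shows "L2_inner \<mu> f g = 0"
proof -
  obtain F c where F: "finite F" "F \<subseteq> I" "AE x in \<mu>. f x = (\<Sum>i\<in>F. c i * e i x)"
    using assms(1) unfolding L2_span_def by blast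
  have e: "L2_fun \<mu> (e i)" "L2_inner \<mu> (e i) g = 0" if "i \<in> F" for i
    using that F(2) assms(4,5) by blast+
  have "L2_inner \<mu> f g = L2_inner \<mu> (\<lambda>x. \<Sum>i\<in>F. c i * e i x) g"
    using e(1) by (intro L2_inner_cong_AE F(3) AE_I2 refl assms(2,3) L2_fun_lin)
  also have "\<dots> = 0" using e by (simp add: L2_inner_lin_left assms(3))
  finally show ?thesis .
qed

section \<open>Density of locally constant functions\<close>

context vilenkin_measure
begin

lemma L2_fun_cyl: "x \<in> V \<Longrightarrow> L2_fun \<mu> (indicator (cyl x l))"
  by (rule L2_fun_indicator) (simp_all add: emeasure_cyl)

text \<open>Density of the span of ball indicators, packaged as an induction rule. The route is a
  Dynkin argument inside a fixed large ball, exhaustion by such balls, and approximation by simple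
  functions.\<close>

theorem L2_induct_cyl [consumes 1, case_names cyl add cmult lim]:
  assumes f: "L2_fun \<mu> f"
    and cyl: "\<And>x l. x \<in> V \<Longrightarrow> P (indicator (cyl x l))"
    and add: "\<And>f g. L2_fun \<mu> f \<Longrightarrow> L2_fun \<mu> g \<Longrightarrow> P f \<Longrightarrow> P g \<Longrightarrow> P (\<lambda>x. f x + g x)"
    and cmult: "\<And>c f. L2_fun \<mu> f \<Longrightarrow> P f \<Longrightarrow> P (\<lambda>x. c * f x)"
    and lim: "\<And>f. L2_fun \<mu> f \<Longrightarrow>
      (\<And>\<epsilon>. 0 < \<epsilon> \<Longrightarrow> \<exists>g. L2_fun \<mu> g \<and> P g \<and> L2_nrm \<mu> (\<lambda>x. f x - g x) < \<epsilon>) \<Longrightarrow> P f"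
  shows "P (f :: 'd vseq \<Rightarrow> complex)"
proof -
  have zero: "P (\<lambda>x. 0)"
    using cmult[OF L2_fun_cyl[OF vzero_V] cyl[OF vzero_V], of 0 0] by simp
  have lim_seq: "P f" if "L2_fun \<mu> f" "\<And>n. L2_fun \<mu> (F n)" "\<And>n. P (F n)"
    "(\<lambda>n. L2_nrm \<mu> (\<lambda>x. f x - F n x)) \<longlonglongrightarrow> 0" for f :: "'d vseq \<Rightarrow> complex" and F
  proof (rule lim[OF that(1)])
    fix \<epsilon> :: real assume "0 < \<epsilon>"
    from order_tendstoD(2)[OF that(4) this] obtain n where "L2_nrm \<mu> (\<lambda>x. f x - F n x) < \<epsilon>"
      by (auto simp: eventually_sequentially)
    then show "\<exists>g. L2_fun \<mu> g \<and> P g \<and> L2_nrm \<mu> (\<lambda>x. f x - g x) < \<epsilon>"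
      using that(2,3) by blast
  qed
  \<comment> \<open>Intersecting with \<open>U n\<close> keeps measures finite, so complements in
    the Dynkin argument remain square-integrable.\<close>
  define U where "U n = cyl vzero (- int n)" for n
  have U_sets: "U n \<in> sets \<mu>" for n by (simp add: U_def)
  have U_fin: "emeasure \<mu> (A \<inter> U n) < \<infinity>" if "A \<in> sets \<mu>" for A n
  proof -
    have "emeasure \<mu> (A \<inter> U n) \<le> emeasure \<mu> (U n)" by (rule emeasure_mono) (auto simp: U_def)
    also have "\<dots> < \<infinity>" by (simp add: U_def emeasure_cyl)
    finally show ?thesis .
  qed
  have L2_AU: "L2_fun \<mu> (indicator (A \<inter> U n))" if "A \<in> sets \<mu>" for A n
    using that U_fin[OF that] U_sets by (intro L2_fun_indicator) auto
  have step1: "P (indicator (A \<inter> U n))" if "A \<in> sets \<mu>" for A n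
  proof -
    have "A \<in> sigma_sets V cyls" using that by (simp add: sets_cyls)
    from Int_stable_cyls cyls_V this show ?thesis
    proof (induction A rule: sigma_sets_induct_disjoint)
      case (basic A)
      have "U n \<in> cyls" unfolding U_def cyls_def using vzero_V by blast
      then have "A \<inter> U n \<in> cyls" using basic Int_stable_cyls by (auto simp: Int_stable_def)
      then consider "A \<inter> U n = {}" | x l where "x \<in> V" "A \<inter> U n = cyl x l"
        by (auto simp: cyls_def)
      then show ?case
      proof cases
        case 1 then show ?thesis using zero by (simp add: indicator_def)
      next
        case 2 then show ?thesis using cyl by simp
      qed
    next
      case empty
      then show ?case using zero by (simp add: indicator_def)
    next
      case (compl A)
      have A: "A \<in> sets \<mu>" using compl by (simp add: sets_cyls)
      have "P (\<lambda>x. indicator (U n) x + (-1) * indicator (A \<inter> U n) x)"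
        using L2_AU[OF A, of n] compl cyl[OF vzero_V] L2_fun_cyl[OF vzero_V]
        by (intro add cmult L2_fun_cmult) (simp_all add: U_def)
      moreover have "(\<lambda>x. indicator (U n) x + (-1) * indicator (A \<inter> U n) x :: complex) = indicator ((V - A) \<inter> U n)"
        using cyl_V by (auto simp: indicator_def fun_eq_iff U_def)
      ultimately show ?case by simp
    next
      case (union A)
      have A: "A i \<in> sets \<mu>" for i using union(2) by (auto simp: sets_cyls)
      define F where "F k = (\<lambda>x. \<Sum>i<k. indicator (A i \<inter> U n) x :: complex)" for k
      have L2F: "L2_fun \<mu> (F k)" for k unfolding F_def by (intro L2_fun_sum L2_AU A)
      have PF: "P (F k)" for k
      proof (induction k)
        case (Suc k)
        have "P (\<lambda>x. F k x + indicator (A k \<inter> U n) x)"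
          by (rule add[OF L2F L2_AU[OF A] Suc union(3)])
        then show ?case by (simp add: F_def)
      qed (simp add: F_def zero)
      have F_eq: "F k x = indicator (\<Union>i<k. A i \<inter> U n) x" for k x
      proof -
        have "disjoint_family_on (\<lambda>i. A i \<inter> U n) {..<k}"
          using union(1) by (auto simp: disjoint_family_on_def)
        then show ?thesis unfolding F_def by (rule indicator_UN_disjoint[OF finite_lessThan, symmetric])
      qed
      have UA: "(\<Union>i. A i) \<in> sets \<mu>" using A by blast
      show ?case
      proof (rule lim_seq[OF L2_AU[OF UA] L2F PF], rule L2_dominated_convergence[where w = "indicator (U n)"])
        show "integrable \<mu> (\<lambda>x. (indicat_real (U n) x)\<^sup>2)"
        proof -
          have "(\<lambda>x. (indicat_real (U n) x)\<^sup>2) = indicat_real (U n)"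
            by (auto simp: indicator_def fun_eq_iff)
          then show ?thesis using U_sets U_fin[OF U_sets, of n n] by simp
        qed
        show "cmod (F k x) \<le> indicat_real (U n) x" for k x
          unfolding F_eq by (auto simp: indicator_def)
        show "(\<lambda>k. F k x) \<longlonglongrightarrow> indicator (\<Union> (range A) \<inter> U n) x" for x
        proof -
          have "(\<lambda>k. indicator (\<Union>i<k. A i \<inter> U n) x :: complex) \<longlonglongrightarrow> indicator (\<Union>i. A i \<inter> U n) x"
            by (rule LIMSEQ_indicator_UN)
          moreover have "(\<Union>i. A i \<inter> U n) = \<Union> (range A) \<inter> U n" by blast
          ultimately show ?thesis unfolding F_eq by simp
        qed
        show "F k \<in> borel_measurable \<mu>" for k using L2F by (rule L2_fun_borel)
        show "(indicator (\<Union> (range A) \<inter> U n) :: _ \<Rightarrow> complex) \<in> borel_measurable \<mu>" using L2_AU[OF UA] by (rule L2_fun_borel)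
      qed
    qed
  qed
  have U_lim: "(\<lambda>n. indicator (A \<inter> U n) x :: complex) \<longlonglongrightarrow> indicator A x" if "A \<in> sets \<mu>" for A x
  proof -
    have "incseq (\<lambda>n. A \<inter> U n)"
      unfolding U_def incseq_def by (intro allI impI Int_mono order_refl cyl_antimono) simp
    from LIMSEQ_indicator_incseq[OF this] have "(\<lambda>n. indicator (A \<inter> U n) x :: complex) \<longlonglongrightarrow> indicator (\<Union>n. A \<inter> U n) x" .
    moreover have "(\<Union>n. A \<inter> U n) = A"
      using sets.sets_into_space[OF that] V_Union_cyl by (auto simp: U_def)
    ultimately show ?thesis by simp
  qed
  have step2: "P (indicator A)" if A: "A \<in> sets \<mu>" "emeasure \<mu> A < \<infinity>" for A
  proof (rule lim_seq[OF L2_fun_indicator[OF A] L2_AU[OF A(1)] step1[OF A(1)]],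
         rule L2_dominated_convergence[where w = "indicator A"])
    show "integrable \<mu> (\<lambda>x. (indicat_real A x)\<^sup>2)"
    proof -
      have "(\<lambda>x. (indicat_real A x)\<^sup>2) = indicat_real A"
        by (auto simp: indicator_def fun_eq_iff)
      then show ?thesis using A by simp
    qed
    show "cmod (indicator (A \<inter> U n) x) \<le> indicat_real A x" for n x by (auto simp: indicator_def)
    show "(\<lambda>n. indicator (A \<inter> U n) x :: complex) \<longlonglongrightarrow> indicator A x" for x by (rule U_lim[OF A(1)])
    show "(indicator (A \<inter> U n) :: _ \<Rightarrow> complex) \<in> borel_measurable \<mu>" for n using L2_AU[OF A(1)] by (rule L2_fun_borel)
    show "(indicator A :: _ \<Rightarrow> complex) \<in> borel_measurable \<mu>" using A by simp
  qed
  obtain S where S: "\<And>i. simple_function \<mu> (S i)"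
      "\<And>x. x \<in> space \<mu> \<Longrightarrow> (\<lambda>i. S i x) \<longlonglongrightarrow> f x"
      "\<And>i x. x \<in> space \<mu> \<Longrightarrow> cmod (S i x) \<le> 2 * cmod (f x)"
    using borel_measurable_implies_sequence_metric[OF L2_fun_borel[OF f], of 0]
    unfolding dist_norm diff_0_right by blast
  define A where "A i y = S i -` {y} \<inter> space \<mu>" for i y
  \<comment> \<open>The value 0 is left out because its level set may have infinite measure; the
    other level sets are finite since \<open>S\<close> is bounded by
    \<open>2 * cmod (f x)\<close>.\<close>
  define T where "T i = (\<lambda>x. \<Sum>y\<in>S i ` space \<mu> - {0}. y * indicator (A i y) x)" for i
  have fin: "finite (S i ` space \<mu>)" for i using S(1) by (simp add: simple_function_def)
  have A_sets: "A i y \<in> sets \<mu>" for i y unfolding A_def using S(1) by (rule simple_functionD)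
  have A_fin: "emeasure \<mu> (A i y) < \<infinity>" if "y \<noteq> 0" for i y
  proof -
    have "integrable \<mu> (indicat_real (A i y))"
    proof (rule Bochner_Integration.integrable_bound)
      show "integrable \<mu> (\<lambda>x. 4 / (cmod y)\<^sup>2 * (cmod (f x))\<^sup>2)"
        using f by (simp add: L2_fun_def)
      have "indicat_real (A i y) x \<le> 4 / (cmod y)\<^sup>2 * (cmod (f x))\<^sup>2" for x
      proof (cases "x \<in> A i y")
        case True
        then have "cmod y \<le> 2 * cmod (f x)" using S(3)[of x i] by (auto simp: A_def)
        then have "(cmod y)\<^sup>2 \<le> (2 * cmod (f x))\<^sup>2" by (intro power_mono) auto
        then show ?thesis using True that by (simp add: field_simps power_mult_distrib)
      qed simp
      then show "AE x in \<mu>. norm (indicat_real (A i y) x) \<le> norm (4 / (cmod y)\<^sup>2 * (cmod (f x))\<^sup>2)"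
        by (auto intro!: AE_I2 intro: order_trans[OF _ abs_ge_self])
    qed (use A_sets in simp)
    moreover have "A i y \<inter> V = A i y" by (auto simp: A_def)
    ultimately show ?thesis by (simp add: integrable_indicator_iff)
  qed
  have T_eq: "T i x = S i x" if "x \<in> space \<mu>" for i x
  proof -
    have "T i x = (\<Sum>y\<in>S i ` space \<mu> - {0}. if y = S i x then y else 0)"
      unfolding T_def A_def using that by (intro sum.cong refl) (auto simp: indicator_def)
    also have "\<dots> = S i x" using fin that by (auto simp: sum.delta)
    finally show ?thesis .
  qed
  have T_L2: "L2_fun \<mu> (T i) \<and> P (T i)" for i
    unfolding T_def
  proof -
    have *: "L2_fun \<mu> (\<lambda>x. \<Sum>y\<in>Y. y * indicator (A i y) x) \<and> P (\<lambda>x. \<Sum>y\<in>Y. y * indicator (A i y) x)"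
      if "finite Y" "0 \<notin> Y" for Y
      using that
    proof (induction Y)
      case (insert y Y)
      have y: "L2_fun \<mu> (indicator (A i y))" "P (indicator (A i y))"
        using A_sets A_fin[of y i] insert.prems by (auto intro!: L2_fun_indicator step2)
      have IH: "L2_fun \<mu> (\<lambda>x. \<Sum>y\<in>Y. y * indicator (A i y) x)" "P (\<lambda>x. \<Sum>y\<in>Y. y * indicator (A i y) x)"
        using insert by auto
      show ?case
        unfolding sum.insert[OF insert.hyps]
        by (intro conjI L2_fun_add add L2_fun_cmult cmult y IH)
    qed (simp add: zero L2_fun_zero)
    show "L2_fun \<mu> (\<lambda>x. \<Sum>y\<in>S i ` space \<mu> - {0}. y * indicator (A i y) x) \<and>
        P (\<lambda>x. \<Sum>y\<in>S i ` space \<mu> - {0}. y * indicator (A i y) x)"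
      by (rule *) (use fin[of i] in auto)
  qed
  show "P f"
  proof (rule lim_seq[OF f])
    show "L2_fun \<mu> (T i)" "P (T i)" for i using T_L2 by auto
    show "(\<lambda>n. L2_nrm \<mu> (\<lambda>x. f x - T n x)) \<longlonglongrightarrow> 0"
    proof (rule L2_dominated_convergence[where w = "\<lambda>x. 2 * cmod (f x)"])
      show "T n \<in> borel_measurable \<mu>" for n using T_L2 L2_fun_borel by blast
      show "integrable \<mu> (\<lambda>x. (2 * cmod (f x))\<^sup>2)"
        using f by (simp add: L2_fun_def power_mult_distrib)
    qed (use f S T_eq in \<open>auto intro: L2_fun_borel\<close>)
  qed
qed

text \<open>By density \<open>f\<close> is orthogonal to every square-integrable function, in
  particular to itself.\<close>

lemma AE_zero_if_cyl_inner_zero: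
  assumes f: "L2_fun \<mu> f" and z: "\<And>x l. x \<in> V \<Longrightarrow> L2_inner \<mu> f (indicator (cyl x l)) = 0"
  shows "AE x in \<mu>. f x = 0"
proof -
  have "L2_inner \<mu> f u = 0" if "L2_fun \<mu> u" for u
    using that
  proof (induction u rule: L2_induct_cyl)
    case (lim u)
    have "cmod (L2_inner \<mu> f u) \<le> 0 + \<epsilon>" if "0 < \<epsilon>" for \<epsilon>
    proof -
      \<comment> \<open>Adding 1 keeps the denominator positive when the norm of \<open>f\<close>
        vanishes.\<close>
      have "0 < \<epsilon> / (L2_nrm \<mu> f + 1)" using that by (simp add: add_nonneg_pos)
      then obtain g where g: "L2_fun \<mu> g" "L2_inner \<mu> f g = 0" "L2_nrm \<mu> (\<lambda>x. u x - g x) < \<epsilon> / (L2_nrm \<mu> f + 1)"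
        using lim(2) by blast
      have "L2_inner \<mu> f u = L2_inner \<mu> f (\<lambda>x. u x - g x)"
        using f lim(1) g by (simp add: L2_inner_diff_right)
      also have "cmod \<dots> \<le> L2_nrm \<mu> f * L2_nrm \<mu> (\<lambda>x. u x - g x)"
        using f lim(1) g by (intro L2_Cauchy_Schwarz L2_fun_diff)
      also have "\<dots> \<le> (L2_nrm \<mu> f + 1) * (\<epsilon> / (L2_nrm \<mu> f + 1))"
        using g(3) by (intro mult_mono) auto
      also have "\<dots> = \<epsilon>" by (simp add: add_nonneg_eq_0_iff)
      finally show ?thesis by simp
    qed
    then have "cmod (L2_inner \<mu> f u) \<le> 0" by (rule field_le_epsilon)
    then show ?case by simp
  qed (simp_all add: z f L2_inner_add_right L2_inner_cmult_right)
  from this[OF f] show ?thesis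
    using L2_nrm_eq_0_iff[OF f] by (simp add: L2_inner_self)
qed

end

section \<open>Characters\<close>

lemma exp_2pi_i_of_int: "exp (2 * of_real pi * \<i> * of_real (of_int k)) = 1"
  by (simp add: exp_eq_1)

lemma exp_2pi_i_eq_1_iff: "exp (2 * of_real pi * \<i> * of_real r) = 1 \<longleftrightarrow> r \<in> \<int>"
proof
  assume "exp (2 * of_real pi * \<i> * of_real r) = 1"
  then obtain n :: int where "2 * pi * r = of_int (2 * n) * pi" by (auto simp: exp_eq_1)
  then have "r = of_int n" by simp
  then show "r \<in> \<int>" by simp
next
  assume "r \<in> \<int>"
  then obtain k where "r = of_int k" by (elim Ints_cases)
  then show "exp (2 * of_real pi * \<i> * of_real r) = 1" by (simp only: exp_2pi_i_of_int)
qed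

text \<open>The factor of \<open>vchar\<close> contributed by one pair of coordinates, a character
  of the integer lattice in each argument.\<close>

definition vec_char :: "int ^ 'd ^ 'd \<Rightarrow> int ^ 'd \<Rightarrow> int ^ 'd \<Rightarrow> complex" where
  "vec_char M v w = exp (2 * of_real pi * \<i> * of_real
     ((matrix_inv (mat_of_int M) *v vec_of_int v) \<bullet> (vec_of_int w :: real ^ 'd)))"

lemma vec_of_int_add: "vec_of_int (v + w) = (vec_of_int v + vec_of_int w :: real ^ 'd)"
  by (simp add: vec_of_int_def vec_eq_iff)

lemma vec_of_int_0: "vec_of_int 0 = (0 :: real ^ 'd)"
  by (simp add: vec_of_int_def vec_eq_iff)

lemma vec_char_add_left: "vec_char M (v + v') w = vec_char M v w * vec_char M v' w"
  by (simp add: vec_char_def vec_of_int_add matrix_vector_right_distrib inner_add_left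
      ring_distribs exp_add)

lemma vec_char_add_right: "vec_char M v (w + w') = vec_char M v w * vec_char M v w'"
  by (simp add: vec_char_def vec_of_int_add inner_add_right ring_distribs exp_add)

lemma vec_char_0 [simp]: "vec_char M 0 w = 1" "vec_char M v 0 = 1"
  by (simp_all add: vec_char_def vec_of_int_0)

lemma vchar_eq_prod:
  assumes "finite J" "\<And>j. j \<notin> J \<Longrightarrow> x j = 0 \<or> \<omega> (1 - j) = 0"
  shows "vchar M x \<omega> = (\<Prod>j\<in>J. vec_char M (x j) (\<omega> (1 - j)))"
proof -
  let ?q = "\<lambda>j. (matrix_inv (mat_of_int M) *v vec_of_int (x j)) \<bullet> (vec_of_int (\<omega> (1 - j)) :: real ^ _)"
  have "infsum ?q UNIV = infsum ?q J"
    using assms(2) by (intro infsum_cong_neutral) (auto simp: vec_of_int_0 dest!: assms(2))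
  also have "\<dots> = sum ?q J" using assms(1) by simp
  finally show ?thesis
    using assms(1) by (simp add: vchar_def vec_char_def exp_sum[symmetric] sum_distrib_left)
qed

lemma norm_vchar [simp]: "cmod (vchar M x \<omega>) = 1"
  by (simp add: vchar_def norm_exp_eq_Re)

text \<open>Index \<open>j\<close> is paired with \<open>1 - j\<close>, so after reindexing the
  shift appears on the other side with the same sign.\<close>

lemma vchar_shift: "vchar M (vshift n x) \<omega> = vchar M x (vshift n \<omega>)"
proof -
  let ?q = "\<lambda>j. (matrix_inv (mat_of_int M) *v vec_of_int (x j)) \<bullet> (vec_of_int (\<omega> (1 - (j - n))) :: real ^ _)"
  have "bij (\<lambda>j::int. j + n)" by (rule bij_plus_right)
  from infsum_reindex_bij_betw[OF this, of ?q] show ?thesis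
    by (simp add: vchar_def vshift_def algebra_simps)
qed

context vilenkin_group
begin

lemma invertible_real: "invertible (mat_of_int M :: real ^ 'd ^ 'd)"
  using det_nz by (simp add: invertible_det_nz det_mat_of_int)

lemma matrix_inv_real:
  "matrix_inv (mat_of_int M :: real ^ 'd ^ 'd) ** mat_of_int M = mat 1"
  "mat_of_int M ** matrix_inv (mat_of_int M :: real ^ 'd ^ 'd) = mat 1"
proof -
  have "\<exists>B. (mat_of_int M :: real ^ 'd ^ 'd) ** B = mat 1 \<and> B ** mat_of_int M = mat 1"
    using invertible_real by (simp add: invertible_def)
  from someI_ex[OF this]
  show "matrix_inv (mat_of_int M :: real ^ 'd ^ 'd) ** mat_of_int M = mat 1"
    "mat_of_int M ** matrix_inv (mat_of_int M :: real ^ 'd ^ 'd) = mat 1"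
    unfolding matrix_inv_def by auto
qed

lemma inner_transpose_matrix: "a \<bullet> (transpose B *v u) = (B *v a) \<bullet> u" for B :: "real ^ 'n ^ 'm"
proof -
  have "a \<bullet> (transpose B *v u) = (u v* B) \<bullet> a"
    by (simp only: transpose_matrix_vector inner_commute)
  also have "\<dots> = u \<bullet> (B *v a)" by (rule dot_lmul_matrix)
  finally show ?thesis by (simp only: inner_commute)
qed

lemma vec_char_range_left: "vec_char M (M *v u) w = 1"
proof -
  have "matrix_inv (mat_of_int M) *v vec_of_int (M *v u) = (vec_of_int u :: real ^ 'd)"
    by (simp add: mat_of_int_mult_vec[symmetric] matrix_vector_mul_assoc matrix_inv_real)
  then have "(matrix_inv (mat_of_int M) *v vec_of_int (M *v u)) \<bullet> (vec_of_int w :: real ^ 'd)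
      = of_int (\<Sum>i\<in>UNIV. u $ i * w $ i)"
    by (simp add: inner_vec_def vec_of_int_def)
  then show ?thesis unfolding vec_char_def by (simp only: exp_2pi_i_of_int)
qed

text \<open>Moved across the inner product, the transpose cancels the inverse matrix. With the left
  version, the pairing depends only on residue classes, so digit reduction in \<open>vadd\<close>
  does not disturb characters.\<close>

lemma vec_char_range_right: "vec_char M v (transpose M *v u) = 1"
proof -
  have tr: "(transpose (mat_of_int M) :: real ^ 'd ^ 'd) = mat_of_int (transpose M)"
    by (simp add: transpose_def mat_of_int_def)
  have eq: "vec_of_int (transpose M *v u) = (transpose (mat_of_int M) *v vec_of_int u :: real ^ 'd)"
    by (simp only: tr mat_of_int_mult_vec)
  have "(matrix_inv (mat_of_int M) *v vec_of_int v) \<bullet> (vec_of_int (transpose M *v u) :: real ^ 'd)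
      = (mat_of_int M *v (matrix_inv (mat_of_int M) *v vec_of_int v)) \<bullet> (vec_of_int u :: real ^ 'd)"
    unfolding eq by (rule inner_transpose_matrix)
  also have "\<dots> = vec_of_int v \<bullet> (vec_of_int u :: real ^ 'd)"
    by (simp add: matrix_vector_mul_assoc matrix_inv_real)
  also have "\<dots> = of_int (\<Sum>i\<in>UNIV. v $ i * u $ i)"
    by (simp add: inner_vec_def vec_of_int_def)
  finally show ?thesis unfolding vec_char_def by (simp only: exp_2pi_i_of_int)
qed

lemma vec_char_D_left [simp]: "vec_char M (D v) w = vec_char M v w"
proof -
  obtain u where "D v - v = M *v u" using D_props(2) by (auto simp: congruent_mod_def)
  then have "D v = v + M *v u" by (simp add: algebra_simps)
  then show ?thesis by (simp only: vec_char_add_left vec_char_range_left mult_1_right)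
qed

text \<open>Pairing with the unit vectors shows that the inverse matrix sends \<open>v\<close> to an
  integer vector.\<close>

lemma vec_char_nondegenerate:
  assumes "\<And>w. vec_char M v w = 1" shows "congruent_mod M v 0"
proof -
  define r where "r = (matrix_inv (mat_of_int M) *v vec_of_int v :: real ^ 'd)"
  have "r $ i \<in> \<int>" for i
  proof -
    have "r \<bullet> vec_of_int (axis i 1) \<in> \<int>"
      using assms[of "axis i 1"] unfolding vec_char_def exp_2pi_i_eq_1_iff r_def .
    moreover have "(vec_of_int (axis i 1) :: real ^ 'd) = axis i 1"
      by (simp add: vec_of_int_def axis_def vec_eq_iff)
    ultimately show ?thesis by (simp add: inner_axis)
  qed
  then have r: "r = vec_of_int (\<chi> i. \<lfloor>r $ i\<rfloor>)"
    by (simp add: vec_eq_iff vec_of_int_def)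
  have "(vec_of_int v :: real ^ 'd) = mat_of_int M *v r"
    by (simp add: r_def matrix_vector_mul_assoc matrix_inv_real)
  also have "\<dots> = vec_of_int (M *v (\<chi> i. \<lfloor>r $ i\<rfloor>))"
    by (subst r) (rule mat_of_int_mult_vec)
  finally have "v = M *v (\<chi> i. \<lfloor>r $ i\<rfloor>)" by simp
  then show ?thesis unfolding congruent_mod_def by (intro exI) simp
qed

end

locale vilenkin_dual =
  vilenkin_measure M s \<mu> + dual: vilenkin_measure "transpose M" t \<mu>'
  for M :: "int ^ 'd ^ 'd" and s t :: "nat \<Rightarrow> int ^ 'd" and \<mu> \<mu>' :: "'d vseq measure"
begin

abbreviation "V' \<equiv> vilenkin (transpose M) t"
abbreviation add' (infixl "\<oplus>''" 65) where "x \<oplus>' y \<equiv> vadd (transpose M) t x y"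

lemma abs_det_transpose: "abs_det (transpose M) = abs_det M"
  by (simp add: abs_det_def)

lemma vec_char_D_right [simp]: "vec_char M v (dual.D w) = vec_char M v w"
proof -
  obtain u where "dual.D w - w = transpose M *v u" using dual.D_props(2) by (auto simp: congruent_mod_def)
  then have "dual.D w = w + transpose M *v u" by (simp add: algebra_simps)
  then show ?thesis by (simp only: vec_char_add_right vec_char_range_right mult_1_right)
qed

text \<open>\<open>x j\<close> vanishes far to the left and \<omega> (1 - j) far to the right. The
  form with all \<open>n\<close> above \<open>N\<close> lets the intervals of two pairs be
  merged.\<close>

lemma vchar_support:
  assumes "x \<in> V" "\<omega> \<in> V'"
  obtains N where "\<And>n j. N \<le> n \<Longrightarrow> j \<notin> {- int n..int n} \<Longrightarrow> x j = 0 \<or> \<omega> (1 - j) = 0"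
proof -
  obtain a b where a: "0 \<le> a" "\<forall>j\<le>-a. x j = 0" and b: "0 \<le> b" "\<forall>j\<le>-b. \<omega> j = 0"
    using V_lower[OF assms(1), of 0] dual.V_lower[OF assms(2), of 0] by blast
  show ?thesis
  proof (rule that[of "nat (max a (b + 1))"])
    fix n j assume "nat (max a (b + 1)) \<le> n" "j \<notin> {- int n..int n}"
    then have "j \<le> - a \<or> 1 - j \<le> - b" by (auto simp: nat_le_iff)
    then show "x j = 0 \<or> \<omega> (1 - j) = 0" using a b by blast
  qed
qed

lemma vchar_add_left:
  assumes "x \<in> V" "y \<in> V" "\<omega> \<in> V'"
  shows "vchar M (x \<oplus> y) \<omega> = vchar M x \<omega> * vchar M y \<omega>"
proof -
  obtain A where A: "\<And>n j. A \<le> n \<Longrightarrow> j \<notin> {- int n..int n} \<Longrightarrow> x j = 0 \<or> \<omega> (1 - j) = 0"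
    using vchar_support[OF assms(1,3)] by blast
  obtain B where B: "\<And>n j. B \<le> n \<Longrightarrow> j \<notin> {- int n..int n} \<Longrightarrow> y j = 0 \<or> \<omega> (1 - j) = 0"
    using vchar_support[OF assms(2,3)] by blast
  define J where "J = {- int (max A B)..int (max A B)}"
  have x: "x j = 0 \<or> \<omega> (1 - j) = 0" and y: "y j = 0 \<or> \<omega> (1 - j) = 0" if "j \<notin> J" for j
    using A[of "max A B" j] B[of "max A B" j] that by (auto simp: J_def)
  have xy: "(x \<oplus> y) j = 0 \<or> \<omega> (1 - j) = 0" if "j \<notin> J" for j
    using x[OF that] y[OF that] by (auto simp: vadd_def)
  have J: "finite J" by (simp add: J_def)
  have "vchar M (x \<oplus> y) \<omega> = (\<Prod>j\<in>J. vec_char M ((x \<oplus> y) j) (\<omega> (1 - j)))"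
    by (rule vchar_eq_prod[OF J]) (rule xy)
  also have "\<dots> = (\<Prod>j\<in>J. vec_char M (x j) (\<omega> (1 - j))) * (\<Prod>j\<in>J. vec_char M (y j) (\<omega> (1 - j)))"
    by (simp add: vadd_def vec_char_add_left prod.distrib)
  also have "\<dots> = vchar M x \<omega> * vchar M y \<omega>"
    by (subst (1 2) vchar_eq_prod[OF J]) (use x y in auto)
  finally show ?thesis .
qed

lemma vchar_add_right:
  assumes "x \<in> V" "\<omega> \<in> V'" "\<eta> \<in> V'"
  shows "vchar M x (\<omega> \<oplus>' \<eta>) = vchar M x \<omega> * vchar M x \<eta>"
proof -
  obtain A where A: "\<And>n j. A \<le> n \<Longrightarrow> j \<notin> {- int n..int n} \<Longrightarrow> x j = 0 \<or> \<omega> (1 - j) = 0"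
    using vchar_support[OF assms(1,2)] by blast
  obtain B where B: "\<And>n j. B \<le> n \<Longrightarrow> j \<notin> {- int n..int n} \<Longrightarrow> x j = 0 \<or> \<eta> (1 - j) = 0"
    using vchar_support[OF assms(1,3)] by blast
  define J where "J = {- int (max A B)..int (max A B)}"
  have x: "x j = 0 \<or> \<omega> (1 - j) = 0" and y: "x j = 0 \<or> \<eta> (1 - j) = 0" if "j \<notin> J" for j
    using A[of "max A B" j] B[of "max A B" j] that by (auto simp: J_def)
  have xy: "x j = 0 \<or> (\<omega> \<oplus>' \<eta>) (1 - j) = 0" if "j \<notin> J" for j
    using x[OF that] y[OF that] by (auto simp: vadd_def)
  have J: "finite J" by (simp add: J_def)
  have "vchar M x (\<omega> \<oplus>' \<eta>) = (\<Prod>j\<in>J. vec_char M (x j) ((\<omega> \<oplus>' \<eta>) (1 - j)))"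
    by (rule vchar_eq_prod[OF J]) (rule xy)
  also have "\<dots> = (\<Prod>j\<in>J. vec_char M (x j) (\<omega> (1 - j))) * (\<Prod>j\<in>J. vec_char M (x j) (\<eta> (1 - j)))"
    by (simp add: vadd_def vec_char_add_right prod.distrib)
  also have "\<dots> = vchar M x \<omega> * vchar M x \<eta>"
    by (subst (1 2) vchar_eq_prod[OF J]) (use x y in auto)
  finally show ?thesis .
qed

lemma vchar_eq_1: "(\<And>j. x j = 0 \<or> \<omega> (1 - j) = 0) \<Longrightarrow> vchar M x \<omega> = 1"
  by (subst vchar_eq_prod[of "{}"]) auto

lemma vchar_vzero [simp]: "vchar M vzero \<omega> = 1" "vchar M x vzero = 1"
  by (rule vchar_eq_1; simp add: vzero_def)+

lemma vchar_vneg: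
  assumes "x \<in> V" "\<omega> \<in> V'" shows "vchar M (vneg x) \<omega> = cnj (vchar M x \<omega>)"
proof -
  have "vchar M x \<omega> * vchar M (vneg x) \<omega> = 1"
    using vchar_add_left[of x "vneg x" \<omega>] assms by simp
  moreover have "vchar M x \<omega> * cnj (vchar M x \<omega>) = 1"
    by (simp add: complex_norm_square[symmetric])
  ultimately show ?thesis by (metis mult_cancel_left mult_zero_left zero_neq_one)
qed

text \<open>A single digit of \<omega> at index \<open>1 - j\<close> meets only \<open>x j\<close>,
  which is not congruent to 0.\<close>

lemma vchar_nondegenerate:
  assumes "x \<in> V" "x j \<noteq> 0"
  obtains \<omega> where "\<omega> \<in> V'" "\<And>i. i \<noteq> 1 - j \<Longrightarrow> \<omega> i = 0" "vchar M x \<omega> \<noteq> 1"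
proof -
  have "\<not> congruent_mod M (x j) 0"
    using assms digits_unique[OF V_digit zero_digit] by blast
  then obtain w where w: "vec_char M (x j) w \<noteq> 1" using vec_char_nondegenerate by blast
  define \<omega> where "\<omega> i = (if i = 1 - j then dual.D w else 0)" for i
  have "\<omega> \<in> V'" unfolding dual.V_iff \<omega>_def by (intro conjI exI[of _ "- j"]) (auto simp: dual.D_props)
  moreover have "vchar M x \<omega> = vec_char M (x j) w"
    by (subst vchar_eq_prod[of "{j}"]) (auto simp: \<omega>_def)
  ultimately show ?thesis using that[of \<omega>] w by (auto simp: \<omega>_def)
qed

text \<open>A character sums over a finite group to the order of the group if it is trivial there
  and to 0 otherwise. The window consists of the \<open>j\<close> with
  \<open>a < 1 - j \<le> b\<close>.\<close>

lemma sum_vchar_vfin: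
  assumes x: "x \<in> V"
  shows "(\<Sum>\<omega>\<in>dual.vfin a b. vchar M x \<omega>)
    = (if \<forall>j. 1 - b \<le> j \<and> j < 1 - a \<longrightarrow> x j = 0 then of_nat (abs_det M ^ nat (b - a)) else 0)"
proof (cases "\<forall>j. 1 - b \<le> j \<and> j < 1 - a \<longrightarrow> x j = 0")
  case True
  have "vchar M x \<omega> = 1" if "\<omega> \<in> dual.vfin a b" for \<omega>
  proof (rule vchar_eq_1)
    fix j
    show "x j = 0 \<or> \<omega> (1 - j) = 0"
      using that True by (cases "1 - b \<le> j \<and> j < 1 - a") (auto simp: dual.vfin_def)
  qed
  then show ?thesis using True by (simp add: dual.card_vfin abs_det_transpose)
next
  case False
  then obtain j where j: "1 - b \<le> j" "j < 1 - a" "x j \<noteq> 0" by blast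
  obtain \<eta> where \<eta>: "\<eta> \<in> V'" "\<And>i. i \<noteq> 1 - j \<Longrightarrow> \<eta> i = 0" "vchar M x \<eta> \<noteq> 1"
    using vchar_nondegenerate[OF x j(3)] by blast
  have \<eta>_fin: "\<eta> \<in> dual.vfin a b" using \<eta>(1,2) j by (auto simp: dual.vfin_def)
  let ?S = "\<Sum>\<omega>\<in>dual.vfin a b. vchar M x \<omega>"
  \<comment> \<open>Translation by \<eta> permutes the subgroup, yet multiplies the sum by a number
    different from 1.\<close>
  have "?S = (\<Sum>\<omega>\<in>dual.vfin a b. vchar M x (\<omega> \<oplus>' \<eta>))"
  proof (rule sum.reindex_bij_witness[where i = "\<lambda>\<omega>. \<omega> \<oplus>' \<eta>" and j = "\<lambda>\<omega>. \<omega> \<oplus>' dual.vneg \<eta>"])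
    fix \<omega> assume "\<omega> \<in> dual.vfin a b"
    then show "\<omega> \<oplus>' dual.vneg \<eta> \<oplus>' \<eta> = \<omega>" "\<omega> \<oplus>' \<eta> \<oplus>' dual.vneg \<eta> = \<omega>"
      using dual.vfin_V by (simp_all add: dual.add_assoc)
  qed (use \<eta>_fin in \<open>auto simp: dual.add_assoc dual.vfin_V\<close>)
  also have "\<dots> = ?S * vchar M x \<eta>"
    unfolding sum_distrib_right
    by (intro sum.cong refl vchar_add_right x \<eta>(1) dual.vfin_V)
  finally have "?S = 0" using \<eta>(3) by (metis mult_cancel_left mult_1_right)
  then show ?thesis using False by auto
qed

text \<open>Joint measurability serves Fubini. At each point the finite products are eventually
  constant, and each factor depends on two coordinates from a countable set.\<close>

lemma measurable_vchar:
  "(\<lambda>(x, \<omega>). vchar M x \<omega>) \<in> borel_measurable (\<mu> \<Otimes>\<^sub>M \<mu>')"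
proof (rule borel_measurable_LIMSEQ_metric[where f = "\<lambda>n (x, \<omega>). \<Prod>j\<in>{- int n..int n}. vec_char M (x j) (\<omega> (1 - j))"])
  fix n
  have "(\<lambda>p. vec_char M (fst p j) (snd p (1 - j))) \<in> borel_measurable (\<mu> \<Otimes>\<^sub>M \<mu>')" for j
  proof -
    have "(\<lambda>p. (fst p j, snd p (1 - j))) \<in> measurable (\<mu> \<Otimes>\<^sub>M \<mu>') (count_space UNIV \<Otimes>\<^sub>M count_space UNIV)"
      by (intro measurable_Pair measurable_compose[OF measurable_fst measurable_coordinate]
          measurable_compose[OF measurable_snd dual.measurable_coordinate])
    then have "(\<lambda>p. (fst p j, snd p (1 - j))) \<in> measurable (\<mu> \<Otimes>\<^sub>M \<mu>') (count_space UNIV)"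
      by (simp add: pair_measure_countable)
    from measurable_compose[OF this, of "\<lambda>(v, w). vec_char M v w" borel] show ?thesis by simp
  qed
  then show "(\<lambda>(x, \<omega>). \<Prod>j\<in>{- int n..int n}. vec_char M (x j) (\<omega> (1 - j))) \<in> borel_measurable (\<mu> \<Otimes>\<^sub>M \<mu>')"
    unfolding case_prod_beta by (intro borel_measurable_prod)
next
  fix p assume "p \<in> space (\<mu> \<Otimes>\<^sub>M \<mu>')"
  then obtain x \<omega> where p: "p = (x, \<omega>)" "x \<in> V" "\<omega> \<in> V'" by (auto simp: space_pair_measure)
  obtain N where N: "\<And>n j. N \<le> n \<Longrightarrow> j \<notin> {- int n..int n} \<Longrightarrow> x j = 0 \<or> \<omega> (1 - j) = 0"
    using vchar_support[OF p(2,3)] by blast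
  have "\<forall>\<^sub>F n in sequentially. (\<Prod>j\<in>{- int n..int n}. vec_char M (x j) (\<omega> (1 - j))) = vchar M x \<omega>"
    unfolding eventually_sequentially
    by (intro exI[of _ N] allI impI vchar_eq_prod[symmetric] N) auto
  then have "(\<lambda>n. \<Prod>j\<in>{- int n..int n}. vec_char M (x j) (\<omega> (1 - j))) \<longlonglongrightarrow> vchar M x \<omega>"
    by (rule tendsto_eventually)
  then show "(\<lambda>n. (\<lambda>(x, \<omega>). \<Prod>j\<in>{- int n..int n}. vec_char M (x j) (\<omega> (1 - j))) p)
      \<longlonglongrightarrow> (\<lambda>(x, \<omega>). vchar M x \<omega>) p"
    by (simp add: p)
qed

lemma measurable_vchar_right: "x \<in> V \<Longrightarrow> vchar M x \<in> borel_measurable \<mu>'"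
  using measurable_Pair2[OF measurable_vchar, of x] by simp

lemma measurable_vchar_left: "\<omega> \<in> V' \<Longrightarrow> (\<lambda>x. vchar M x \<omega>) \<in> borel_measurable \<mu>"
  using measurable_Pair1[OF measurable_vchar, of \<omega>] by simp

end

lemma L2_inner_tendsto_left:
  assumes "\<And>n. L2_fun \<mu> (F n)" "L2_fun \<mu> f" "L2_fun \<mu> u"
    and lim: "(\<lambda>n. L2_nrm \<mu> (\<lambda>x. F n x - f x)) \<longlonglongrightarrow> 0"
  shows "(\<lambda>n. L2_inner \<mu> (F n) u) \<longlonglongrightarrow> L2_inner \<mu> f u"
proof -
  have "(\<lambda>n. L2_inner \<mu> (F n) u - L2_inner \<mu> f u) \<longlonglongrightarrow> 0"
  proof (rule Lim_null_comparison)
    show "\<forall>\<^sub>F n in sequentially. norm (L2_inner \<mu> (F n) u - L2_inner \<mu> f u)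
        \<le> L2_nrm \<mu> (\<lambda>x. F n x - f x) * L2_nrm \<mu> u"
      using L2_Cauchy_Schwarz[OF L2_fun_diff[OF assms(1,2)] assms(3)] assms(1-3)
      by (simp add: L2_inner_diff_left)
    show "(\<lambda>n. L2_nrm \<mu> (\<lambda>x. F n x - f x) * L2_nrm \<mu> u) \<longlonglongrightarrow> 0"
      using tendsto_mult_right[OF lim, of "L2_nrm \<mu> u"] by simp
  qed
  then show ?thesis by (simp add: LIM_zero_iff)
qed

context vilenkin_measure
begin

lemma L2_fun_affine:
  assumes "L2_fun \<mu> f" "h \<in> V" shows "L2_fun \<mu> (\<lambda>x. f (vshift n x \<oplus> h))"
  using assms borel_measurable_affine[OF assms(2), of f n]
    integrable_affine_iff[OF assms(2) borel_measurable_integrable[OF L2_fun_integrable[OF assms(1)]], of n]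
  by (simp add: L2_fun_def)

lemma L2_inner_affine:
  assumes "L2_fun \<mu> f" "L2_fun \<mu> g" "h \<in> V"
  shows "L2_inner \<mu> (\<lambda>x. f (vshift n x \<oplus> h)) (\<lambda>x. g (vshift n x \<oplus> h)) = of_real (m powi (- n)) * L2_inner \<mu> f g"
  using integral_affine[OF assms(3) borel_measurable_integrable[OF L2_inner_integrable[OF assms(1,2)]], of n]
  by (simp add: L2_inner_def scaleR_conv_of_real)

lemma AE_affine:
  assumes "AE x in \<mu>. P x" "h \<in> V" shows "AE x in \<mu>. P (vshift n x \<oplus> h)"
proof -
  have "AE x in density (distr \<mu> \<mu> (\<lambda>x. vshift n x \<oplus> h)) (\<lambda>_. ennreal (m powi n)). P x"
    using assms(1) arg_cong[of _ _ "\<lambda>N. AE x in N. P x", OF density_affine[OF assms(2), of n]] by blast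
  moreover have "0 < m powi n" using m_pos by simp
  ultimately have "AE x in distr \<mu> \<mu> (\<lambda>x. vshift n x \<oplus> h). P x"
    by (simp add: AE_density)
  then show ?thesis by (rule AE_distrD[OF measurable_affine[OF assms(2)]])
qed

lemma topspace_vtopology: "topspace (vtopology M s) = V"
proof -
  have "openin (vtopology M s) V" by (auto simp: openin_vtopology vnbhd_def)
  then show ?thesis
    by (metis openin_subset openin_topspace openin_vtopology subset_antisym)
qed

text \<open>Balls around the neutral element form an increasing open cover, so compactness selects
  one of them.\<close>

lemma compact_support_cyl:
  assumes "compactly_supported M s f"
  obtains N where "\<And>x. x \<in> V \<Longrightarrow> f x \<noteq> 0 \<Longrightarrow> x \<in> cyl vzero (- int N)"
proof -
  define K where "K = vtopology M s closure_of {x \<in> V. f x \<noteq> 0}"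
  have K: "compactin (vtopology M s) K"
    using assms by (simp add: compactly_supported_def K_def)
  have cover: "K \<subseteq> \<Union> (range (\<lambda>n. cyl vzero (- int n)))"
    using compactin_subset_topspace[OF K] V_Union_cyl by (simp add: topspace_vtopology)
  have opn: "openin (vtopology M s) C" if "C \<in> range (\<lambda>n. cyl vzero (- int n))" for C
    using that open_cyl by auto
  have "\<exists>\<F>. finite \<F> \<and> \<F> \<subseteq> range (\<lambda>n. cyl vzero (- int n)) \<and> K \<subseteq> \<Union> \<F>"
    by (rule compactinD[OF K _ cover]) (rule opn)
  then obtain \<F> where F: "finite \<F>" "\<F> \<subseteq> range (\<lambda>n. cyl vzero (- int n))" "K \<subseteq> \<Union> \<F>"
    by (elim exE conjE)
  obtain J where J: "finite J" "\<F> = (\<lambda>n. cyl vzero (- int n)) ` J"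
    using finite_subset_image[OF F(1,2)] by blast
  have "\<Union> \<F> \<subseteq> cyl vzero (- int (Max (insert 0 J)))"
    unfolding J(2)
  proof (rule UN_least, rule cyl_antimono)
    fix n assume "n \<in> J"
    then have "n \<le> Max (insert 0 J)" using J(1) by (intro Max_ge) auto
    then show "- int (Max (insert 0 J)) \<le> - int n" by simp
  qed
  with F(3) have sub: "K \<subseteq> cyl vzero (- int (Max (insert 0 J)))" by (rule subset_trans)
  have "{x \<in> V. f x \<noteq> 0} \<subseteq> K"
    unfolding K_def by (rule closure_of_subset) (auto simp: topspace_vtopology)
  from subset_trans[OF this sub] show ?thesis
    by (intro that[of "Max (insert 0 J)"]) (simp add: subset_iff)
qed

text \<open>On the ball, which has finite measure, \<open>cmod (f x)\<close> is at most its square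
  plus 1.\<close>

lemma integrable_L2_compact_support:
  assumes f: "L2_fun \<mu> f" and N: "\<And>x. x \<in> V \<Longrightarrow> f x \<noteq> 0 \<Longrightarrow> x \<in> cyl vzero (- int N)"
  shows "integrable \<mu> f"
proof (rule Bochner_Integration.integrable_bound)
  show "integrable \<mu> (\<lambda>x. (cmod (f x))\<^sup>2 + indicator (cyl vzero (- int N)) x)"
    using f by (intro Bochner_Integration.integrable_add L2_fun_integrable integrable_real_indicator)
      (simp_all add: emeasure_cyl)
  have "norm (f x) \<le> (cmod (f x))\<^sup>2 + indicator (cyl vzero (- int N)) x" if "x \<in> V" for x
  proof (cases "f x = 0")
    case False
    then have "x \<in> cyl vzero (- int N)" using N that by blast
    moreover have "cmod (f x) \<le> (cmod (f x))\<^sup>2 + 1"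
      using sum_squares_bound[of "cmod (f x)" 1] norm_ge_zero[of "f x"] unfolding power_one mult_1_right by linarith
    ultimately show ?thesis by simp
  qed simp
  then have "norm (f x) \<le> norm ((cmod (f x))\<^sup>2 + indicator (cyl vzero (- int N)) x)" if "x \<in> V" for x
    using that by (metis abs_ge_self order_trans real_norm_def)
  then show "AE x in \<mu>. norm (f x) \<le> norm ((cmod (f x))\<^sup>2 + indicator (cyl vzero (- int N)) x)"
    by (intro AE_I2) simp
qed (use f in \<open>rule L2_fun_borel\<close>)

end

section \<open>Fourier transform\<close>

context vilenkin_dual
begin

text \<open>The character of \<open>x\<close> is trivial on the dual ball exactly when
  \<open>x\<close> vanishes up to index \<open>- l\<close>. Otherwise invariance under a translation
  inside the ball makes the integral vanish.\<close>

lemma integral_vchar_cyl: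
  assumes x: "x \<in> V"
  shows "(LINT \<omega>|\<mu>'. indicator (dual.cyl vzero l) \<omega> * vchar M x \<omega>)
    = (if \<forall>j\<le>- l. x j = 0 then of_real (m powi (- l)) else 0)"
proof (cases "\<forall>j\<le>- l. x j = 0")
  case True
  have *: "indicator (dual.cyl vzero l) \<omega> * vchar M x \<omega> = complex_of_real (indicator (dual.cyl vzero l) \<omega>)" for \<omega>
  proof (cases "\<omega> \<in> dual.cyl vzero l")
    case c: True
    have "vchar M x \<omega> = 1"
    proof (rule vchar_eq_1)
      show "x j = 0 \<or> \<omega> (1 - j) = 0" for j
        using c True by (cases "j \<le> - l") (auto simp: dual.cyl_def vzero_def)
    qed
    then show ?thesis using c by simp
  qed simp
  have "(LINT \<omega>|\<mu>'. indicator (dual.cyl vzero l) \<omega> * vchar M x \<omega>) = of_real (measure \<mu>' (dual.cyl vzero l))"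
  proof -
    have "dual.cyl vzero l \<inter> V' = dual.cyl vzero l" using dual.cyl_V by blast
    then show ?thesis by (simp add: *)
  qed
  then show ?thesis using True by (simp add: dual.measure_cyl abs_det_transpose)
next
  case False
  then obtain j where j: "j \<le> - l" "x j \<noteq> 0" by blast
  obtain \<eta> where \<eta>: "\<eta> \<in> V'" "\<And>i. i \<noteq> 1 - j \<Longrightarrow> \<eta> i = 0" "vchar M x \<eta> \<noteq> 1"
    using vchar_nondegenerate[OF x j(2)] by blast
  let ?f = "\<lambda>\<omega>. indicator (dual.cyl vzero l) \<omega> * vchar M x \<omega>"
  have f: "?f \<in> borel_measurable \<mu>'"
    using measurable_vchar_right[OF x] by simp
  have "dual.vneg \<eta> i = 0" if "i \<le> l" for i
    using \<eta>(2)[of i] j(1) that by (simp add: dual.vneg_def)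
  then have "dual.vneg \<eta> \<in> dual.cyl vzero l"
    using \<eta>(1) by (simp add: dual.cyl_def vzero_def)
  then have "dual.cyl (vzero \<oplus>' dual.vneg \<eta>) l = dual.cyl vzero l"
    using \<eta>(1) by (simp add: dual.cyl_eq)
  then have ind: "indicator (dual.cyl vzero l) (\<omega> \<oplus>' \<eta>) = (indicator (dual.cyl vzero l) \<omega> :: complex)"
    if "\<omega> \<in> V'" for \<omega>
    using dual.add_cyl_iff[OF that dual.vzero_V \<eta>(1), of l] by (simp add: indicator_def)
  have "integral\<^sup>L \<mu>' ?f = (LINT \<omega>|\<mu>'. ?f (vshift 0 \<omega> \<oplus>' \<eta>))"
    unfolding dual.integral_affine[OF \<eta>(1) f, of 0] by simp
  also have "\<dots> = (LINT \<omega>|\<mu>'. vchar M x \<eta> * ?f \<omega>)"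
    by (intro Bochner_Integration.integral_cong) (simp_all add: ind vchar_add_right x \<eta>(1))
  also have "\<dots> = vchar M x \<eta> * integral\<^sup>L \<mu>' ?f" by simp
  finally have "integral\<^sup>L \<mu>' ?f - vchar M x \<eta> * integral\<^sup>L \<mu>' ?f = 0"
    by (rule iffD2[OF right_minus_eq])
  then have "(1 - vchar M x \<eta>) * integral\<^sup>L \<mu>' ?f = 0"
    by (simp only: left_diff_distrib mult_1_left)
  then have "integral\<^sup>L \<mu>' ?f = 0" using \<eta>(3)[symmetric] unfolding mult_eq_0_iff right_minus_eq by blast
  then show ?thesis using False by auto
qed

text \<open>For \<open>x\<close> in the group this is, up to the factor \<open>m powi (- l)\<close>,
  the Fourier transform of the indicator of \<open>cyl x (- l)\<close>.\<close>

definition ftest :: "'d vseq \<Rightarrow> int \<Rightarrow> 'd vseq \<Rightarrow> complex" where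
  "ftest x l \<omega> = indicator (dual.cyl vzero l) \<omega> * cnj (vchar M x \<omega>)"

lemma L2_fun_ftest: "x \<in> V \<Longrightarrow> L2_fun \<mu>' (ftest x l)"
proof (rule L2_funI_bounded)
  assume x: "x \<in> V"
  show "ftest x l \<in> borel_measurable \<mu>'"
    unfolding ftest_def using borel_measurable_cnj[OF measurable_vchar_right[OF x]] by simp
  show "integrable \<mu>' (indicat_real (dual.cyl vzero l))"
    by (rule integrable_real_indicator) (simp_all add: dual.emeasure_cyl)
qed (simp add: ftest_def norm_mult indicator_def)

text \<open>Plancherel's identity against ball indicators only. By Fubini the integral over the dual
  ball is done first and yields the indicator of the ball around \<open>x0\<close>.\<close>

lemma fourier_cyl:
  assumes F: "integrable \<mu> F" and x0: "x0 \<in> V"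
  shows "L2_inner \<mu>' (fourier M \<mu> F) (ftest x0 l)
    = of_real (m powi (- l)) * L2_inner \<mu> F (indicator (cyl x0 (- l)))"
proof -
  interpret P: pair_sigma_finite \<mu> \<mu>' ..
  define C where "C = dual.cyl vzero l"
  define f where "f x \<omega> = F x * cnj (vchar M x \<omega>) * (indicator C \<omega> * vchar M x0 \<omega>)" for x \<omega>
  have C: "C \<in> sets \<mu>'" by (simp add: C_def)
  have meas: "(\<lambda>p. f (fst p) (snd p)) \<in> borel_measurable (\<mu> \<Otimes>\<^sub>M \<mu>')"
  proof -
    have "(\<lambda>p. F (fst p)) \<in> borel_measurable (\<mu> \<Otimes>\<^sub>M \<mu>')"
      by (rule measurable_compose[OF measurable_fst borel_measurable_integrable[OF F]])
    moreover have "(\<lambda>p. cnj (vchar M (fst p) (snd p))) \<in> borel_measurable (\<mu> \<Otimes>\<^sub>M \<mu>')"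
      using borel_measurable_cnj[OF measurable_vchar] by (simp add: case_prod_beta)
    moreover have "(\<lambda>p. indicator C (snd p) * vchar M x0 (snd p)) \<in> borel_measurable (\<mu> \<Otimes>\<^sub>M \<mu>')"
      using C measurable_vchar_right[OF x0]
      by (intro measurable_compose[OF measurable_snd, of "\<lambda>\<omega>. indicator C \<omega> * vchar M x0 \<omega>"]) simp
    ultimately show ?thesis unfolding f_def by (rule borel_measurable_times[OF borel_measurable_times])
  qed
  have norm_f: "norm (f x \<omega>) = cmod (F x) * indicator C \<omega>" for x \<omega>
    by (simp add: f_def norm_mult indicator_def)
  have intC: "integrable \<mu>' (indicat_real C)"
    using C by (intro integrable_real_indicator) (simp_all add: C_def dual.emeasure_cyl)
  have "integrable (\<mu> \<Otimes>\<^sub>M \<mu>') (\<lambda>p. f (fst p) (snd p))"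
  proof (rule P.Fubini_integrable[OF meas])
    show "integrable \<mu> (\<lambda>x. LINT \<omega>|\<mu>'. norm (f (fst (x, \<omega>)) (snd (x, \<omega>))))"
      using F by (simp add: norm_f)
    show "AE x in \<mu>. integrable \<mu>' (\<lambda>\<omega>. f (fst (x, \<omega>)) (snd (x, \<omega>)))"
    proof (rule AE_I2)
      fix x assume x: "x \<in> space \<mu>"
      have "(\<lambda>\<omega>. f x \<omega>) \<in> borel_measurable \<mu>'"
        using measurable_compose[OF measurable_Pair1'[OF x] meas] by simp
      then have "integrable \<mu>' (\<lambda>\<omega>. f x \<omega>)"
        by (rule Bochner_Integration.integrable_bound[OF integrable_mult_right[OF intC, of "cmod (F x)"]])
           (simp add: norm_f)
      then show "integrable \<mu>' (\<lambda>\<omega>. f (fst (x, \<omega>)) (snd (x, \<omega>)))" by simp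
    qed
  qed
  then have int: "integrable (\<mu> \<Otimes>\<^sub>M \<mu>') (case_prod f)" by (simp add: case_prod_beta')
  have "L2_inner \<mu>' (fourier M \<mu> F) (ftest x0 l) = (LINT \<omega>|\<mu>'. (LINT x|\<mu>. f x \<omega>))"
    unfolding L2_inner_def f_def fourier_def ftest_def C_def
    by (intro Bochner_Integration.integral_cong refl) (simp add: indicator_def)
  also have "\<dots> = (LINT x|\<mu>. (LINT \<omega>|\<mu>'. f x \<omega>))"
    by (rule P.Fubini_integral[OF int])
  also have "\<dots> = (LINT x|\<mu>. of_real (m powi (- l)) * (F x * cnj (indicator (cyl x0 (- l)) x)))"
  proof (rule Bochner_Integration.integral_cong[OF refl])
    fix x assume "x \<in> space \<mu>"
    then have x: "x \<in> V" by simp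
    \<comment> \<open>The two characters merge into that of the difference, so
      \<open>integral_vchar_cyl\<close> detects whether \<open>x\<close> and \<open>x0\<close> agree
      up to index \<open>- l\<close>.\<close>
    have "f x \<omega> = F x * (indicator C \<omega> * vchar M (x0 \<oplus> vneg x) \<omega>)" if "\<omega> \<in> V'" for \<omega>
      using that x x0 by (simp add: f_def vchar_add_left vchar_vneg)
    then have "(LINT \<omega>|\<mu>'. f x \<omega>) = (LINT \<omega>|\<mu>'. F x * (indicator C \<omega> * vchar M (x0 \<oplus> vneg x) \<omega>))"
      by (intro Bochner_Integration.integral_cong) auto
    also have "\<dots> = F x * (LINT \<omega>|\<mu>'. indicator C \<omega> * vchar M (x0 \<oplus> vneg x) \<omega>)"
      by simp
    also have "\<dots> = F x * (if \<forall>j\<le>- l. (x0 \<oplus> vneg x) j = 0 then of_real (m powi (- l)) else 0)"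
      unfolding C_def by (subst integral_vchar_cyl) (use x x0 in auto)
    also have "(\<forall>j\<le>- l. (x0 \<oplus> vneg x) j = 0) \<longleftrightarrow> x \<in> cyl x0 (- l)"
    proof -
      have "(x0 \<oplus> vneg x) j = 0 \<longleftrightarrow> x j = x0 j" for j
      proof -
        have "(x0 \<oplus> vneg x) j = 0 \<longleftrightarrow> D (x0 j + - x j) = 0" by (simp add: vadd_def vneg_def)
        also have "\<dots> \<longleftrightarrow> x0 j = D (0 - - x j)"
          by (rule D_add_eq_iff) (simp_all add: V_digit x0)
        finally show ?thesis using V_digit[OF x, of j] by auto
      qed
      then show ?thesis using x by (simp add: cyl_def)
    qed
    finally show "(LINT \<omega>|\<mu>'. f x \<omega>) = of_real (m powi (- l)) * (F x * cnj (indicator (cyl x0 (- l)) x))"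
      by (simp add: indicator_def)
  qed
  also have "\<dots> = of_real (m powi (- l)) * L2_inner \<mu> F (indicator (cyl x0 (- l)))"
    by (simp add: L2_inner_def)
  finally show ?thesis .
qed

text \<open>Both sides of \<open>fourier_cyl\<close> are continuous in the L2 norm, so the identity
  survives the limit defining the transform.\<close>

lemma has_fourier_cyl:
  assumes f: "has_fourier_L2 M \<mu> \<mu>' f g" and x0: "x0 \<in> V"
  shows "L2_inner \<mu>' g (ftest x0 l) = of_real (m powi (- l)) * L2_inner \<mu> f (indicator (cyl x0 (- l)))"
proof -
  obtain F where F: "\<And>n. integrable \<mu> (F n)" "\<And>n. L2_fun \<mu> (F n)" "\<And>n. L2_fun \<mu>' (fourier M \<mu> (F n))"
    "(\<lambda>n. L2_nrm \<mu> (\<lambda>x. F n x - f x)) \<longlonglongrightarrow> 0"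
    "(\<lambda>n. L2_nrm \<mu>' (\<lambda>\<omega>. fourier M \<mu> (F n) \<omega> - g \<omega>)) \<longlonglongrightarrow> 0"
    and fg: "L2_fun \<mu> f" "L2_fun \<mu>' g"
    using f unfolding has_fourier_L2_def by blast
  have "(\<lambda>n. L2_inner \<mu>' (fourier M \<mu> (F n)) (ftest x0 l)) \<longlonglongrightarrow> L2_inner \<mu>' g (ftest x0 l)"
    by (rule L2_inner_tendsto_left[OF F(3) fg(2) L2_fun_ftest[OF x0] F(5)])
  moreover have "(\<lambda>n. L2_inner \<mu>' (fourier M \<mu> (F n)) (ftest x0 l))
      \<longlonglongrightarrow> of_real (m powi (- l)) * L2_inner \<mu> f (indicator (cyl x0 (- l)))"
    unfolding fourier_cyl[OF F(1) x0]
    by (intro tendsto_mult_left L2_inner_tendsto_left[OF F(2) fg(1) L2_fun_cyl[OF x0] F(4)])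
  ultimately show ?thesis by (rule LIMSEQ_unique)
qed

lemma AE_eq_if_cyl_inner_eq:
  assumes "L2_fun \<mu> f" "L2_fun \<mu> f'"
    and "\<And>x l. x \<in> V \<Longrightarrow> of_real (m powi (- l)) * L2_inner \<mu> f (indicator (cyl x (- l)))
      = of_real (m powi (- l)) * L2_inner \<mu> f' (indicator (cyl x (- l)))"
  shows "AE x in \<mu>. f x = f' x"
proof -
  have "AE x in \<mu>. f x - f' x = 0"
  proof (rule AE_zero_if_cyl_inner_zero[OF L2_fun_diff[OF assms(1,2)]])
    fix x l assume x: "x \<in> V"
    have "m powi l \<noteq> 0" using m_pos by simp
    then have "L2_inner \<mu> f (indicator (cyl x l)) = L2_inner \<mu> f' (indicator (cyl x l))"
      using assms(3)[OF x, of "- l"] by (simp only: minus_minus mult_cancel_left of_real_eq_0_iff) blast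
    then show "L2_inner \<mu> (\<lambda>x. f x - f' x) (indicator (cyl x l)) = 0"
      by (simp add: L2_inner_diff_left assms(1,2) L2_fun_cyl x)
  qed
  then show ?thesis by simp
qed

lemma L2_inner_cong_space:
  "(\<And>x. x \<in> space \<mu>' \<Longrightarrow> f x = g x) \<Longrightarrow> L2_inner \<mu>' f u = L2_inner \<mu>' g u"
  unfolding L2_inner_def by (intro Bochner_Integration.integral_cong) auto

lemma fourier_inject:
  assumes "integrable \<mu> f" "L2_fun \<mu> f" "integrable \<mu> f'" "L2_fun \<mu> f'"
    and "\<And>\<omega>. \<omega> \<in> V' \<Longrightarrow> fourier M \<mu> f \<omega> = fourier M \<mu> f' \<omega>"
  shows "AE x in \<mu>. f x = f' x"
proof (rule AE_eq_if_cyl_inner_eq[OF assms(2,4)])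
  fix x l assume x: "x \<in> V"
  show "of_real (m powi (- l)) * L2_inner \<mu> f (indicator (cyl x (- l)))
      = of_real (m powi (- l)) * L2_inner \<mu> f' (indicator (cyl x (- l)))"
    unfolding fourier_cyl[OF assms(1) x, symmetric] fourier_cyl[OF assms(3) x, symmetric]
    by (intro L2_inner_cong_space) (simp add: assms(5))
qed

lemma has_fourier_L2_inject:
  assumes "has_fourier_L2 M \<mu> \<mu>' f g" "integrable \<mu> f'" "L2_fun \<mu> f'"
    and "\<And>\<omega>. \<omega> \<in> V' \<Longrightarrow> fourier M \<mu> f' \<omega> = g \<omega>"
  shows "AE x in \<mu>. f x = f' x"
proof (rule AE_eq_if_cyl_inner_eq)
  show "L2_fun \<mu> f" using assms(1) by (simp add: has_fourier_L2_def)
  fix x l assume x: "x \<in> V"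
  show "of_real (m powi (- l)) * L2_inner \<mu> f (indicator (cyl x (- l)))
      = of_real (m powi (- l)) * L2_inner \<mu> f' (indicator (cyl x (- l)))"
    unfolding has_fourier_cyl[OF assms(1) x, symmetric] fourier_cyl[OF assms(2) x, symmetric]
    by (intro L2_inner_cong_space) (simp add: assms(4))
qed (rule assms)

lemma fourier_affine:
  assumes f: "f \<in> borel_measurable \<mu>" and h: "h \<in> V" and \<omega>: "\<omega> \<in> V'"
  shows "fourier M \<mu> (\<lambda>x. f (vshift n x \<oplus> h)) \<omega>
    = of_real (m powi (- n)) * vchar M h (vshift (- n) \<omega>) * fourier M \<mu> f (vshift (- n) \<omega>)"
proof -
  let ?\<omega> = "vshift (- n) \<omega>"
  let ?G = "\<lambda>y. f y * cnj (vchar M y ?\<omega>) * vchar M h ?\<omega>"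
  have \<omega>': "?\<omega> \<in> V'" using \<omega> by simp
  have "f (vshift n x \<oplus> h) * cnj (vchar M x \<omega>) = ?G (vshift n x \<oplus> h)" if "x \<in> V" for x
  proof -
    have "vchar M (vshift n x) ?\<omega> = vchar M x \<omega>" by (simp add: vchar_shift)
    moreover have "vchar M (vshift n x \<oplus> h) ?\<omega> = vchar M (vshift n x) ?\<omega> * vchar M h ?\<omega>"
      using that h \<omega>' by (intro vchar_add_left) auto
    moreover have "cnj (vchar M h ?\<omega>) * vchar M h ?\<omega> = 1"
      using complex_norm_square[of "vchar M h ?\<omega>"] by (simp add: mult.commute)
    ultimately show ?thesis by simp
  qed
  then have "fourier M \<mu> (\<lambda>x. f (vshift n x \<oplus> h)) \<omega> = (LINT x|\<mu>. ?G (vshift n x \<oplus> h))"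
    unfolding fourier_def by (intro Bochner_Integration.integral_cong) auto
  also have "\<dots> = m powi (- n) *\<^sub>R (LINT x|\<mu>. ?G x)"
    by (rule integral_affine[OF h]) (intro borel_measurable_times f borel_measurable_cnj measurable_vchar_left \<omega>' borel_measurable_const)
  also have "(LINT x|\<mu>. ?G x) = fourier M \<mu> f ?\<omega> * vchar M h ?\<omega>"
    unfolding fourier_def by simp
  finally show ?thesis by (simp add: scaleR_conv_of_real mult_ac)
qed

section \<open>Walsh polynomials as symbols of finite refinement operators\<close>

lemma walsh_polynomial_vlattice:
  assumes "walsh_polynomial M s t p"
  obtains G a where "finite G" "G \<subseteq> vlattice M s"
    "\<And>\<omega>. \<omega> \<in> V' \<Longrightarrow> p \<omega> = (\<Sum>g\<in>G. a g * vchar M g \<omega>)"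
proof -
  obtain K c where K: "finite K" "\<And>\<omega>. \<omega> \<in> V' \<Longrightarrow> p \<omega> = (\<Sum>k\<in>K. c k * walsh M s k \<omega>)"
    using assms unfolding walsh_polynomial_def by blast
  have inj: "inj (vgamma M s)" using bij_vgamma by (rule bij_betw_imp_inj_on)
  show ?thesis
  proof (rule that[of "vgamma M s ` K" "\<lambda>g. c (inv (vgamma M s) g)"])
    show "vgamma M s ` K \<subseteq> vlattice M s" using bij_vgamma by (auto simp: bij_betw_def)
    show "p \<omega> = (\<Sum>g\<in>vgamma M s ` K. c (inv (vgamma M s) g) * vchar M g \<omega>)" if "\<omega> \<in> V'" for \<omega>
      unfolding K(2)[OF that] using inj
      by (subst sum.reindex) (auto simp: inj_on_def inv_f_f walsh_def)
  qed (use K in simp)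
qed

text \<open>The factor \<open>m\<close> cancels the Jacobian of the dilation, so that the symbol is
  exactly the Walsh polynomial with coefficients \<open>a\<close>.\<close>

definition refine :: "'d vseq set \<Rightarrow> ('d vseq \<Rightarrow> complex) \<Rightarrow> ('d vseq \<Rightarrow> complex) \<Rightarrow> 'd vseq \<Rightarrow> complex" where
  "refine G a \<phi> x = (\<Sum>g\<in>G. (of_real m * a g) * \<phi> (vshift 1 x \<oplus> g))"

lemma refine:
  assumes \<phi>: "integrable \<mu> \<phi>" "L2_fun \<mu> \<phi>" and G: "G \<subseteq> V"
  shows L2_fun_refine: "L2_fun \<mu> (refine G a \<phi>)"
    and integrable_refine: "integrable \<mu> (refine G a \<phi>)"
    and fourier_refine: "\<omega> \<in> V' \<Longrightarrow> fourier M \<mu> (refine G a \<phi>) \<omega>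
      = (\<Sum>g\<in>G. a g * vchar M g (vshift (- 1) \<omega>)) * fourier M \<mu> \<phi> (vshift (- 1) \<omega>)"
proof -
  have bm: "\<phi> \<in> borel_measurable \<mu>" using \<phi>(2) by (rule L2_fun_borel)
  have int: "integrable \<mu> (\<lambda>x. \<phi> (vshift 1 x \<oplus> g))" if "g \<in> G" for g
    using integrable_affine_iff[OF _ bm, of g 1] that G \<phi>(1) by blast
  show "L2_fun \<mu> (refine G a \<phi>)"
    unfolding refine_def using G \<phi> by (intro L2_fun_lin L2_fun_affine) auto
  show "integrable \<mu> (refine G a \<phi>)"
    unfolding refine_def using int by (intro Bochner_Integration.integrable_sum integrable_mult_right) auto
  assume \<omega>: "\<omega> \<in> V'"
  have int': "integrable \<mu> (\<lambda>x. \<phi> (vshift 1 x \<oplus> g) * cnj (vchar M x \<omega>))" if "g \<in> G" for g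
    by (rule Bochner_Integration.integrable_bound[OF int[OF that]
          borel_measurable_times[OF borel_measurable_integrable[OF int[OF that]]
            borel_measurable_cnj[OF measurable_vchar_left[OF \<omega>]]]])
       (simp add: norm_mult)
  have "fourier M \<mu> (refine G a \<phi>) \<omega>
      = (LINT x|\<mu>. (\<Sum>g\<in>G. (of_real m * a g) * (\<phi> (vshift 1 x \<oplus> g) * cnj (vchar M x \<omega>))))"
    by (simp add: fourier_def refine_def sum_distrib_right mult.assoc)
  also have "\<dots> = (\<Sum>g\<in>G. (LINT x|\<mu>. (of_real m * a g) * (\<phi> (vshift 1 x \<oplus> g) * cnj (vchar M x \<omega>))))"
    using int' by (intro Bochner_Integration.integral_sum integrable_mult_right)
  also have "\<dots> = (\<Sum>g\<in>G. (of_real m * a g) * fourier M \<mu> (\<lambda>x. \<phi> (vshift 1 x \<oplus> g)) \<omega>)"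
    by (simp add: fourier_def)
  also have "\<dots> = (\<Sum>g\<in>G. a g * vchar M g (vshift (- 1) \<omega>) * fourier M \<mu> \<phi> (vshift (- 1) \<omega>))"
  proof (rule sum.cong[OF refl])
    fix g assume "g \<in> G"
    then have g: "g \<in> V" using G by blast
    show "(of_real m * a g) * fourier M \<mu> (\<lambda>x. \<phi> (vshift 1 x \<oplus> g)) \<omega>
        = a g * vchar M g (vshift (- 1) \<omega>) * fourier M \<mu> \<phi> (vshift (- 1) \<omega>)"
      using m_pos unfolding fourier_affine[OF bm g \<omega>] by (simp add: power_int_minus)
  qed
  finally show "fourier M \<mu> (refine G a \<phi>) \<omega>
      = (\<Sum>g\<in>G. a g * vchar M g (vshift (- 1) \<omega>)) * fourier M \<mu> \<phi> (vshift (- 1) \<omega>)"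
    by (simp add: sum_distrib_right)
qed

end

section \<open>Refinement and orthonormality\<close>

lemma L2_span_Un_split:
  assumes "L2_span \<mu> (I \<union> J) e f" "\<And>i. i \<in> I \<union> J \<Longrightarrow> L2_fun \<mu> (e i)"
  obtains f1 f2 where "L2_span \<mu> I e f1" "L2_fun \<mu> f1" "L2_span \<mu> J e f2" "L2_fun \<mu> f2"
    "AE x in \<mu>. f x = f1 x + f2 x"
proof -
  obtain F c where F: "finite F" "F \<subseteq> I \<union> J" "AE x in \<mu>. f x = (\<Sum>i\<in>F. c i * e i x)"
    using assms(1) unfolding L2_span_def by blast
  let ?f1 = "\<lambda>x. \<Sum>i\<in>F \<inter> I. c i * e i x" and ?f2 = "\<lambda>x. \<Sum>i\<in>F - I. c i * e i x"
  show thesis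
  proof (rule that[of ?f1 ?f2])
    show "L2_span \<mu> I e ?f1" by (intro L2_span_sum L2_span_base) auto
    show "L2_span \<mu> J e ?f2" using F(2) by (intro L2_span_sum L2_span_base) auto
    show "L2_fun \<mu> ?f1" "L2_fun \<mu> ?f2" using F(2) assms(2) by (intro L2_fun_lin; blast)+
    have "(\<Sum>i\<in>F. c i * e i x) = ?f1 x + ?f2 x" for x
      using F(1) by (rule sum.Int_Diff)
    then show "AE x in \<mu>. f x = ?f1 x + ?f2 x" using F(3) by simp
  qed
qed

lemma sum_swap2:
  "(\<Sum>j\<in>J. \<Sum>j'\<in>J'. \<Sum>i\<in>I. \<Sum>i'\<in>I'. F i i' j j') = (\<Sum>i\<in>I. \<Sum>i'\<in>I'. \<Sum>j\<in>J. \<Sum>j'\<in>J'. F i i' j j')"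
proof -
  have "(\<Sum>j\<in>J. \<Sum>j'\<in>J'. \<Sum>i\<in>I. \<Sum>i'\<in>I'. F i i' j j') = (\<Sum>j\<in>J. \<Sum>i\<in>I. \<Sum>j'\<in>J'. \<Sum>i'\<in>I'. F i i' j j')"
    by (rule sum.cong[OF refl], rule sum.swap)
  also have "\<dots> = (\<Sum>j\<in>J. \<Sum>i\<in>I. \<Sum>i'\<in>I'. \<Sum>j'\<in>J'. F i i' j j')"
    by (rule sum.cong[OF refl], rule sum.cong[OF refl], rule sum.swap)
  also have "\<dots> = (\<Sum>i\<in>I. \<Sum>j\<in>J. \<Sum>i'\<in>I'. \<Sum>j'\<in>J'. F i i' j j')"
    by (rule sum.swap)
  also have "\<dots> = (\<Sum>i\<in>I. \<Sum>i'\<in>I'. \<Sum>j\<in>J. \<Sum>j'\<in>J'. F i i' j j')"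
    by (rule sum.cong[OF refl], rule sum.swap)
  finally show ?thesis .
qed

text \<open>The squared Hilbert-Schmidt norm of \<open>B\<^sup>* B - 1\<close> is \<open>card I - 2 card I + card J = 0\<close>.\<close>

lemma orthonormal_rows_imp_columns:
  fixes B :: "'i \<Rightarrow> 'j \<Rightarrow> complex"
  assumes fin: "finite I" "finite J" and card: "card I = card J"
    and rows: "\<And>i i'. i \<in> I \<Longrightarrow> i' \<in> I \<Longrightarrow> (\<Sum>j\<in>J. B i j * cnj (B i' j)) = (if i = i' then 1 else 0)"
    and j: "j \<in> J" "j' \<in> J"
  shows "(\<Sum>i\<in>I. B i j * cnj (B i j')) = (if j = j' then 1 else 0)"
proof -
  define X where "X j j' = (\<Sum>i\<in>I. B i j * cnj (B i j'))" for j j'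
  define d :: "'j \<Rightarrow> 'j \<Rightarrow> complex" where "d j j' = (if j = j' then 1 else 0)" for j j'
  have "(\<Sum>j\<in>J. \<Sum>j'\<in>J. X j j' * cnj (X j j'))
      = (\<Sum>j\<in>J. \<Sum>j'\<in>J. \<Sum>i\<in>I. \<Sum>i'\<in>I. (B i j * cnj (B i' j)) * (B i' j' * cnj (B i j')))"
    by (simp add: X_def cnj_sum sum_product mult_ac)
  also have "\<dots> = (\<Sum>i\<in>I. \<Sum>i'\<in>I. \<Sum>j\<in>J. \<Sum>j'\<in>J. (B i j * cnj (B i' j)) * (B i' j' * cnj (B i j')))"
    by (rule sum_swap2)
  also have "\<dots> = (\<Sum>i\<in>I. \<Sum>i'\<in>I. (\<Sum>j\<in>J. B i j * cnj (B i' j)) * (\<Sum>j'\<in>J. B i' j' * cnj (B i j')))"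
    by (simp add: sum_product)
  also have "\<dots> = (\<Sum>i\<in>I. \<Sum>i'\<in>I. if i = i' then 1 else 0)"
    by (intro sum.cong refl) (simp add: rows)
  finally have XX: "(\<Sum>j\<in>J. \<Sum>j'\<in>J. X j j' * cnj (X j j')) = of_nat (card I)"
    using fin by simp
  have "(\<Sum>j\<in>J. X j j) = (\<Sum>i\<in>I. \<Sum>j\<in>J. B i j * cnj (B i j))"
    unfolding X_def by (rule sum.swap)
  then have tr: "(\<Sum>j\<in>J. X j j) = of_nat (card I)" by (simp add: rows)
  have "(\<Sum>j\<in>J. \<Sum>j'\<in>J. (X j j' - d j j') * cnj (X j j' - d j j'))
      = (\<Sum>j\<in>J. \<Sum>j'\<in>J. X j j' * cnj (X j j')) - (\<Sum>j\<in>J. \<Sum>j'\<in>J. X j j' * d j j')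
        - (\<Sum>j\<in>J. \<Sum>j'\<in>J. cnj (X j j') * d j j') + (\<Sum>j\<in>J. \<Sum>j'\<in>J. d j j')"
    by (simp add: sum.distrib[symmetric] sum_subtractf[symmetric] d_def algebra_simps if_distrib[of cnj] cong: if_cong)
      (intro sum.cong refl, simp)
  also have "\<dots> = of_nat (card I) - (\<Sum>j\<in>J. X j j) - cnj (\<Sum>j\<in>J. X j j) + of_nat (card J)"
    using fin unfolding XX by (simp add: d_def if_distrib[of "(*) _"] cnj_sum cong: if_cong)
  also have "\<dots> = 0" by (simp add: tr card)
  finally have "complex_of_real (\<Sum>j\<in>J. \<Sum>j'\<in>J. (cmod (X j j' - d j j'))\<^sup>2) = 0"
    by (simp only: of_real_sum complex_norm_square)
  then have "(\<Sum>j\<in>J. \<Sum>j'\<in>J. (cmod (X j j' - d j j'))\<^sup>2) = 0" by (simp only: of_real_eq_0_iff)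
  then have "\<forall>j\<in>J. (\<Sum>j'\<in>J. (cmod (X j j' - d j j'))\<^sup>2) = 0"
    using fin by (subst (asm) sum_nonneg_eq_0_iff) (auto intro: sum_nonneg)
  then have "(\<Sum>j'\<in>J. (cmod (X j j' - d j j'))\<^sup>2) = 0" using j(1) by blast
  then have "\<forall>j'\<in>J. (cmod (X j j' - d j j'))\<^sup>2 = 0"
    using fin by (subst (asm) sum_nonneg_eq_0_iff) auto
  then have "X j j' = d j j'" using j(2) by auto
  then show ?thesis by (simp add: X_def d_def)
qed

context vilenkin_group
begin

section \<open>Fourier analysis on finite subgroups\<close>

lemma sum_vfin_translate:
  assumes c: "c \<in> vfin a b" shows "(\<Sum>u\<in>vfin a b. f u) = (\<Sum>g\<in>vfin a b. f (g \<oplus> c))"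
proof (rule sum.reindex_bij_witness[where i = "\<lambda>u. u \<oplus> c" and j = "\<lambda>u. u \<oplus> vneg c"])
qed (use c in \<open>auto simp: add_assoc vfin_V\<close>)

lemma vfin_eq_vzeroI: "x \<in> vfin a b \<Longrightarrow> (\<And>j. a < j \<Longrightarrow> j \<le> b \<Longrightarrow> x j = 0) \<Longrightarrow> x = vzero"
  unfolding vzero_def vfin_def by (rule ext) (metis (mono_tags, lifting) mem_Collect_eq not_le)

end

context vilenkin_dual
begin

text \<open>Here the window of \<open>sum_vchar_vfin\<close> covers all coordinates of
  \<open>g\<close>: the two finite groups are dual to each other.\<close>

lemma sum_vchar_dual:
  assumes g: "g \<in> vfin (- int n) 0"
  shows "(\<Sum>\<omega>\<in>dual.vfin 0 (int n). vchar M g \<omega>) = (if g = vzero then of_nat (abs_det M ^ n) else 0)"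
proof -
  have "(\<forall>j. 1 - int n \<le> j \<and> j < 1 - 0 \<longrightarrow> g j = 0) \<longleftrightarrow> g = vzero"
  proof
    assume "\<forall>j. 1 - int n \<le> j \<and> j < 1 - 0 \<longrightarrow> g j = 0"
    then show "g = vzero" by (intro vfin_eq_vzeroI[OF g]) auto
  qed (simp add: vzero_def)
  then show ?thesis
    using sum_vchar_vfin[where a = 0 and b = "int n", OF vfin_V[OF g]] by (simp only: diff_zero nat_int)
qed

lemma vneg_eq_vzero_iff: "u \<in> V \<Longrightarrow> v \<in> V \<Longrightarrow> u \<oplus> vneg v = vzero \<longleftrightarrow> u = v"
  using add_eq_iff[of u vzero "vneg v"] by simp

lemma Parseval_finite:
  "(\<Sum>\<omega>\<in>dual.vfin 0 (int n). (\<Sum>u\<in>vfin (- int n) 0. x u * vchar M u \<omega>) * cnj (\<Sum>u\<in>vfin (- int n) 0. y u * vchar M u \<omega>))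
    = of_nat (abs_det M ^ n) * (\<Sum>u\<in>vfin (- int n) 0. x u * cnj (y u))"
proof -
  let ?L = "vfin (- int n) 0" and ?D = "dual.vfin 0 (int n)"
  have "(\<Sum>\<omega>\<in>?D. (\<Sum>u\<in>?L. x u * vchar M u \<omega>) * cnj (\<Sum>u\<in>?L. y u * vchar M u \<omega>))
      = (\<Sum>\<omega>\<in>?D. \<Sum>u\<in>?L. \<Sum>v\<in>?L. (x u * cnj (y v)) * vchar M (u \<oplus> vneg v) \<omega>)"
    unfolding cnj_sum sum_product
    by (intro sum.cong refl) (simp add: vchar_add_left vchar_vneg vfin_V dual.vfin_V)
  also have "\<dots> = (\<Sum>u\<in>?L. \<Sum>v\<in>?L. \<Sum>\<omega>\<in>?D. (x u * cnj (y v)) * vchar M (u \<oplus> vneg v) \<omega>)"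
    by (subst sum.swap, subst (2) sum.swap) (rule refl)
  also have "\<dots> = (\<Sum>u\<in>?L. \<Sum>v\<in>?L. (x u * cnj (y v)) * (if u = v then of_nat (abs_det M ^ n) else 0))"
    unfolding sum_distrib_left[symmetric]
    by (intro sum.cong refl) (simp only: sum_vchar_dual add_vfin vneg_vfin vneg_eq_vzero_iff vfin_V)
  also have "\<dots> = (\<Sum>u\<in>?L. of_nat (abs_det M ^ n) * (x u * cnj (y u)))"
    by (intro sum.cong refl) (simp add: if_distrib[of "(*) _"] mult.commute cong: if_cong)
  finally show ?thesis by (simp only: sum_distrib_left)
qed

end

text \<open>The data left once Fourier transforms have been eliminated: \<open>\<Psi> 0\<close> is
  the refinable function, the other \<open>\<Psi> \<nu>\<close> are the wavelet functions, and all
  mask coefficients live on one finite subgroup.\<close>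

locale wavelet_system = vilenkin_dual M s t \<mu> \<mu>'
  for M :: "int ^ 'd ^ 'd" and s t :: "nat \<Rightarrow> int ^ 'd" and \<mu> \<mu>' :: "'d vseq measure" +
  fixes \<Psi> :: "nat \<Rightarrow> 'd vseq \<Rightarrow> complex" and p a :: "nat \<Rightarrow> 'd vseq \<Rightarrow> complex" and n0 N :: nat
  assumes L2_\<Psi>: "\<nu> < abs_det M \<Longrightarrow> L2_fun \<mu> (\<Psi> \<nu>)"
    and integral_\<Psi>: "(LINT x|\<mu>. \<Psi> 0 x) = 1"
    and support_\<Psi>: "x \<in> V \<Longrightarrow> \<Psi> 0 x \<noteq> 0 \<Longrightarrow> x \<in> cyl vzero (- int N)"
    and orthonormal_\<Psi>: "orthonormal_system \<mu> (vlattice M s) (\<lambda>h x. \<Psi> 0 (x \<oplus> h))"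
    and support_a: "g \<notin> vfin (- int n0) 0 \<Longrightarrow> a \<nu> g = 0"
    and p_eq: "\<nu> < abs_det M \<Longrightarrow> \<omega> \<in> V' \<Longrightarrow> p \<nu> \<omega> = (\<Sum>g\<in>vfin (- int n0) 0. a \<nu> g * vchar M g \<omega>)"
    and p_unitary: "k < abs_det M \<Longrightarrow> l < abs_det M \<Longrightarrow> \<omega> \<in> V' \<Longrightarrow>
      (\<Sum>\<nu><abs_det M. p \<nu> (vshift (- 1) (\<omega> \<oplus>' digit_embed (t k))) *
         cnj (p \<nu> (vshift (- 1) (\<omega> \<oplus>' digit_embed (t l))))) = (if k = l then 1 else 0)"
    and refine_\<Psi>: "\<nu> < abs_det M \<Longrightarrow> AE x in \<mu>. \<Psi> \<nu> x = refine (vfin (- int n0) 0) (a \<nu>) (\<Psi> 0) x"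
begin

definition rt :: "int \<Rightarrow> real" where "rt j = m powr (real_of_int j / 2)"

lemma rt_Suc: "sqrt m * rt j = rt (j + 1)"
  using m_pos by (simp add: rt_def powr_half_sqrt[symmetric] powr_add[symmetric] add_divide_distrib add.commute)

lemma rt_squared: "rt j * rt j = m powi j"
  using m_pos by (simp add: rt_def powr_add[symmetric] powr_real_of_int')

text \<open>Indexed by elements of \<open>H\<close> rather than by numbers, so that index arithmetic
  is group arithmetic.\<close>

definition e :: "nat \<Rightarrow> int \<Rightarrow> 'd vseq \<Rightarrow> 'd vseq \<Rightarrow> complex" where
  "e \<nu> j h x = of_real (rt j) * \<Psi> \<nu> (vshift j x \<oplus> h)"

lemma L2_e: "\<nu> < abs_det M \<Longrightarrow> h \<in> vlattice M s \<Longrightarrow> L2_fun \<mu> (e \<nu> j h)"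
  unfolding e_def by (intro L2_fun_cmult L2_fun_affine L2_\<Psi> vlattice_V)

lemma abs_det_pos: "0 < abs_det M"
  using abs_det_ge_2 by simp

lemma inner_e0:
  assumes "h \<in> vlattice M s" "h' \<in> vlattice M s"
  shows "L2_inner \<mu> (e 0 j h) (e 0 j h') = (if h = h' then 1 else 0)"
proof -
  have L2: "L2_fun \<mu> (\<lambda>x. \<Psi> 0 (x \<oplus> h))" if "h \<in> vlattice M s" for h
    using orthonormal_\<Psi> that by (simp add: orthonormal_system_def)
  \<comment> \<open>The inserted zero translation separates the dilation from the translates whose
    orthonormality is assumed.\<close>
  have eq: "e 0 j h = (\<lambda>x. of_real (rt j) * \<Psi> 0 ((vshift j x \<oplus> vzero) \<oplus> h))" if "h \<in> vlattice M s" for h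
    using vlattice_V[OF that] by (simp add: e_def fun_eq_iff add_assoc)
  have "L2_inner \<mu> (e 0 j h) (e 0 j h') = of_real (rt j) * (of_real (rt j) *
      (of_real (m powi (- j)) * L2_inner \<mu> (\<lambda>x. \<Psi> 0 (x \<oplus> h)) (\<lambda>x. \<Psi> 0 (x \<oplus> h'))))"
    unfolding eq[OF assms(1)] eq[OF assms(2)]
    by (simp only: L2_inner_cmult_left L2_inner_cmult_right complex_cnj_complex_of_real
        L2_inner_affine[OF L2[OF assms(1)] L2[OF assms(2)] vzero_V])
  also have "L2_inner \<mu> (\<lambda>x. \<Psi> 0 (x \<oplus> h)) (\<lambda>x. \<Psi> 0 (x \<oplus> h')) = (if h = h' then 1 else 0)"
    using orthonormal_\<Psi> assms by (simp add: orthonormal_system_def)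
  also have "complex_of_real (rt j) * (of_real (rt j) * (of_real (m powi (- j)) * z)) = z" for z
  proof -
    have "rt j * (rt j * m powi (- j)) = 1"
      using m_pos by (simp add: rt_squared mult.assoc[symmetric] power_int_minus)
    then have "complex_of_real (rt j * (rt j * m powi (- j))) = 1" by simp
    then show ?thesis by (simp only: of_real_mult mult.assoc[symmetric] mult_1_left)
  qed
  finally show ?thesis .
qed

text \<open>Coefficients of \<open>e \<nu> j h\<close> in terms of the \<open>e 0 (j + 1) u\<close>,
  the same for every \<open>j\<close>. The square root is what the factor \<open>m\<close> of
  \<open>refine\<close> leaves after the two normalisations.\<close>

definition beta :: "nat \<Rightarrow> 'd vseq \<Rightarrow> 'd vseq \<Rightarrow> complex" where
  "beta \<nu> h u = of_real (sqrt m) * a \<nu> (u \<oplus> vneg (vshift 1 h))"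

lemma vshift_vfin_Suc: "h \<in> vfin (- int n) 0 \<Longrightarrow> vshift 1 h \<in> vfin (- int (Suc n)) 0"
  by (rule subsetD[OF vfin_mono vshift_vfin[of h "- int n" 0 1]]) auto

text \<open>Translation by \<open>vshift 1 h\<close> recentres the coefficients at the support of
  \<open>a\<close>, which fits into the larger group because \<open>n0 \<le> n\<close>.\<close>

lemma sum_beta:
  assumes h: "h \<in> vfin (- int n) 0" and n: "n0 \<le> n"
  shows "(\<Sum>u\<in>vfin (- int (Suc n)) 0. beta \<nu> h u * f u)
    = (\<Sum>g\<in>vfin (- int n0) 0. (of_real (sqrt m) * a \<nu> g) * f (g \<oplus> vshift 1 h))"
proof -
  have "(\<Sum>u\<in>vfin (- int (Suc n)) 0. beta \<nu> h u * f u)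
      = (\<Sum>g\<in>vfin (- int (Suc n)) 0. beta \<nu> h (g \<oplus> vshift 1 h) * f (g \<oplus> vshift 1 h))"
    by (rule sum_vfin_translate[OF vshift_vfin_Suc[OF h]])
  also have "\<dots> = (\<Sum>g\<in>vfin (- int (Suc n)) 0. (of_real (sqrt m) * a \<nu> g) * f (g \<oplus> vshift 1 h))"
    by (intro sum.cong refl) (simp add: beta_def add_assoc vfin_V)
  also have "\<dots> = (\<Sum>g\<in>vfin (- int n0) 0. (of_real (sqrt m) * a \<nu> g) * f (g \<oplus> vshift 1 h))"
  proof (rule sum.mono_neutral_right)
    show "vfin (- int n0) 0 \<subseteq> vfin (- int (Suc n)) 0" using n by (intro vfin_mono) auto
  qed (simp_all add: support_a)
  finally show ?thesis .
qed

lemma e_refinement: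
  assumes \<nu>: "\<nu> < abs_det M" and h: "h \<in> vfin (- int n) 0" and n: "n0 \<le> n"
  shows "AE x in \<mu>. e \<nu> j h x = (\<Sum>u\<in>vfin (- int (Suc n)) 0. beta \<nu> h u * e 0 (j + 1) u x)"
proof -
  have "e \<nu> j h x = (\<Sum>u\<in>vfin (- int (Suc n)) 0. beta \<nu> h u * e 0 (j + 1) u x)"
    if "\<Psi> \<nu> (vshift j x \<oplus> h) = refine (vfin (- int n0) 0) (a \<nu>) (\<Psi> 0) (vshift j x \<oplus> h)" for x
  proof -
    have "e \<nu> j h x = (\<Sum>g\<in>vfin (- int n0) 0. of_real (rt j) * ((of_real m * a \<nu> g) *
        \<Psi> 0 (vshift 1 (vshift j x \<oplus> h) \<oplus> g)))"
      by (simp only: e_def that refine_def sum_distrib_left)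
    also have "\<dots> = (\<Sum>g\<in>vfin (- int n0) 0. (of_real (sqrt m) * a \<nu> g) * e 0 (j + 1) (g \<oplus> vshift 1 h) x)"
    proof (intro sum.cong refl)
      fix g
      have "m * rt j = sqrt m * rt (j + 1)"
        using m_pos by (simp add: rt_Suc[symmetric])
      then have 1: "complex_of_real (rt j) * of_real m = of_real (sqrt m) * of_real (rt (j + 1))"
        by (simp only: of_real_mult[symmetric] mult.commute)
      have 2: "vshift 1 (vshift j x \<oplus> h) \<oplus> g = vshift (j + 1) x \<oplus> (g \<oplus> vshift 1 h)"
        by (simp only: vshift_add vshift_vshift add.commute[of 1 j] add_assoc add_commute[of "vshift 1 h" g])
      have "of_real (rt j) * ((of_real m * a \<nu> g) * \<Psi> 0 (vshift 1 (vshift j x \<oplus> h) \<oplus> g))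
          = (of_real (rt j) * of_real m) * (a \<nu> g * \<Psi> 0 (vshift (j + 1) x \<oplus> (g \<oplus> vshift 1 h)))"
        by (simp only: 2 mult.assoc)
      also have "\<dots> = (of_real (sqrt m) * a \<nu> g) * e 0 (j + 1) (g \<oplus> vshift 1 h) x"
        unfolding 1 e_def by (simp only: mult_ac)
      finally show "of_real (rt j) * ((of_real m * a \<nu> g) * \<Psi> 0 (vshift 1 (vshift j x \<oplus> h) \<oplus> g))
          = (of_real (sqrt m) * a \<nu> g) * e 0 (j + 1) (g \<oplus> vshift 1 h) x" .
    qed
    also have "\<dots> = (\<Sum>u\<in>vfin (- int (Suc n)) 0. beta \<nu> h u * e 0 (j + 1) u x)"
      by (rule sum_beta[OF h n, symmetric])
    finally show ?thesis .
  qed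
  then show ?thesis
    using AE_affine[OF refine_\<Psi>[OF \<nu>] vfin_V[OF h], of j] by (rule eventually_mono[rotated])
qed

text \<open>The mask condition makes the rows indexed by digits orthonormal; the matrix is square,
  so orthonormality passes to the index \<nu>. The inverse shift puts each digit at index 1.\<close>

lemma unitary_columns:
  assumes "\<nu> < abs_det M" "\<nu>' < abs_det M" "\<omega> \<in> V'"
  shows "(\<Sum>k<abs_det M. p \<nu> (\<omega> \<oplus>' vshift (- 1) (digit_embed (t k))) *
      cnj (p \<nu>' (\<omega> \<oplus>' vshift (- 1) (digit_embed (t k))))) = (if \<nu> = \<nu>' then 1 else 0)"
proof (rule orthonormal_rows_imp_columns[where I = "{..<abs_det M}" and J = "{..<abs_det M}"])
  fix k l assume "k \<in> {..<abs_det M}" "l \<in> {..<abs_det M}"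
  then show "(\<Sum>\<nu><abs_det M. p \<nu> (\<omega> \<oplus>' vshift (- 1) (digit_embed (t k))) *
      cnj (p \<nu> (\<omega> \<oplus>' vshift (- 1) (digit_embed (t l))))) = (if k = l then 1 else 0)"
    using p_unitary[of k l "vshift 1 \<omega>"] assms(3) by (simp add: dual.vshift_add)
qed (use assms in auto)

lemma digit_shift_vfin:
  assumes "k < abs_det M"
  shows "vshift (- 1) (digit_embed (t k)) \<in> dual.vfin 0 (int (Suc n))"
proof -
  have "t k \<in> digits (transpose M) t" using assms by (auto simp: digits_def abs_det_transpose)
  then have "digit_embed (t k) \<in> V'"
    unfolding dual.V_iff by (intro conjI exI[of _ "- 1"]) (auto simp: digit_embed_def)
  then show ?thesis by (simp add: dual.vfin_def) (simp add: vshift_def digit_embed_def)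
qed

lemma beta_transform:
  assumes "\<nu> < abs_det M" "h \<in> vfin (- int n) 0" "n0 \<le> n" "\<omega> \<in> V'"
  shows "(\<Sum>u\<in>vfin (- int (Suc n)) 0. beta \<nu> h u * vchar M u \<omega>)
    = of_real (sqrt m) * (p \<nu> \<omega> * vchar M (vshift 1 h) \<omega>)"
proof -
  have "(\<Sum>u\<in>vfin (- int (Suc n)) 0. beta \<nu> h u * vchar M u \<omega>)
      = (\<Sum>g\<in>vfin (- int n0) 0. (of_real (sqrt m) * a \<nu> g) * vchar M (g \<oplus> vshift 1 h) \<omega>)"
    by (rule sum_beta[OF assms(2,3)])
  also have "\<dots> = (\<Sum>g\<in>vfin (- int n0) 0. of_real (sqrt m) * (a \<nu> g * vchar M g \<omega> * vchar M (vshift 1 h) \<omega>))"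
    using assms(2,4) by (intro sum.cong refl) (simp add: vchar_add_left vfin_V)
  also have "\<dots> = of_real (sqrt m) * (p \<nu> \<omega> * vchar M (vshift 1 h) \<omega>)"
    by (simp only: p_eq[OF assms(1,4)] sum_distrib_left sum_distrib_right)
  finally show ?thesis .
qed

text \<open>By finite Parseval the sum is an average of \<open>p \<nu> * cnj (p \<nu>')\<close>
  times the character of \<open>g\<close>. Averaging over the shifts \<open>?\<sigma> k\<close>, on
  which that character is trivial, brings in unitarity; the remaining character sum detects
  \<open>h = h'\<close>.\<close>

lemma beta_orthonormal:
  assumes \<nu>: "\<nu> < abs_det M" "\<nu>' < abs_det M"
    and h: "h \<in> vfin (- int n) 0" "h' \<in> vfin (- int n) 0" and n: "n0 \<le> n"
  shows "(\<Sum>u\<in>vfin (- int (Suc n)) 0. beta \<nu> h u * cnj (beta \<nu>' h' u)) = (if \<nu> = \<nu>' \<and> h = h' then 1 else 0)"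
proof -
  let ?D = "dual.vfin 0 (int (Suc n))"
  let ?\<sigma> = "\<lambda>k. vshift (- 1) (digit_embed (t k))"
  define g where "g = vshift 1 (h \<oplus> vneg h')"
  define G where "G \<omega> = p \<nu> \<omega> * cnj (p \<nu>' \<omega>) * vchar M g \<omega>" for \<omega>
  have hh: "h \<oplus> vneg h' \<in> vfin (- int n) 0" using h by simp
  have g: "g \<in> vfin (- int (Suc n)) 0" "g \<in> V"
    unfolding g_def using vshift_vfin_Suc[OF hh] by (blast intro: vfin_V)+
  have g0: "g = vzero \<longleftrightarrow> h = h'"
  proof -
    have "g = vzero \<longleftrightarrow> vshift (- 1) g = vzero" by (metis vshift_0 vshift_vshift vshift_vzero add.right_inverse)
    also have "vshift (- 1) g = h \<oplus> vneg h'" by (simp add: g_def)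
    finally show ?thesis using h by (simp add: vneg_eq_vzero_iff vfin_V)
  qed
  \<comment> \<open>\<open>?\<sigma> k\<close> lives at index 1, which is paired with
    \<open>g 0\<close>; this is the digit of the difference at index 1, hence 0.\<close>
  have sg: "vchar M g (?\<sigma> k) = 1" for k
  proof (rule vchar_eq_1)
    fix j
    have "g 0 = 0" using hh by (simp add: g_def vshift_def vfin_def)
    then show "g j = 0 \<or> ?\<sigma> k (1 - j) = 0" by (cases "j = 0") (auto simp: vshift_def digit_embed_def)
  qed
  have "of_nat (abs_det M ^ Suc n) * (\<Sum>u\<in>vfin (- int (Suc n)) 0. beta \<nu> h u * cnj (beta \<nu>' h' u))
      = (\<Sum>\<omega>\<in>?D. (\<Sum>u\<in>vfin (- int (Suc n)) 0. beta \<nu> h u * vchar M u \<omega>)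
          * cnj (\<Sum>u\<in>vfin (- int (Suc n)) 0. beta \<nu>' h' u * vchar M u \<omega>))"
    by (rule Parseval_finite[symmetric])
  also have "\<dots> = (\<Sum>\<omega>\<in>?D. of_nat (abs_det M) * G \<omega>)"
  proof (intro sum.cong refl)
    fix \<omega> assume "\<omega> \<in> ?D"
    then have \<omega>: "\<omega> \<in> V'" by (rule dual.vfin_V)
    have "vchar M g \<omega> = vchar M (vshift 1 h) \<omega> * cnj (vchar M (vshift 1 h') \<omega>)"
      using h \<omega> by (simp add: g_def vshift_add vshift_vneg vchar_add_left vchar_vneg vfin_V)
    moreover have "complex_of_real (sqrt m) * of_real (sqrt m) = of_nat (abs_det M)"
      by (simp flip: of_real_mult)
    ultimately show "(\<Sum>u\<in>vfin (- int (Suc n)) 0. beta \<nu> h u * vchar M u \<omega>)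
        * cnj (\<Sum>u\<in>vfin (- int (Suc n)) 0. beta \<nu>' h' u * vchar M u \<omega>) = of_nat (abs_det M) * G \<omega>"
      unfolding beta_transform[OF \<nu>(1) h(1) n \<omega>] beta_transform[OF \<nu>(2) h(2) n \<omega>] G_def
      by (simp flip: \<open>_ = of_nat (abs_det M)\<close>)
  qed
  \<comment> \<open>The factor \<open>abs_det M\<close> becomes a sum over \<open>k\<close>, making
    room for one translate of \<open>G\<close> per digit.\<close>
  also have "\<dots> = (\<Sum>k<abs_det M. \<Sum>\<omega>\<in>?D. G \<omega>)" by (simp add: sum_distrib_left)
  also have "\<dots> = (\<Sum>k<abs_det M. \<Sum>\<omega>\<in>?D. G (\<omega> \<oplus>' ?\<sigma> k))"
    by (intro sum.cong refl dual.sum_vfin_translate digit_shift_vfin) simp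
  also have "\<dots> = (\<Sum>\<omega>\<in>?D. \<Sum>k<abs_det M. G (\<omega> \<oplus>' ?\<sigma> k))" by (rule sum.swap)
  also have "\<dots> = (\<Sum>\<omega>\<in>?D. (if \<nu> = \<nu>' then 1 else 0) * vchar M g \<omega>)"
  proof (intro sum.cong refl)
    fix \<omega> assume "\<omega> \<in> ?D"
    then have \<omega>: "\<omega> \<in> V'" by (rule dual.vfin_V)
    have "G (\<omega> \<oplus>' ?\<sigma> k) = p \<nu> (\<omega> \<oplus>' ?\<sigma> k) * cnj (p \<nu>' (\<omega> \<oplus>' ?\<sigma> k)) * vchar M g \<omega>"
      if "k < abs_det M" for k
      using dual.vfin_V[OF digit_shift_vfin[OF that]]
      by (simp add: G_def vchar_add_right g(2) \<omega> sg)
    then have "(\<Sum>k<abs_det M. G (\<omega> \<oplus>' ?\<sigma> k))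
        = (\<Sum>k<abs_det M. p \<nu> (\<omega> \<oplus>' ?\<sigma> k) * cnj (p \<nu>' (\<omega> \<oplus>' ?\<sigma> k))) * vchar M g \<omega>"
      unfolding sum_distrib_right by (intro sum.cong refl) simp
    then show "(\<Sum>k<abs_det M. G (\<omega> \<oplus>' ?\<sigma> k)) = (if \<nu> = \<nu>' then 1 else 0) * vchar M g \<omega>"
      by (simp only: unitary_columns[OF \<nu> \<omega>])
  qed
  also have "\<dots> = (if \<nu> = \<nu>' then 1 else 0) * (if g = vzero then of_nat (abs_det M ^ Suc n) else 0)"
    unfolding sum_distrib_left[symmetric] sum_vchar_dual[OF g(1)] ..
  also have "\<dots> = of_nat (abs_det M ^ Suc n) * (if \<nu> = \<nu>' \<and> h = h' then 1 else 0)"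
    by (simp add: g0)
  finally show ?thesis using abs_det_pos by simp
qed

lemma inner_e:
  assumes "\<nu> < abs_det M" "\<nu>' < abs_det M" "h \<in> vlattice M s" "h' \<in> vlattice M s"
  shows "L2_inner \<mu> (e \<nu> j h) (e \<nu>' j h') = (if \<nu> = \<nu>' \<and> h = h' then 1 else 0)"
proof -
  obtain n1 where n1: "{h, h'} \<subseteq> vfin (- int n1) 0"
    using finite_subset_vlattice[of "{h, h'}"] assms by auto
  define n where "n = max n0 n1"
  have "vfin (- int n1) 0 \<subseteq> vfin (- int n) 0" by (rule vfin_mono) (auto simp: n_def)
  then have h: "h \<in> vfin (- int n) 0" "h' \<in> vfin (- int n) 0" and n: "n0 \<le> n"
    using n1 by (auto simp: n_def)
  let ?L = "vfin (- int (Suc n)) 0"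
  have L: "u \<in> vlattice M s" if "u \<in> ?L" for u using that vlattice_eq_Union_vfin by blast
  have e0: "L2_fun \<mu> (e 0 (j + 1) u)" if "u \<in> ?L" for u using L2_e[OF abs_det_pos L[OF that]] .
  have "L2_inner \<mu> (e \<nu> j h) (e \<nu>' j h') =
      L2_inner \<mu> (\<lambda>x. \<Sum>u\<in>?L. beta \<nu> h u * e 0 (j + 1) u x) (\<lambda>x. \<Sum>u\<in>?L. beta \<nu>' h' u * e 0 (j + 1) u x)"
    using assms by (intro L2_inner_cong_AE e_refinement h n L2_e L2_fun_lin e0)
  also have "\<dots> = (\<Sum>u\<in>?L. beta \<nu> h u * (\<Sum>v\<in>?L. cnj (beta \<nu>' h' v) * L2_inner \<mu> (e 0 (j + 1) u) (e 0 (j + 1) v)))"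
    using e0 by (simp add: L2_inner_lin_left L2_inner_lin_right L2_fun_lin)
  also have "\<dots> = (\<Sum>u\<in>?L. beta \<nu> h u * (\<Sum>v\<in>?L. if u = v then cnj (beta \<nu>' h' v) else 0))"
    by (intro sum.cong refl arg_cong[of _ _ "(*) _"]) (simp add: inner_e0 L)
  also have "\<dots> = (\<Sum>u\<in>?L. beta \<nu> h u * cnj (beta \<nu>' h' u))" by simp
  also have "\<dots> = (if \<nu> = \<nu>' \<and> h = h' then 1 else 0)"
    by (rule beta_orthonormal[OF assms(1,2) h n])
  finally show ?thesis .
qed

abbreviation E :: "nat \<times> int \<times> 'd vseq \<Rightarrow> 'd vseq \<Rightarrow> complex" where
  "E \<equiv> \<lambda>(\<nu>, j, h). e \<nu> j h"

text \<open>\<open>level {0} {j}\<close> indexes V_j, \<open>level {1..} {j}\<close> indexes W_j,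
  and \<open>level UNIV {j}\<close> both together.\<close>

definition level :: "nat set \<Rightarrow> int set \<Rightarrow> (nat \<times> int \<times> 'd vseq) set" where
  "level A B = (A \<inter> {..<abs_det M}) \<times> B \<times> vlattice M s"

lemma L2_E: "i \<in> level A B \<Longrightarrow> L2_fun \<mu> (E i)"
  by (auto simp: level_def intro: L2_e)

section \<open>Passing between levels, and orthonormality of the wavelets\<close>

lemma e_span_finer:
  assumes "\<nu> < abs_det M" "h \<in> vlattice M s"
  shows "L2_span \<mu> (level {0} {j + 1}) E (e \<nu> j h)"
proof -
  obtain n1 where "h \<in> vfin (- int n1) 0"
    using assms(2) vlattice_eq_Union_vfin by blast
  then have h: "h \<in> vfin (- int (max n0 n1)) 0"
    using vfin_mono[of "- int (max n0 n1)" "- int n1" 0 0] by auto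
  show ?thesis
  proof (rule L2_span_cong[OF L2_span_sum e_refinement[OF assms(1) h]])
    fix u assume "u \<in> vfin (- int (Suc (max n0 n1))) 0"
    then have "u \<in> vlattice M s" using vlattice_eq_Union_vfin by blast
    then have "(0, j + 1, u) \<in> level {0} {j + 1}" using abs_det_pos by (simp add: level_def)
    from L2_span_base[OF this, of \<mu> E] show "L2_span \<mu> (level {0} {j + 1}) E (e 0 (j + 1) u)" by simp
  qed simp
qed

lemma e_span_finer_level:
  assumes "\<nu> < abs_det M" "h \<in> vlattice M s"
  shows "L2_span \<mu> (level {0} {j + 1 + int n}) E (e \<nu> j h)"
proof (induction n)
  case 0
  then show ?case using e_span_finer[OF assms] by simp
next
  case (Suc n)
  show ?case
  proof (rule L2_span_trans[OF Suc])
    fix i assume "i \<in> level {0} {j + 1 + int n}"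
    then obtain u where "i = (0, j + 1 + int n, u)" "u \<in> vlattice M s" by (auto simp: level_def)
    then show "L2_span \<mu> (level {0} {j + 1 + int (Suc n)}) E (E i)"
      using e_span_finer[OF abs_det_pos, of u "j + 1 + int n"] by (simp add: algebra_simps)
  qed
qed

text \<open>Inverts the refinement equations: the square matrix \<open>beta\<close> has orthonormal
  rows, hence orthonormal columns, so its adjoint recovers the finer function.\<close>

lemma e_span_coarser:
  assumes u: "u \<in> vlattice M s"
  shows "L2_span \<mu> (level UNIV {j}) E (e 0 (j + 1) u)"
proof -
  obtain n1 where n1: "u \<in> vfin (- int n1) 0" using u vlattice_eq_Union_vfin by blast
  define n where "n = max n0 n1"
  have n: "n0 \<le> n" by (simp add: n_def)
  have uL: "u \<in> vfin (- int (Suc n)) 0"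
    by (rule subsetD[OF vfin_mono[of "- int (Suc n)" "- int n1" 0 0] n1]) (auto simp: n_def)
  let ?L = "vfin (- int (Suc n)) 0" and ?I = "{..<abs_det M} \<times> vfin (- int n) 0"
  have cols: "(\<Sum>i\<in>?I. case_prod beta i v * cnj (case_prod beta i u)) = (if v = u then 1 else 0)"
    if "v \<in> ?L" for v
  proof (rule orthonormal_rows_imp_columns[where I = ?I and J = ?L])
    \<comment> \<open>The values of \<nu> make up for the one digit by which the lattice points
      \<open>h\<close> are shorter than the \<open>u\<close>.\<close>
    show "card ?I = card ?L" by (simp add: card_cartesian_product card_vfin nat_add_distrib)
    fix i i' assume "i \<in> ?I" "i' \<in> ?I"
    then show "(\<Sum>v\<in>?L. case_prod beta i v * cnj (case_prod beta i' v)) = (if i = i' then 1 else 0)"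
      using n by (cases i, cases i') (simp only: mem_Times_iff fst_conv snd_conv lessThan_iff
          case_prod_conv beta_orthonormal prod.inject)
  qed (use that uL in auto)
  have "AE x in \<mu>. \<forall>i\<in>?I. case_prod (\<lambda>\<nu>. e \<nu> j) i x = (\<Sum>v\<in>?L. case_prod beta i v * e 0 (j + 1) v x)"
    using e_refinement n by (intro AE_finite_allI) auto
  then have "AE x in \<mu>. e 0 (j + 1) u x = (\<Sum>i\<in>?I. cnj (case_prod beta i u) * case_prod (\<lambda>\<nu>. e \<nu> j) i x)"
  proof eventually_elim
    case (elim x)
    have "(\<Sum>i\<in>?I. cnj (case_prod beta i u) * case_prod (\<lambda>\<nu>. e \<nu> j) i x)
        = (\<Sum>i\<in>?I. \<Sum>v\<in>?L. (case_prod beta i v * cnj (case_prod beta i u)) * e 0 (j + 1) v x)"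
    proof (intro sum.cong refl)
      fix i assume "i \<in> ?I"
      then show "cnj (case_prod beta i u) * case_prod (\<lambda>\<nu>. e \<nu> j) i x
          = (\<Sum>v\<in>?L. (case_prod beta i v * cnj (case_prod beta i u)) * e 0 (j + 1) v x)"
        using elim by (simp only: sum_distrib_left mult_ac)
    qed
    also have "\<dots> = (\<Sum>v\<in>?L. (\<Sum>i\<in>?I. case_prod beta i v * cnj (case_prod beta i u)) * e 0 (j + 1) v x)"
      unfolding sum_distrib_right by (rule sum.swap)
    also have "\<dots> = (\<Sum>v\<in>?L. (if v = u then 1 else 0) * e 0 (j + 1) v x)"
      by (intro sum.cong refl) (simp only: cols)
    also have "\<dots> = (\<Sum>v\<in>?L. if v = u then e 0 (j + 1) v x else 0)"
      by (intro sum.cong refl) simp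
    also have "\<dots> = e 0 (j + 1) u x" using uL by simp
    finally show ?case by simp
  qed
  moreover have "L2_span \<mu> (level UNIV {j}) E (\<lambda>x. \<Sum>i\<in>?I. cnj (case_prod beta i u) * case_prod (\<lambda>\<nu>. e \<nu> j) i x)"
  proof (rule L2_span_sum)
    fix i assume "i \<in> ?I"
    then obtain \<nu> h where i: "i = (\<nu>, h)" "\<nu> < abs_det M" "h \<in> vlattice M s"
      using vlattice_eq_Union_vfin by blast
    then have "(\<nu>, j, h) \<in> level UNIV {j}" by (simp add: level_def)
    from L2_span_base[OF this, of \<mu> E] i
    show "L2_span \<mu> (level UNIV {j}) E (case_prod (\<lambda>\<nu>. e \<nu> j) i)" by simp
  qed
  ultimately show ?thesis by (rule L2_span_cong[rotated])
qed

text \<open>The coarser function is a combination of the \<open>e 0 j' u\<close>, which are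
  orthogonal to the wavelets of their own level.\<close>

lemma inner_e_finer:
  assumes "\<nu> < abs_det M" "h \<in> vlattice M s" "0 < \<nu>'" "\<nu>' < abs_det M" "h' \<in> vlattice M s" "j < j'"
  shows "L2_inner \<mu> (e \<nu> j h) (e \<nu>' j' h') = 0"
proof (rule L2_span_orthogonal)
  show "L2_span \<mu> (level {0} {j'}) E (e \<nu> j h)"
    using e_span_finer_level[OF assms(1,2), of j "nat (j' - j - 1)"] assms(6) by simp
  show "L2_inner \<mu> (E i) (e \<nu>' j' h') = 0" if "i \<in> level {0} {j'}" for i
    using that assms by (auto simp: level_def inner_e)
  show "L2_fun \<mu> (e \<nu> j h)" "L2_fun \<mu> (e \<nu>' j' h')"
    by (rule L2_e; rule assms)+
qed (rule L2_E)

lemma orthonormal_wavelets: "orthonormal_system \<mu> (level {1..} UNIV) E"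
  unfolding orthonormal_system_def
proof (intro conjI ballI)
  fix i i' assume "i \<in> level {1..} UNIV" "i' \<in> level {1..} UNIV"
  then obtain \<nu> j h \<nu>' j' h' where i: "i = (\<nu>, j, h)" "0 < \<nu>" "\<nu> < abs_det M" "h \<in> vlattice M s"
    "i' = (\<nu>', j', h')" "0 < \<nu>'" "\<nu>' < abs_det M" "h' \<in> vlattice M s"
    by (auto simp: level_def)
  consider "j < j'" | "j = j'" | "j' < j" by linarith
  then show "L2_inner \<mu> (E i) (E i') = (if i = i' then 1 else 0)"
  proof cases
    case 1
    then show ?thesis using i by (simp add: inner_e_finer)
  next
    case 2
    then show ?thesis using i by (simp add: inner_e)
  next
    case 3
    then show ?thesis using i inner_e_finer[of \<nu>' h' \<nu> h j' j] L2_inner_commute[of \<mu> "e \<nu> j h" "e \<nu>' j' h'"]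
      by simp
  qed
qed (rule L2_E)

end

section \<open>Completeness\<close>

lemma L2_span_mono: "L2_span \<mu> I e f \<Longrightarrow> I \<subseteq> J \<Longrightarrow> L2_span \<mu> J e f"
  unfolding L2_span_def by (meson subset_trans)

text \<open>The coefficients of a finite orthonormal expansion are inner products, so Bessel's
  defect vanishes.\<close>

lemma L2_span_nrm:
  assumes on: "orthonormal_system \<mu> I e" and f: "L2_span \<mu> I e f" "L2_fun \<mu> f"
  obtains F where "finite F" "F \<subseteq> I" "(L2_nrm \<mu> f)\<^sup>2 = (\<Sum>i\<in>F. (cmod (L2_inner \<mu> f (e i)))\<^sup>2)"
proof -
  obtain F c where F: "finite F" "F \<subseteq> I" "AE x in \<mu>. f x = (\<Sum>i\<in>F. c i * e i x)"
    using f(1) unfolding L2_span_def by blast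
  have e: "L2_fun \<mu> (e i)" if "i \<in> F" for i
    using on F(2) that unfolding orthonormal_system_def by blast
  have S: "L2_fun \<mu> (\<lambda>x. \<Sum>i\<in>F. c i * e i x)" using e by (rule L2_fun_lin)
  have c: "L2_inner \<mu> f (e i) = c i" if "i \<in> F" for i
  proof -
    have "L2_inner \<mu> f (e i) = L2_inner \<mu> (\<lambda>x. \<Sum>i\<in>F. c i * e i x) (e i)"
      by (intro L2_inner_cong_AE F(3) AE_I2 refl f(2) S e that)
    also have "\<dots> = (\<Sum>k\<in>F. c k * L2_inner \<mu> (e k) (e i))"
      by (rule L2_inner_lin_left) (use e that in auto)
    also have "\<dots> = (\<Sum>k\<in>F. if k = i then c k else 0)"
    proof (intro sum.cong refl)
      fix k assume "k \<in> F"
      then have "L2_inner \<mu> (e k) (e i) = (if k = i then 1 else 0)"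
        using on F(2) that unfolding orthonormal_system_def by blast
      then show "c k * L2_inner \<mu> (e k) (e i) = (if k = i then c k else 0)" by simp
    qed
    also have "\<dots> = c i" using F(1) that by simp
    finally show ?thesis .
  qed
  have "orthonormal_system \<mu> F e"
    using on F(2) unfolding orthonormal_system_def by blast
  note L2_nrm_orthonormal_expansion[OF f(2) F(1) this]
  moreover have "L2_nrm \<mu> (\<lambda>x. f x - (\<Sum>i\<in>F. L2_inner \<mu> f (e i) * e i x)) = 0"
  proof (subst L2_nrm_eq_0_iff)
    show "L2_fun \<mu> (\<lambda>x. f x - (\<Sum>i\<in>F. L2_inner \<mu> f (e i) * e i x))"
      using e by (intro L2_fun_diff f(2) L2_fun_lin)
    show "AE x in \<mu>. f x - (\<Sum>i\<in>F. L2_inner \<mu> f (e i) * e i x) = 0"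
      using F(3) by eventually_elim (simp add: c)
  qed
  ultimately have "(L2_nrm \<mu> f)\<^sup>2 = (\<Sum>i\<in>F. (cmod (L2_inner \<mu> f (e i)))\<^sup>2)" by simp
  with F(1,2) show thesis by (rule that)
qed

lemma orthonormal_basis_cong:
  assumes "orthonormal_basis \<mu> I e" and eq: "\<And>i. i \<in> I \<Longrightarrow> e' i = e i"
  shows "orthonormal_basis \<mu> I e'"
  unfolding orthonormal_basis_def
proof (intro conjI allI impI)
  show "orthonormal_system \<mu> I e'"
    using assms(1) unfolding orthonormal_basis_def orthonormal_system_def by (simp add: eq)
  fix f and \<epsilon> :: real assume "L2_fun \<mu> f" "0 < \<epsilon>"
  then obtain F c where F: "finite F" "F \<subseteq> I" "L2_nrm \<mu> (\<lambda>x. f x - (\<Sum>i\<in>F. c i * e i x)) < \<epsilon>"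
    using assms(1) unfolding orthonormal_basis_def by blast
  have "(\<Sum>i\<in>F. c i * e' i x) = (\<Sum>i\<in>F. c i * e i x)" for x
  proof (intro sum.cong refl)
    fix i assume "i \<in> F"
    then have "e' i = e i" using F(2) by (intro eq) blast
    then show "c i * e' i x = c i * e i x" by simp
  qed
  then show "\<exists>F c. finite F \<and> F \<subseteq> I \<and> L2_nrm \<mu> (\<lambda>x. f x - (\<Sum>i\<in>F. c i * e' i x)) < \<epsilon>"
    using F by (intro exI[of _ F] exI[of _ c]) simp
qed

context vilenkin_measure
begin

lemma L2_nrm_indicator_cyl:
  assumes "x \<in> V" shows "(L2_nrm \<mu> (indicator (cyl x l)))\<^sup>2 = m powi (- l)"
proof -
  have "(\<lambda>y. (cmod (indicator (cyl x l) y))\<^sup>2) = indicat_real (cyl x l)"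
    by (auto simp: indicator_def fun_eq_iff)
  moreover have "cyl x l \<inter> V = cyl x l" using cyl_V by blast
  ultimately show ?thesis using assms by (simp add: L2_nrm_squared measure_cyl)
qed

lemma AE_not_point:
  assumes "h \<in> V" shows "AE x in \<mu>. x \<noteq> h"
proof -
  have "(\<Inter>n. cyl h (int n)) = {h}"
  proof (intro set_eqI iffI)
    fix x assume x: "x \<in> (\<Inter>n. cyl h (int n))"
    have "x j = h j" for j
    proof -
      have "x \<in> cyl h (int (nat j))" using x by blast
      then show ?thesis by (simp add: cyl_def)
    qed
    then show "x \<in> {h}" by (simp add: fun_eq_iff)
  qed (use assms in auto)
  moreover have "(\<Inter>n. cyl h (int n)) \<in> sets \<mu>" by (rule sets.countable_INT) auto
  ultimately have "{h} \<in> null_sets \<mu>" using emeasure_point[OF assms] by (simp add: null_sets_def)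
  from AE_not_in[OF this] show ?thesis by simp
qed

end

context wavelet_system
begin

text \<open>The orthonormal translates of \<open>\<Psi> 0\<close> supported in a large ball number exactly the measure
  of the ball, and each has inner product \<open>1\<close> with its indicator; hence the expansion of the
  indicator along them has error \<open>0\<close>.\<close>

lemma indicator_cyl_span:
  assumes x0: "x0 \<in> V"
  shows "L2_span \<mu> (level {0} {l + int N}) E (indicator (cyl x0 l))"
proof -
  \<comment> \<open>\<open>N\<close> levels beyond \<open>l\<close>, the dilated support ball of
    each translate is a ball of level \<open>l\<close>.\<close>
  define J where "J = l + int N"
  \<comment> \<open>The part of the rescaled centre lying in \<open>H\<close>. Subtracting it from
    \<open>vfin (- int N) 0\<close> gives translations that bring the support into the ball.\<close>
  define h0 where "h0 = (\<lambda>j. if j \<le> 0 then vshift J x0 j else 0)"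
  define S where "S = (\<lambda>u. u \<oplus> vneg h0) ` vfin (- int N) 0"
  have y0: "vshift J x0 \<in> V" using x0 by simp
  have h0: "h0 \<in> vlattice M s"
    using y0 by (auto simp: vlattice_def V_iff h0_def)
  have vl: "u \<in> vlattice M s" if "u \<in> vfin (- int N) 0" for u
    using that vlattice_eq_Union_vfin by blast
  have S: "finite S" "S \<subseteq> vlattice M s"
    unfolding S_def using vl h0 by auto
  have "inj_on (\<lambda>u. u \<oplus> vneg h0) (vfin (- int N) 0)"
    using h0 by (intro inj_onI) (simp add: add_right_cancel vfin_V vlattice_V)
  then have card_S: "card S = abs_det M ^ N"
    unfolding S_def by (simp add: card_image card_vfin)
  let ?f = "indicator (cyl x0 l) :: _ \<Rightarrow> complex"
  have supp: "x \<in> cyl x0 l" if x: "x \<in> V" and h: "h \<in> S" and ne: "e 0 J h x \<noteq> 0" for x h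
  proof -
    have hV: "h \<in> V" using S(2) h vlattice_V by blast
    have "vshift J x \<oplus> h \<in> cyl vzero (- int N)"
      using ne x hV by (intro support_\<Psi>) (auto simp: e_def)
    then have "x \<in> cyl (vshift (- J) (vzero \<oplus> vneg h)) (- int N + J)"
      using affine_cyl_iff[OF x vzero_V hV] by simp
    moreover have "- int N + J = l" by (simp add: J_def)
    ultimately have eq: "x i = vneg h (i - J)" if "i \<le> l" for i
      using that hV by (simp add: cyl_def vshift_def)
    obtain u where u: "u \<in> vfin (- int N) 0" "h = u \<oplus> vneg h0" using h by (auto simp: S_def)
    have "vneg h (i - J) = x0 i" if "i \<le> l" for i
    proof -
      have "i - J \<le> - int N" using that by (simp add: J_def)
      then have "u (i - J) = 0" "h0 (i - J) = x0 i"
        using u(1) by (auto simp: vfin_def h0_def vshift_def)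
      then show ?thesis using V_digit[OF x0, of i] by (simp add: u(2) vneg_def vadd_def)
    qed
    then show ?thesis using x eq by (simp add: cyl_def)
  qed
  have inner: "L2_inner \<mu> ?f (e 0 J h) = of_real (rt J * m powi (- J))" if h: "h \<in> S" for h
  proof -
    have hV: "h \<in> V" using S(2) h vlattice_V by blast
    have "L2_inner \<mu> ?f (e 0 J h) = (LINT x|\<mu>. cnj (e 0 J h x))"
      unfolding L2_inner_def
      by (intro Bochner_Integration.integral_cong refl) (use supp[OF _ h] in \<open>auto simp: indicator_def\<close>)
    also have "\<dots> = cnj (of_real (rt J) * (LINT x|\<mu>. \<Psi> 0 (vshift J x \<oplus> h)))"
      by (simp add: e_def)
    also have "(LINT x|\<mu>. \<Psi> 0 (vshift J x \<oplus> h)) = of_real (m powi (- J))"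
      unfolding integral_affine[OF hV L2_fun_borel[OF L2_\<Psi>[OF abs_det_pos]]] integral_\<Psi>
      by (simp add: scaleR_conv_of_real)
    finally show ?thesis by (simp only: complex_cnj_mult complex_cnj_complex_of_real of_real_mult)
  qed
  have on: "orthonormal_system \<mu> S (e 0 J)"
    unfolding orthonormal_system_def using S(2) abs_det_pos by (auto simp: inner_e0 subset_iff intro!: L2_e)
  have "(L2_nrm \<mu> (\<lambda>x. ?f x - (\<Sum>h\<in>S. L2_inner \<mu> ?f (e 0 J h) * e 0 J h x)))\<^sup>2
      = m powi (- l) - (\<Sum>h\<in>S. (cmod (L2_inner \<mu> ?f (e 0 J h)))\<^sup>2)"
    unfolding L2_nrm_orthonormal_expansion[OF L2_fun_cyl[OF x0] S(1) on] L2_nrm_indicator_cyl[OF x0] ..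
  also have "(\<Sum>h\<in>S. (cmod (L2_inner \<mu> ?f (e 0 J h)))\<^sup>2) = (\<Sum>h\<in>S. (rt J * m powi (- J))\<^sup>2)"
    by (intro sum.cong refl) (simp add: inner power2_eq_square flip: of_real_mult)
  also have "\<dots> = m ^ N * (rt J * m powi (- J))\<^sup>2" by (simp add: card_S)
  also have "\<dots> = m powi (- l)"
  proof -
    \<comment> \<open>Each squared coefficient is \<open>m powi (- J)\<close>; by the choice of
      \<open>J\<close>, \<open>m ^ N\<close> of them add up to the measure of the ball.\<close>
    have "(rt J * m powi (- J))\<^sup>2 = m powi J * m powi (- J) * m powi (- J)"
      using rt_squared[of J] by (simp add: power2_eq_square mult_ac)
    also have "\<dots> = m powi (- J)" using m_pos by (simp add: power_int_minus)
    finally have "m ^ N * (rt J * m powi (- J))\<^sup>2 = m powi (int N) * m powi (- J)" by simp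
    also have "\<dots> = m powi (- l)"
      using m_pos by (subst power_int_add[symmetric]) (simp_all add: J_def)
    finally show ?thesis .
  qed
  finally have "L2_nrm \<mu> (\<lambda>x. ?f x - (\<Sum>h\<in>S. L2_inner \<mu> ?f (e 0 J h) * e 0 J h x)) = 0" by simp
  moreover have "L2_fun \<mu> (\<lambda>x. ?f x - (\<Sum>h\<in>S. L2_inner \<mu> ?f (e 0 J h) * e 0 J h x))"
    using S(2) by (intro L2_fun_diff L2_fun_cyl x0 L2_fun_lin L2_e abs_det_pos) blast
  ultimately have "AE x in \<mu>. ?f x - (\<Sum>h\<in>S. L2_inner \<mu> ?f (e 0 J h) * e 0 J h x) = 0"
    using L2_nrm_eq_0_iff by blast
  then have AE: "AE x in \<mu>. ?f x = (\<Sum>h\<in>S. L2_inner \<mu> ?f (e 0 J h) * e 0 J h x)" by simp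
  show ?thesis
  proof (rule L2_span_cong[OF L2_span_sum AE])
    fix h assume "h \<in> S"
    then have "(0, J, h) \<in> level {0} {l + int N}" using S(2) abs_det_pos by (auto simp: level_def J_def)
    from L2_span_base[OF this, of \<mu> E] show "L2_span \<mu> (level {0} {l + int N}) E (e 0 J h)" by simp
  qed
qed

text \<open>For \<open>x\<close> in \<open>B\<close> the rescaled point has no digits up to index
  \<open>- int N\<close>, so the support of \<open>\<Psi> 0\<close> forces the same on
  \<open>h\<close>. At most \<open>abs_det M ^ N\<close> translates survive, whatever
  \<open>K\<close> is.\<close>

lemma inner_indicator_zero:
  assumes B: "B \<subseteq> cyl vzero (- R)" and h: "h \<in> vlattice M s" "h \<notin> vfin (- int N) 0" and K: "R \<le> K"
  shows "L2_inner \<mu> (indicator B) (e 0 (- K) h) = 0"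
proof -
  have "indicator B x * cnj (e 0 (- K) h x) = 0" if x: "x \<in> V" for x
  proof (rule ccontr)
    assume ne: "indicator B x * cnj (e 0 (- K) h x) \<noteq> 0"
    then have "x \<in> B" by (simp add: indicator_def split: if_splits)
    then have x0: "x i = 0" if "i \<le> - R" for i using B that by (auto simp: cyl_def vzero_def)
    have hV: "h \<in> V" using h(1) by (rule vlattice_V)
    have "\<Psi> 0 (vshift (- K) x \<oplus> h) \<noteq> 0" using ne by (simp add: e_def)
    then have c: "vshift (- K) x \<oplus> h \<in> cyl vzero (- int N)"
      using x hV by (intro support_\<Psi>) auto
    have "h i = 0" if "i \<le> - int N" for i
    proof -
      have "x (i - K) = 0" using that K by (intro x0) simp
      moreover have "D (x (i - K) + h i) = 0"
        using c that by (simp add: cyl_def vzero_def vadd_def vshift_def)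
      ultimately show ?thesis using V_digit[OF hV, of i] by simp
    qed
    then have "h \<in> vfin (- int N) 0" using h(1) by (auto simp: vfin_def vlattice_def)
    then show False using h(2) by simp
  qed
  then have "L2_inner \<mu> (indicator B) (e 0 (- K) h) = (LINT x|\<mu>. 0)"
    unfolding L2_inner_def by (intro Bochner_Integration.integral_cong refl) simp
  then show ?thesis by simp
qed

text \<open>The normalisation cancels the Jacobian, so scaling itself gives no decay. Decay comes
  from \<open>C K\<close>, the image of the fixed ball \<open>U\<close>, which shrinks to the null
  set \<open>{h}\<close>.\<close>

lemma inner_indicator_tendsto:
  assumes x0: "x0 \<in> V" and B: "cyl x0 l \<subseteq> cyl vzero (- R)" and h: "h \<in> vlattice M s"
  shows "(\<lambda>K. L2_inner \<mu> (indicator (cyl x0 l)) (e 0 (- int K) h)) \<longlonglongrightarrow> 0"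
proof -
  have hV: "h \<in> V" using h by (rule vlattice_V)
  define C where "C K = cyl h (int K - R)" for K
  define U where "U = cyl vzero (- R)"
  have L2: "L2_fun \<mu> (\<Psi> 0)" by (rule L2_\<Psi>[OF abs_det_pos])
  have "(\<lambda>K. LINT y|\<mu>. indicator (C K) y * (cmod (\<Psi> 0 y))\<^sup>2) \<longlonglongrightarrow> (LINT y|\<mu>. 0)"
  proof (rule integral_dominated_convergence[where w = "\<lambda>y. (cmod (\<Psi> 0 y))\<^sup>2"])
    show "(\<lambda>y. indicator (C K) y * (cmod (\<Psi> 0 y))\<^sup>2) \<in> borel_measurable \<mu>" for K
      using L2_fun_borel[OF L2] by (simp add: C_def)
    show "AE y in \<mu>. norm (indicator (C K) y * (cmod (\<Psi> 0 y))\<^sup>2) \<le> (cmod (\<Psi> 0 y))\<^sup>2" for K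
      by (intro AE_I2) (simp add: indicator_def)
    show "AE y in \<mu>. (\<lambda>K. indicator (C K) y * (cmod (\<Psi> 0 y))\<^sup>2) \<longlonglongrightarrow> 0"
      using AE_not_point[OF hV]
    proof eventually_elim
      case (elim y)
      then obtain i where i: "y i \<noteq> h i" by auto
      have "\<forall>\<^sub>F K in sequentially. indicator (C K) y * (cmod (\<Psi> 0 y))\<^sup>2 = 0"
        unfolding eventually_sequentially
      proof (intro exI allI impI)
        fix K assume "nat (i + R) \<le> K"
        then have "i \<le> int K - R" by linarith
        then have "y \<notin> C K" using i by (auto simp: C_def cyl_def)
        then show "indicator (C K) y * (cmod (\<Psi> 0 y))\<^sup>2 = 0" by simp
      qed
      then show ?case by (rule tendsto_eventually)
    qed
  qed (use L2 in \<open>simp_all add: L2_fun_integrable\<close>)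
  then have lim: "(\<lambda>K. LINT y|\<mu>. indicator (C K) y * (cmod (\<Psi> 0 y))\<^sup>2) \<longlonglongrightarrow> 0" by simp
  have bound: "norm (L2_inner \<mu> (indicator (cyl x0 l)) (e 0 (- int K) h))
      \<le> L2_nrm \<mu> (indicator (cyl x0 l)) * sqrt (LINT y|\<mu>. indicator (C K) y * (cmod (\<Psi> 0 y))\<^sup>2)" for K
  proof -
    let ?u = "\<lambda>x. indicator U x * e 0 (- int K) h x"
    have e: "L2_fun \<mu> (e 0 (- int K) h)" by (rule L2_e[OF abs_det_pos h])
    have u: "L2_fun \<mu> ?u"
    proof (rule L2_funI_bounded[OF _ L2_fun_integrable[OF e]])
      show "?u \<in> borel_measurable \<mu>" using L2_fun_borel[OF e] by (simp add: U_def)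
    qed (simp add: indicator_def)
    have "L2_inner \<mu> (indicator (cyl x0 l)) (e 0 (- int K) h) = L2_inner \<mu> (indicator (cyl x0 l)) ?u"
      unfolding L2_inner_def
      by (intro Bochner_Integration.integral_cong refl) (use B in \<open>auto simp: indicator_def U_def\<close>)
    also have "norm \<dots> \<le> L2_nrm \<mu> (indicator (cyl x0 l)) * L2_nrm \<mu> ?u"
      by (rule L2_Cauchy_Schwarz[OF L2_fun_cyl[OF x0] u])
    also have "L2_nrm \<mu> ?u = sqrt (LINT y|\<mu>. indicator (C K) y * (cmod (\<Psi> 0 y))\<^sup>2)"
    proof -
      let ?G = "\<lambda>y. indicator (C K) y * (cmod (\<Psi> 0 y))\<^sup>2"
      have "(cmod (?u x))\<^sup>2 = (rt (- int K) * rt (- int K)) * ?G (vshift (- int K) x \<oplus> h)" if x: "x \<in> V" for x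
      proof -
        have "vshift (- int K) x \<oplus> h \<in> C K \<longleftrightarrow> x \<in> U"
          using affine_cyl_iff[OF x hV hV, of "- int K" "int K - R"] by (simp add: C_def U_def)
        then show ?thesis
          by (simp add: indicator_def e_def norm_mult power_mult_distrib power2_eq_square)
      qed
      then have "(LINT x|\<mu>. (cmod (?u x))\<^sup>2)
          = (LINT x|\<mu>. (rt (- int K) * rt (- int K)) * ?G (vshift (- int K) x \<oplus> h))"
        by (intro Bochner_Integration.integral_cong) auto
      also have "\<dots> = (rt (- int K) * rt (- int K)) * (m powi (- (- int K)) *\<^sub>R (LINT y|\<mu>. ?G y))"
      proof -
        have "?G \<in> borel_measurable \<mu>" using L2_fun_borel[OF L2] by (simp add: C_def)
        from integral_affine[OF hV this, of "- int K"] show ?thesis by simp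
      qed
      also have "\<dots> = (LINT y|\<mu>. ?G y)"
        using m_pos by (simp add: rt_squared power_int_minus)
      finally show ?thesis by (simp add: L2_nrm_def)
    qed
    finally show ?thesis .
  qed
  have "(\<lambda>K. L2_nrm \<mu> (indicator (cyl x0 l)) * sqrt (LINT y|\<mu>. indicator (C K) y * (cmod (\<Psi> 0 y))\<^sup>2))
      \<longlonglongrightarrow> L2_nrm \<mu> (indicator (cyl x0 l)) * sqrt 0"
    by (intro tendsto_mult_left tendsto_real_sqrt lim)
  then have "(\<lambda>K. L2_nrm \<mu> (indicator (cyl x0 l)) * sqrt (LINT y|\<mu>. indicator (C K) y * (cmod (\<Psi> 0 y))\<^sup>2))
      \<longlonglongrightarrow> 0" by simp
  then show ?thesis
    by (rule Lim_null_comparison[rotated]) (use bound in simp)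
qed

text \<open>Each step splits the coarse part into wavelets one level down and a coarser remainder.
  Existence of a finite splitting suffices.\<close>

lemma multiresolution_decomposition:
  assumes f: "L2_span \<mu> (level {0} {j}) E f" "L2_fun \<mu> f"
  shows "\<exists>w g. L2_fun \<mu> w \<and> L2_fun \<mu> g \<and> L2_span \<mu> (level {1..} {j - int n..}) E w \<and>
    L2_span \<mu> (level {0} {j - int n}) E g \<and> (AE x in \<mu>. f x = w x + g x)"
proof (induction n)
  case 0
  show ?case
    by (rule exI[of _ "\<lambda>x. 0"], rule exI[of _ f]) (use f in \<open>simp add: L2_fun_zero L2_span_zero\<close>)
next
  case (Suc n)
  then obtain w g where IH: "L2_fun \<mu> w" "L2_fun \<mu> g" "L2_span \<mu> (level {1..} {j - int n..}) E w"
    "L2_span \<mu> (level {0} {j - int n}) E g" "AE x in \<mu>. f x = w x + g x" by blast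
  let ?j = "j - int (Suc n)"
  have "L2_span \<mu> (level UNIV {?j}) E g"
  proof (rule L2_span_trans[OF IH(4)])
    fix i assume "i \<in> level {0} {j - int n}"
    then obtain u where "i = (0, j - int n, u)" "u \<in> vlattice M s" by (auto simp: level_def)
    then show "L2_span \<mu> (level UNIV {?j}) E (E i)"
      using e_span_coarser[of u ?j] by simp
  qed
  moreover have "level UNIV {?j} = level {1..} {?j} \<union> level {0} {?j}"
    by (auto simp: level_def)
  ultimately have "L2_span \<mu> (level {1..} {?j} \<union> level {0} {?j}) E g" by simp
  moreover have "L2_fun \<mu> (E i)" if "i \<in> level {1..} {?j} \<union> level {0} {?j}" for i
    using that L2_E by blast
  ultimately obtain g1 g2 where g: "L2_span \<mu> (level {1..} {?j}) E g1" "L2_fun \<mu> g1"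
    "L2_span \<mu> (level {0} {?j}) E g2" "L2_fun \<mu> g2" "AE x in \<mu>. g x = g1 x + g2 x"
    by (rule L2_span_Un_split)
  have "L2_span \<mu> (level {1..} {?j..}) E (\<lambda>x. w x + g1 x)"
    by (intro L2_span_add L2_span_mono[OF IH(3)] L2_span_mono[OF g(1)]) (auto simp: level_def)
  moreover have "AE x in \<mu>. f x = (w x + g1 x) + g2 x"
    using IH(5) g(5) by eventually_elim simp
  ultimately show ?case
    using L2_fun_add[OF IH(1) g(2)] g(3,4) by blast
qed

lemma inner_wavelet_span_zero:
  assumes w: "L2_span \<mu> (level {1..} {j..}) E w" "L2_fun \<mu> w" and h: "h \<in> vlattice M s"
  shows "L2_inner \<mu> w (e 0 j h) = 0"
proof (rule L2_span_orthogonal[OF w(1,2) L2_e[OF abs_det_pos h] L2_E])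
  fix i assume "i \<in> level {1..} {j..}"
  then obtain \<nu> k h' where i: "i = (\<nu>, k, h')" "0 < \<nu>" "\<nu> < abs_det M" "j \<le> k" "h' \<in> vlattice M s"
    by (auto simp: level_def)
  show "L2_inner \<mu> (E i) (e 0 j h) = 0"
  proof (cases "k = j")
    case True
    then show ?thesis using i h abs_det_pos by (simp add: inner_e)
  next
    case False
    then show ?thesis
      using i inner_e_finer[OF abs_det_pos h i(2,3,5), of j k] L2_inner_commute[of \<mu> "e \<nu> k h'" "e 0 j h"]
      by simp
  qed
qed

lemma orthonormal_level_0: "orthonormal_system \<mu> (level {0} {j}) E"
  unfolding orthonormal_system_def
proof (intro conjI ballI)
  fix i i' assume "i \<in> level {0} {j}" "i' \<in> level {0} {j}"
  then show "L2_inner \<mu> (E i) (E i') = (if i = i' then 1 else 0)"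
    by (auto simp: level_def inner_e0 split: if_splits)
qed (rule L2_E)

text \<open>The error is the coarse part \<open>g\<close>. Its coefficients are those of the
  indicator, by orthogonality to the wavelet part, and only those with \<open>h\<close> in
  \<open>?Q\<close>, a set independent of the scale, can be nonzero.\<close>

lemma indicator_cyl_approx:
  assumes x0: "x0 \<in> V" and \<epsilon>: "0 < \<epsilon>"
  shows "\<exists>w. L2_fun \<mu> w \<and> L2_span \<mu> (level {1..} UNIV) E w \<and> L2_nrm \<mu> (\<lambda>x. indicator (cyl x0 l) x - w x) < \<epsilon>"
proof -
  let ?f = "indicator (cyl x0 l) :: _ \<Rightarrow> complex"
  define J where "J = l + int N"
  obtain R where R: "max 0 (- l) \<le> R" "\<forall>j\<le>- R. x0 j = 0" using V_lower[OF x0] by blast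
  have B: "cyl x0 l \<subseteq> cyl vzero (- R)"
    using R by (auto simp: cyl_def vzero_def)
  let ?Q = "vfin (- int N) 0"
  have Q: "h \<in> vlattice M s" if "h \<in> ?Q" for h using that vlattice_eq_Union_vfin by blast
  define q where "q K = (\<Sum>h\<in>?Q. (cmod (L2_inner \<mu> ?f (e 0 (- int K) h)))\<^sup>2)" for K
  have "q \<longlonglongrightarrow> (\<Sum>h\<in>?Q. (cmod 0)\<^sup>2)"
    unfolding q_def by (intro tendsto_sum tendsto_power tendsto_norm inner_indicator_tendsto[OF x0 B] Q)
  then have "q \<longlonglongrightarrow> 0" by simp
  moreover have "0 < \<epsilon>\<^sup>2" using \<epsilon> by simp
  ultimately have "\<forall>\<^sub>F K in sequentially. q K < \<epsilon>\<^sup>2" by (rule order_tendstoD(2))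
  then obtain K0 where K0: "\<And>K. K0 \<le> K \<Longrightarrow> q K < \<epsilon>\<^sup>2" by (auto simp: eventually_sequentially)
  \<comment> \<open>\<open>K0\<close> makes \<open>q\<close> small, \<open>R\<close> confines the
    coefficients to \<open>?Q\<close>, and \<open>- J\<close> keeps the number of decomposition
    steps nonnegative.\<close>
  define K where "K = max K0 (nat (max R (- J)))"
  have K: "q K < \<epsilon>\<^sup>2" "R \<le> int K" "- J \<le> int K" using K0[of K] by (auto simp: K_def)
  define n where "n = nat (J + int K)"
  have n: "J - int n = - int K" using K(3) by (simp add: n_def)
  obtain w g where wg: "L2_fun \<mu> w" "L2_fun \<mu> g" "L2_span \<mu> (level {1..} {- int K..}) E w"
    "L2_span \<mu> (level {0} {- int K}) E g" "AE x in \<mu>. ?f x = w x + g x"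
    using multiresolution_decomposition[OF indicator_cyl_span[OF x0] L2_fun_cyl[OF x0], of l n]
    unfolding J_def[symmetric] n by (elim exE conjE)
  obtain F where F: "finite F" "F \<subseteq> level {0} {- int K}"
    "(L2_nrm \<mu> g)\<^sup>2 = (\<Sum>i\<in>F. (cmod (L2_inner \<mu> g (E i)))\<^sup>2)"
    using L2_span_nrm[OF orthonormal_level_0 wg(4,2)] by blast
  let ?I = "(\<lambda>h. (0, - int K, h)) ` ?Q"
  have gi: "L2_inner \<mu> g (E i) = L2_inner \<mu> ?f (E i)" if iF: "i \<in> F" for i
  proof -
    obtain h where i: "i = (0, - int K, h)" "h \<in> vlattice M s" using F(2) iF by (auto simp: level_def)
    have e: "L2_fun \<mu> (e 0 (- int K) h)" by (rule L2_e[OF abs_det_pos i(2)])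
    have "L2_inner \<mu> ?f (E i) = L2_inner \<mu> (\<lambda>x. w x + g x) (e 0 (- int K) h)"
      using i(1) by (simp, intro L2_inner_cong_AE wg(5) AE_I2 refl L2_fun_cyl[OF x0] L2_fun_add[OF wg(1,2)] e)
    also have "\<dots> = L2_inner \<mu> g (e 0 (- int K) h)"
      using wg(1,2) e inner_wavelet_span_zero[OF wg(3,1) i(2)] by (simp add: L2_inner_add_left)
    finally show ?thesis using i(1) by simp
  qed
  have zero: "L2_inner \<mu> ?f (E i) = 0" if iF: "i \<in> F - ?I" for i
  proof -
    obtain h where i: "i = (0, - int K, h)" "h \<in> vlattice M s" using F(2) iF by (auto simp: level_def)
    then have "h \<notin> ?Q" using iF by auto
    then show ?thesis using inner_indicator_zero[OF B i(2) _ K(2)] i(1) by simp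
  qed
  have "(L2_nrm \<mu> g)\<^sup>2 = (\<Sum>i\<in>F. (cmod (L2_inner \<mu> ?f (E i)))\<^sup>2)"
    unfolding F(3) by (intro sum.cong refl) (simp only: gi)
  also have "\<dots> = (\<Sum>i\<in>F \<inter> ?I. (cmod (L2_inner \<mu> ?f (E i)))\<^sup>2)"
    using F(1) zero by (intro sum.mono_neutral_right) auto
  also have "\<dots> \<le> (\<Sum>i\<in>?I. (cmod (L2_inner \<mu> ?f (E i)))\<^sup>2)"
    by (intro sum_mono2) auto
  also have "\<dots> = q K"
    unfolding q_def by (subst sum.reindex) (auto simp: inj_on_def)
  finally have "(L2_nrm \<mu> g)\<^sup>2 < \<epsilon>\<^sup>2" using K(1) by linarith
  then have "L2_nrm \<mu> g < \<epsilon>" using \<epsilon> by (simp add: power_less_imp_less_base)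
  moreover have "L2_nrm \<mu> (\<lambda>x. ?f x - w x) = L2_nrm \<mu> g"
  proof (rule L2_nrm_cong_AE)
    show "AE x in \<mu>. ?f x - w x = g x" using wg(5) by eventually_elim simp
    show "(\<lambda>x. ?f x - w x) \<in> borel_measurable \<mu>"
      by (rule L2_fun_borel[OF L2_fun_diff[OF L2_fun_cyl[OF x0] wg(1)]])
    show "g \<in> borel_measurable \<mu>" by (rule L2_fun_borel[OF wg(2)])
  qed
  moreover have "L2_span \<mu> (level {1..} UNIV) E w"
    by (rule L2_span_mono[OF wg(3)]) (auto simp: level_def)
  ultimately show ?thesis using wg(1) by auto
qed

lemma wavelets_dense:
  assumes "L2_fun \<mu> f" "0 < \<epsilon>"
  shows "\<exists>w. L2_fun \<mu> w \<and> L2_span \<mu> (level {1..} UNIV) E w \<and> L2_nrm \<mu> (\<lambda>x. f x - w x) < \<epsilon>"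
  using assms
proof (induction f arbitrary: \<epsilon> rule: L2_induct_cyl)
  case (cyl x l)
  then show ?case by (rule indicator_cyl_approx)
next
  case (add f g)
  have "0 < \<epsilon> / 2" using add.prems by simp
  then obtain v w where v: "L2_fun \<mu> v" "L2_span \<mu> (level {1..} UNIV) E v" "L2_nrm \<mu> (\<lambda>x. f x - v x) < \<epsilon> / 2"
    and w: "L2_fun \<mu> w" "L2_span \<mu> (level {1..} UNIV) E w" "L2_nrm \<mu> (\<lambda>x. g x - w x) < \<epsilon> / 2"
    using add(3,4) by meson
  have "L2_nrm \<mu> (\<lambda>x. (f x - v x) + (g x - w x)) \<le> L2_nrm \<mu> (\<lambda>x. f x - v x) + L2_nrm \<mu> (\<lambda>x. g x - w x)"
    by (intro L2_nrm_triangle L2_fun_diff add(1,2) v(1) w(1))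
  then have "L2_nrm \<mu> (\<lambda>x. (f x + g x) - (v x + w x)) < \<epsilon>"
    using v(3) w(3) by (simp add: algebra_simps)
  then show ?case using L2_fun_add[OF v(1) w(1)] L2_span_add[OF v(2) w(2)] by blast
next
  case (cmult c f)
  \<comment> \<open>Adding 1 covers the multiple \<open>c = 0\<close>.\<close>
  have pos: "0 < cmod c + 1" by (simp add: add_nonneg_pos)
  then obtain w where w: "L2_fun \<mu> w" "L2_span \<mu> (level {1..} UNIV) E w"
    "L2_nrm \<mu> (\<lambda>x. f x - w x) < \<epsilon> / (cmod c + 1)"
    using cmult(2)[of "\<epsilon> / (cmod c + 1)"] cmult.prems by auto
  have "L2_nrm \<mu> (\<lambda>x. c * f x - c * w x) = cmod c * L2_nrm \<mu> (\<lambda>x. f x - w x)"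
    unfolding right_diff_distrib[symmetric] by (rule L2_nrm_cmult)
  also have "\<dots> \<le> cmod c * (\<epsilon> / (cmod c + 1))" using w(3) by (intro mult_left_mono) auto
  also have "\<dots> < \<epsilon>" using pos cmult.prems by (simp add: field_simps)
  finally show ?case using L2_fun_cmult[OF w(1), of c] L2_span_cmult[OF w(2), of c] by blast
next
  case (lim f)
  have half: "0 < \<epsilon> / 2" using lim.prems by simp
  obtain g where g: "L2_fun \<mu> g" "L2_nrm \<mu> (\<lambda>x. f x - g x) < \<epsilon> / 2"
    "\<And>\<epsilon>. 0 < \<epsilon> \<Longrightarrow> \<exists>w. L2_fun \<mu> w \<and> L2_span \<mu> (level {1..} UNIV) E w \<and> L2_nrm \<mu> (\<lambda>x. g x - w x) < \<epsilon>"
    using lim(2)[OF half] by blast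
  obtain w where w: "L2_fun \<mu> w" "L2_span \<mu> (level {1..} UNIV) E w" "L2_nrm \<mu> (\<lambda>x. g x - w x) < \<epsilon> / 2"
    using g(3)[OF half] by blast
  have "L2_nrm \<mu> (\<lambda>x. f x - w x) < \<epsilon>"
    using L2_nrm_triangle_diff[OF lim(1) g(1) w(1)] g(2) w(3) by linarith
  then show ?case using w by blast
qed

text \<open>The bijection \<open>vgamma\<close> carries the indexing by \<open>H\<close> over to the
  indexing by natural numbers.\<close>

theorem orthonormal_basis_wavelets:
  "orthonormal_basis \<mu> ({1..<abs_det M} \<times> (UNIV :: int set) \<times> (UNIV :: nat set))
    (\<lambda>(\<nu>, j, k). wavelet M s (\<Psi> \<nu>) j k)"
proof -
  let ?I = "{1..<abs_det M} \<times> (UNIV :: int set) \<times> (UNIV :: nat set)"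
  let ?W = "\<lambda>(\<nu>, j, k). wavelet M s (\<Psi> \<nu>) j k"
  let ?\<tau> = "\<lambda>(\<nu> :: nat, j :: int, k). (\<nu>, j, vgamma M s k)"
  have W: "?W i = E (?\<tau> i)" for i
    by (cases i) (auto simp: wavelet_def e_def rt_def fun_eq_iff)
  have inj: "inj (vgamma M s)" and surj: "range (vgamma M s) = vlattice M s"
    using bij_vgamma by (auto simp: bij_betw_def)
  have inj_\<tau>: "?\<tau> i = ?\<tau> i' \<longleftrightarrow> i = i'" for i i'
    using inj by (cases i, cases i') (auto dest: injD)
  have \<tau>_I: "?\<tau> ` ?I = level {1..} UNIV"
  proof (intro set_eqI iffI)
    fix i assume "i \<in> level {1..} UNIV"
    then obtain \<nu> j h where i: "i = (\<nu>, j, h)" "1 \<le> \<nu>" "\<nu> < abs_det M" "h \<in> vlattice M s"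
      by (auto simp: level_def)
    then obtain k where "h = vgamma M s k" using surj by blast
    then show "i \<in> ?\<tau> ` ?I" using i by (intro image_eqI[of _ _ "(\<nu>, j, k)"]) auto
  qed (use surj in \<open>auto simp: level_def\<close>)
  show ?thesis
    unfolding orthonormal_basis_def
  proof (intro conjI allI impI)
    show "orthonormal_system \<mu> ?I ?W"
      unfolding orthonormal_system_def W
    proof (intro conjI ballI)
      fix i assume "i \<in> ?I"
      then have i: "?\<tau> i \<in> level {1..} UNIV" using \<tau>_I by blast
      then show "L2_fun \<mu> (E (?\<tau> i))" by (rule L2_E)
      fix i' assume "i' \<in> ?I"
      then have i': "?\<tau> i' \<in> level {1..} UNIV" using \<tau>_I by blast
      have "L2_inner \<mu> (E (?\<tau> i)) (E (?\<tau> i')) = (if ?\<tau> i = ?\<tau> i' then 1 else 0)"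
        using orthonormal_wavelets i i' unfolding orthonormal_system_def by blast
      then show "L2_inner \<mu> (E (?\<tau> i)) (E (?\<tau> i')) = (if i = i' then 1 else 0)"
        by (simp only: inj_\<tau>)
    qed
    fix f :: "'d vseq \<Rightarrow> complex" and \<epsilon> :: real
    assume f: "L2_fun \<mu> f" and \<epsilon>: "0 < \<epsilon>"
    obtain w where w: "L2_fun \<mu> w" "L2_span \<mu> (level {1..} UNIV) E w" "L2_nrm \<mu> (\<lambda>x. f x - w x) < \<epsilon>"
      using wavelets_dense[OF f \<epsilon>] by blast
    obtain F c where F: "finite F" "F \<subseteq> level {1..} UNIV" "AE x in \<mu>. w x = (\<Sum>i\<in>F. c i * E i x)"
      using w(2) unfolding L2_span_def by blast
    obtain F' where F': "F' \<subseteq> ?I" "finite F'" "F = ?\<tau> ` F'"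
      using finite_subset_image[OF F(1), of ?\<tau> ?I] F(2) \<tau>_I by blast
    have sum: "(\<Sum>i\<in>F. c i * E i x) = (\<Sum>i\<in>F'. c (?\<tau> i) * ?W i x)" for x
      unfolding F'(3) W by (subst sum.reindex) (auto simp: inj_on_def inj_\<tau> simp del: prod.inject)
    have S: "L2_fun \<mu> (\<lambda>x. \<Sum>i\<in>F. c i * E i x)"
      using F(2) L2_E by (intro L2_fun_lin) blast
    have "L2_nrm \<mu> (\<lambda>x. f x - (\<Sum>i\<in>F. c i * E i x)) = L2_nrm \<mu> (\<lambda>x. f x - w x)"
    proof (rule L2_nrm_cong_AE)
      show "AE x in \<mu>. f x - (\<Sum>i\<in>F. c i * E i x) = f x - w x"
        using F(3) by eventually_elim simp
    qed (intro L2_fun_borel L2_fun_diff f w(1) S)+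
    then have "L2_nrm \<mu> (\<lambda>x. f x - (\<Sum>i\<in>F'. c (?\<tau> i) * ?W i x)) < \<epsilon>"
      using w(3) by (simp only: sum)
    then show "\<exists>F c. finite F \<and> F \<subseteq> ?I \<and> L2_nrm \<mu> (\<lambda>x. f x - (\<Sum>i\<in>F. c i * ?W i x)) < \<epsilon>"
      using F'(1,2) by (intro exI[of _ F'] exI[of _ "\<lambda>i. c (?\<tau> i)"] conjI)
  qed
qed

end

section \<open>From the hypotheses to an instance of \<open>wavelet_system\<close>\<close>

theorem theorem6:
  fixes M :: "int ^ 'd ^ 'd"
    and s t :: "nat \<Rightarrow> int ^ 'd"
    and \<mu> \<mu>' :: "'d vseq measure"
    and \<phi> :: "'d vseq \<Rightarrow> complex"
    and \<psi> :: "nat \<Rightarrow> 'd vseq \<Rightarrow> complex"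
  assumes "dilation_matrix M"
    and "digit_set M s"
    and "digit_set (transpose M) t"
    and "haar_measure M s \<mu>"
    and "haar_measure (transpose M) t \<mu>'"
    and "L2_fun \<mu> \<phi>"
    and "orthogonal_refinable M s \<mu> \<phi>"
    and "compactly_supported M s \<phi>"
    and "fourier M \<mu> \<phi> vzero = 1"
    and "wavelet_functions M s t \<mu> \<mu>' \<phi> \<psi>"
  shows "orthonormal_basis \<mu> ({1..<abs_det M} \<times> (UNIV :: int set) \<times> (UNIV :: nat set))
           (\<lambda>(\<nu>, j, k). wavelet M s (\<psi> \<nu>) j k)"
proof -
  have m2: "2 \<le> abs_det M" by (rule dilation_matrix_abs_det_ge_2[OF assms(1)])
  interpret vilenkin_dual M s t \<mu> \<mu>'
  proof (unfold_locales)
    show "2 \<le> abs_det (transpose M)" using m2 by (simp add: abs_det_def)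
  qed (use assms m2 in simp_all)
  obtain N where N: "\<And>x. x \<in> V \<Longrightarrow> \<phi> x \<noteq> 0 \<Longrightarrow> x \<in> cyl vzero (- int N)"
    using compact_support_cyl[OF assms(8)] by blast
  have int: "integrable \<mu> \<phi>" by (rule integrable_L2_compact_support[OF assms(6) N])
  obtain p :: "nat \<Rightarrow> 'd vseq \<Rightarrow> complex" where mask: "is_mask M s t \<mu> \<phi> (p 0)"
    and walsh: "\<And>\<nu>. \<nu> \<in> {1..<abs_det M} \<Longrightarrow> walsh_polynomial M s t (p \<nu>)"
    and unitary: "\<And>k l \<omega>. k < abs_det M \<Longrightarrow> l < abs_det M \<Longrightarrow> \<omega> \<in> V' \<Longrightarrow>
      (\<Sum>\<nu><abs_det M. p \<nu> (vshift (- 1) (\<omega> \<oplus>' digit_embed (t k))) *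
         cnj (p \<nu> (vshift (- 1) (\<omega> \<oplus>' digit_embed (t l))))) = (if k = l then 1 else 0)"
    and psi: "\<And>\<nu>. \<nu> \<in> {1..<abs_det M} \<Longrightarrow> has_fourier_L2 M \<mu> \<mu>' (\<psi> \<nu>)
            (\<lambda>\<omega>. p \<nu> (vshift (- 1) \<omega>) * fourier M \<mu> \<phi> (vshift (- 1) \<omega>))"
    using assms(10) unfolding wavelet_functions_def by (elim exE conjE) (rule that, assumption, blast, blast, blast)
  have "\<exists>Ga. \<nu> < abs_det M \<longrightarrow> finite (fst Ga) \<and> fst Ga \<subseteq> vlattice M s \<and>
      (\<forall>\<omega>\<in>V'. p \<nu> \<omega> = (\<Sum>g\<in>fst Ga. snd Ga g * vchar M g \<omega>))" for \<nu>
  proof (cases "\<nu> < abs_det M")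
    case True
    then have "walsh_polynomial M s t (p \<nu>)"
      using mask walsh[of \<nu>] by (cases "\<nu> = 0") (auto simp: is_mask_def)
    then show ?thesis
    proof (rule walsh_polynomial_vlattice)
      fix G a assume "finite G" "G \<subseteq> vlattice M s"
        "\<And>\<omega>. \<omega> \<in> V' \<Longrightarrow> p \<nu> \<omega> = (\<Sum>g\<in>G. a g * vchar M g \<omega>)"
      then show ?thesis by (intro exI[of _ "(G, a)"]) simp
    qed
  qed simp
  then have "\<forall>\<nu>. \<exists>Ga. \<nu> < abs_det M \<longrightarrow> finite (fst Ga) \<and> fst Ga \<subseteq> vlattice M s \<and>
      (\<forall>\<omega>\<in>V'. p \<nu> \<omega> = (\<Sum>g\<in>fst Ga. snd Ga g * vchar M g \<omega>))" by (rule allI)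
  from choice[OF this] obtain Ga where Ga: "\<forall>\<nu>. \<nu> < abs_det M \<longrightarrow> finite (fst (Ga \<nu>)) \<and> fst (Ga \<nu>) \<subseteq> vlattice M s \<and>
      (\<forall>\<omega>\<in>V'. p \<nu> \<omega> = (\<Sum>g\<in>fst (Ga \<nu>). snd (Ga \<nu>) g * vchar M g \<omega>))"
    by (elim exE)
  define G where "G \<nu> = fst (Ga \<nu>)" for \<nu>
  define a0 where "a0 \<nu> = snd (Ga \<nu>)" for \<nu>
  have G: "finite (G \<nu>)" "G \<nu> \<subseteq> vlattice M s"
      "\<And>\<omega>. \<omega> \<in> V' \<Longrightarrow> p \<nu> \<omega> = (\<Sum>g\<in>G \<nu>. a0 \<nu> g * vchar M g \<omega>)" if "\<nu> < abs_det M" for \<nu>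
    unfolding G_def a0_def using Ga that by simp_all
  have "finite (\<Union>\<nu><abs_det M. G \<nu>)" "(\<Union>\<nu><abs_det M. G \<nu>) \<subseteq> vlattice M s"
    using G(1,2) by auto
  then obtain n0 where n0: "(\<Union>\<nu><abs_det M. G \<nu>) \<subseteq> vfin (- int n0) 0"
    by (rule finite_subset_vlattice)
  \<comment> \<open>Extension by zero puts all masks on one finite subgroup, the common index set of
    the matrix argument.\<close>
  define a where "a \<nu> g = (if \<nu> < abs_det M \<and> g \<in> G \<nu> then a0 \<nu> g else 0)" for \<nu> g
  define \<Psi> where "\<Psi> \<nu> = (if \<nu> = 0 then \<phi> else \<psi> \<nu>)" for \<nu>
  have a_supp: "a \<nu> g = 0" if "g \<notin> vfin (- int n0) 0" for \<nu> g
    using that n0 by (auto simp: a_def)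
  have p_eq: "p \<nu> \<omega> = (\<Sum>g\<in>vfin (- int n0) 0. a \<nu> g * vchar M g \<omega>)" if "\<nu> < abs_det M" "\<omega> \<in> V'" for \<nu> \<omega>
  proof -
    have "p \<nu> \<omega> = (\<Sum>g\<in>G \<nu>. a \<nu> g * vchar M g \<omega>)"
      using G(3)[OF that] that by (simp add: a_def)
    also have "\<dots> = (\<Sum>g\<in>vfin (- int n0) 0. a \<nu> g * vchar M g \<omega>)"
    proof (rule sum.mono_neutral_left)
      show "G \<nu> \<subseteq> vfin (- int n0) 0" using n0 that by blast
    qed (auto simp: a_def)
    finally show ?thesis .
  qed
  have K: "vfin (- int n0) 0 \<subseteq> V" using vfin_V by blast
  \<comment> \<open>A concrete integrable function with the prescribed transform; injectivity then
    identifies it with \<phi> or with the wavelet function.\<close>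
  define r where "r \<nu> = refine (vfin (- int n0) 0) (a \<nu>) \<phi>" for \<nu>
  have r: "L2_fun \<mu> (r \<nu>)" "integrable \<mu> (r \<nu>)" for \<nu>
    unfolding r_def by (rule L2_fun_refine[OF int assms(6) K], rule integrable_refine[OF int assms(6) K])
  have fourier_r: "fourier M \<mu> (r \<nu>) \<omega> = p \<nu> (vshift (- 1) \<omega>) * fourier M \<mu> \<phi> (vshift (- 1) \<omega>)"
    if "\<nu> < abs_det M" "\<omega> \<in> V'" for \<nu> \<omega>
    unfolding r_def fourier_refine[OF int assms(6) K that(2)] p_eq[OF that(1) dual.vshift_V[OF that(2)]] ..
  have r_0: "AE x in \<mu>. \<phi> x = r 0 x"
  proof (rule fourier_inject[OF int assms(6) r(2) r(1)])
    fix \<omega> assume \<omega>: "\<omega> \<in> V'"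
    have "fourier M \<mu> \<phi> \<omega> = p 0 (vshift (- 1) \<omega>) * fourier M \<mu> \<phi> (vshift (- 1) \<omega>)"
      using mask \<omega> unfolding is_mask_def by blast
    also have "\<dots> = fourier M \<mu> (r 0) \<omega>"
      by (rule fourier_r[symmetric]) (use m2 \<omega> in auto)
    finally show "fourier M \<mu> \<phi> \<omega> = fourier M \<mu> (r 0) \<omega>" .
  qed
  have r_pos: "AE x in \<mu>. \<psi> \<nu> x = r \<nu> x" if "0 < \<nu>" "\<nu> < abs_det M" for \<nu>
  proof -
    have "\<nu> \<in> {1..<abs_det M}" using that by simp
    from has_fourier_L2_inject[OF psi[OF this] r(2) r(1) fourier_r[OF that(2)]] show ?thesis .
  qed
  have refine: "AE x in \<mu>. \<Psi> \<nu> x = refine (vfin (- int n0) 0) (a \<nu>) (\<Psi> 0) x" if "\<nu> < abs_det M" for \<nu>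
    using r_0 r_pos[of \<nu>] that by (cases "\<nu> = 0") (simp_all add: \<Psi>_def r_def)
  interpret wavelet_system M s t \<mu> \<mu>' \<Psi> p a n0 N
  proof (unfold_locales)
    show "L2_fun \<mu> (\<Psi> \<nu>)" if "\<nu> < abs_det M" for \<nu>
      using psi[of \<nu>] that assms(6) by (simp add: \<Psi>_def has_fourier_L2_def)
    \<comment> \<open>At \<open>vzero\<close> every character is 1, so the normalisation of the
      transform is one of the integral.\<close>
    show "(LINT x|\<mu>. \<Psi> 0 x) = 1"
      using assms(9) by (simp add: \<Psi>_def fourier_def)
    show "orthonormal_system \<mu> (vlattice M s) (\<lambda>h x. \<Psi> 0 (x \<oplus> h))"
      using assms(7) by (simp add: \<Psi>_def orthogonal_refinable_def)
    show "x \<in> cyl vzero (- int N)" if "x \<in> V" "\<Psi> 0 x \<noteq> 0" for x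
      using N that by (simp add: \<Psi>_def)
  qed (fact a_supp p_eq unitary refine)+
  show ?thesis
    by (rule orthonormal_basis_cong[OF orthonormal_basis_wavelets]) (auto simp: \<Psi>_def)
qed

end
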